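(* Let $\mu\in\mathbb R$ and let $\epsilon$ be a real number with $\epsilon\neq 1$. Let $\xi_\mu(x,a)=\frac12-\frac12\,\mathrm{Erf}(\mu(x-a))$, let $(M\varphi)(t)=e^{-t}\varphi(t)$, and let $\tilde M_\mu$ be the operator defined for $\varphi\in L^2(m)$ by $$(\tilde M_\mu\varphi)(t):=(M\varphi)(t)-\frac1t\int_0^t s\,(M\varphi)(s)\,\mathcal L^{-1}\Big[\xi_\mu\Big(\frac1x,\frac{\epsilon}{1-\epsilon}\Big)\Big](t-s)\,ds,\qquad t>0 .$$ Then, for every $\varphi\in L^2(m)$, $$(\tilde M_\mu\varphi)(t)=\frac12\Big(1-\mathrm{Erf}\Big(\frac{\mu\,\epsilon}{1-\epsilon}\Big)\Big)(M\varphi)(t)+\frac1{\sqrt\pi}\sum_{n=0}^\infty\ \sum_{k=1}^{2n+1}\binom{2n+1}{k}\frac{(-1)^{n+k-1}\mu^{2n+1}}{n!\,(k-1)!\,(2n+1)}\Big(\frac{\epsilon}{1-\epsilon}\Big)^{2n+1-k}\ \frac1t\int_0^t s\,(M\varphi)(s)\,(t-s)^{k-1}\,ds ,$$ where the series over $n$ converges in $L^2(m)$ and the equality holds in $L^2(m)$; moreover $\tilde M_\mu$ is a bounded operator $\tilde M_\mu:L^2(m)\to L^2(m)$.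
   Context: $L^2(m):=L^2(\mathbb R^+,m)$ is the Hilbert space of (classes of) measurable functions $\varphi:(0,\infty)\to\mathbb C$ with $\int_0^\infty|\varphi(t)|^2\,dm(t)<\infty$, where $m$ is the measure on $\mathbb R^+=(0,\infty)$ given by $dm(t)=t e^{-t}\,dt$. $\mathrm{Erf}(x):=\frac{2}{\sqrt\pi}\int_0^x e^{-t^2}\,dt$ is the error function. Inverse Laplace transform: $\mathcal L[\kappa](x)=\int_{[0,\infty)}e^{-xt}\,d\kappa(t)$ denotes the Laplace transform. For a function $g$ of $x>0$, $\mathcal L^{-1}[g]$ denotes the (unique) complex Borel measure $\kappa$ on $[0,\infty)$ (finite on bounded sets, with $\int_{[0,\infty)} e^{-xt}\,d|\kappa|(t)<\infty$ for all $x>0$) such that $\mathcal L[\kappa](x)=g(x)$ for all $x>0$. It is written as a generalized function of $t$ and may contain a multiple of the Dirac delta $\delta_0$ at the origin, e.g. $\mathcal L^{-1}[1](t)=\delta_0(t)$ and $\mathcal L^{-1}[x^{-k}](t)=\frac{t^{k-1}}{(k-1)!}$ for integers $k\ge1$. In $\mathcal L^{-1}\big[\xi_\mu(\frac1x,a)\big]$ the transform is inverted with respect to the variable $x$, with $a$ fixed. The convolution integral $\int_0^t h(s)\,\mathcal L^{-1}[g](t-s)\,ds$ means $\int_{[0,t]}h(t-u)\,d\kappa(u)$ with $\kappa=\mathcal L^{-1}[g]$; in particular $\int_0^t h(s)\,\delta_0(t-s)\,ds=h(t)$. The double sum is read as an iterated sum: for each $n$ the finite sum over $k$ is taken first, and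 then the series over $n$. A zeroth power equals $1$, also when its base is $0$ (relevant for $\epsilon=0$, $k=2n+1$). *)

theory Defs
  imports "HOL-Analysis.Analysis"
begin

section \<open>Complex $L^2$ spaces\<close>

text \<open>
  Elements of $L^2$ are handled through representatives: equality in $L^2(M)$ is equality
  almost everywhere, and \<open>L2_norm M\<close> is the $L^2$ norm of the class.
\<close>

definition L2 :: "'a measure \<Rightarrow> ('a \<Rightarrow> complex) set" where
  "L2 M = {f. f \<in> borel_measurable M \<and> integrable M (\<lambda>x. (norm (f x))\<^sup>2)}"

definition L2_norm :: "'a measure \<Rightarrow> ('a \<Rightarrow> complex) \<Rightarrow> real" where
  "L2_norm M f = sqrt (LINT x|M. (norm (f x))\<^sup>2)"

definition L2_sums :: "'a measure \<Rightarrow> (nat \<Rightarrow> 'a \<Rightarrow> complex) \<Rightarrow> ('a \<Rightarrow> complex) \<Rightarrow> bool" where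
  "L2_sums M f s \<longleftrightarrow> (\<forall>n. f n \<in> L2 M) \<and> s \<in> L2 M \<and>
     (\<lambda>N. L2_norm M (\<lambda>x. (\<Sum>n<N. f n x) - s x)) \<longlonglongrightarrow> 0"

text \<open>The second condition says that \<open>T\<close> acts on classes modulo equality almost everywhere.\<close>

definition bounded_operator_L2 ::
    "'a measure \<Rightarrow> (('a \<Rightarrow> complex) \<Rightarrow> 'a \<Rightarrow> complex) \<Rightarrow> bool" where
  "bounded_operator_L2 M T \<longleftrightarrow>
     (\<forall>f\<in>L2 M. T f \<in> L2 M) \<and>
     (\<forall>f\<in>L2 M. \<forall>g\<in>L2 M. (AE x in M. f x = g x) \<longrightarrow> (AE x in M. T f x = T g x)) \<and>
     (\<forall>f\<in>L2 M. \<forall>g\<in>L2 M. AE x in M. T (\<lambda>y. f y + g y) x = T f x + T g x) \<and>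
     (\<forall>c. \<forall>f\<in>L2 M. AE x in M. T (\<lambda>y. c * f y) x = c * T f x) \<and>
     (\<exists>C. \<forall>f\<in>L2 M. L2_norm M (T f) \<le> C * L2_norm M f)"

text \<open>The measure $dm(t) = t e^{-t}\,dt$ on $(0,\infty)$.\<close>

definition m_measure :: "real measure" where
  "m_measure = density (restrict_space lborel {0<..}) (\<lambda>t. ennreal (t * exp (- t)))"


section \<open>Locally finite complex Borel measures on the half-line\<close>

definition bounded_borel :: "real set set" where
  "bounded_borel = {A \<in> sets borel. A \<subseteq> {0..} \<and> bounded A}"

text \<open>
  A complex measure that is finite on bounded sets need not have a value on unbounded sets
  (its total variation may be infinite there), so it is a countably additive set function on
  the bounded Borel subsets of $[0,\infty)$. The value 0 on all other sets is a convention that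
  makes equality of such measures coincide with equality of HOL functions.
\<close>

definition lf_complex_measure :: "(real set \<Rightarrow> complex) \<Rightarrow> bool" where
  "lf_complex_measure \<kappa> \<longleftrightarrow>
     (\<forall>A. range A \<subseteq> bounded_borel \<longrightarrow> disjoint_family A \<longrightarrow> bounded (\<Union>n::nat. A n) \<longrightarrow>
        (\<lambda>n. \<kappa> (A n)) sums \<kappa> (\<Union>n. A n)) \<and>
     (\<forall>A. A \<notin> bounded_borel \<longrightarrow> \<kappa> A = 0)"

text \<open>
  The total variation $|\kappa|$, a positive Borel measure on $[0,\infty)$. The supremum runs
  over finite disjoint families of bounded Borel subsets of \<open>A\<close>, and hence also gives the right
  value for unbounded \<open>A\<close>.
\<close>

definition total_variation :: "(real set \<Rightarrow> complex) \<Rightarrow> real measure" where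
  "total_variation \<kappa> = measure_of {0..} (sets (restrict_space borel {0..}))
     (\<lambda>A. SUP P\<in>{P. finite P \<and> disjoint P \<and> P \<subseteq> bounded_borel \<and> \<Union>P \<subseteq> A}.
            ennreal (\<Sum>B\<in>P. norm (\<kappa> B)))"

text \<open>
  The polar decomposition $d\kappa = h\,d|\kappa|$ with $|h| = 1$; the density \<open>h\<close> is unique up to
  $|\kappa|$-null sets, so the choice does not affect integrals.
\<close>

definition polar_density :: "(real set \<Rightarrow> complex) \<Rightarrow> real \<Rightarrow> complex" where
  "polar_density \<kappa> = (SOME h. h \<in> borel_measurable (total_variation \<kappa>) \<and> (\<forall>t. norm (h t) = 1) \<and>
     (\<forall>A\<in>bounded_borel. \<kappa> A = (LINT t:A|total_variation \<kappa>. h t)))"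

definition cm_integral :: "(real set \<Rightarrow> complex) \<Rightarrow> (real \<Rightarrow> complex) \<Rightarrow> complex" where
  "cm_integral \<kappa> f = (LINT t|total_variation \<kappa>. f t * polar_density \<kappa> t)"


section \<open>Laplace transform\<close>

definition laplace :: "(real set \<Rightarrow> complex) \<Rightarrow> real \<Rightarrow> complex" where
  "laplace \<kappa> x = cm_integral \<kappa> (\<lambda>t. of_real (exp (- (x * t))))"

definition inverse_laplace :: "(real \<Rightarrow> complex) \<Rightarrow> real set \<Rightarrow> complex" where
  "inverse_laplace g = (THE \<kappa>. lf_complex_measure \<kappa> \<and>
     (\<forall>x>0. (\<integral>\<^sup>+ t. ennreal (exp (- (x * t))) \<partial>total_variation \<kappa>) < \<infinity>) \<and>
     (\<forall>x>0. laplace \<kappa> x = g x))"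

text \<open>The convolution $\int_{[0,t]} h(t-u)\,d\kappa(u)$.\<close>

definition convolution :: "(real \<Rightarrow> complex) \<Rightarrow> (real set \<Rightarrow> complex) \<Rightarrow> real \<Rightarrow> complex" where
  "convolution h \<kappa> t = cm_integral \<kappa> (\<lambda>u. indicator {0..t} u * h (t - u))"


section \<open>The operators\<close>

text \<open>The interval integral is oriented, so this is also the error function for negative \<open>x\<close>.\<close>

definition Erf :: "real \<Rightarrow> real" where
  "Erf x = 2 / sqrt pi * (LBINT t=0..ereal x. exp (- t\<^sup>2))"

definition \<xi> :: "real \<Rightarrow> real \<Rightarrow> real \<Rightarrow> real" where
  "\<xi> \<mu> x a = 1 / 2 - 1 / 2 * Erf (\<mu> * (x - a))"

definition M_op :: "(real \<Rightarrow> complex) \<Rightarrow> real \<Rightarrow> complex" where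
  "M_op \<phi> t = of_real (exp (- t)) * \<phi> t"

text \<open>
  The function $s\,(M\varphi)(s)$ below vanishes at $s = 0$, so only the values of
  $\varphi$ on $(0,\infty)$ enter at points $t > 0$.
\<close>

definition M_tilde :: "real \<Rightarrow> real \<Rightarrow> (real \<Rightarrow> complex) \<Rightarrow> real \<Rightarrow> complex" where
  "M_tilde \<mu> \<epsilon> \<phi> t = M_op \<phi> t - 1 / of_real t *
     convolution (\<lambda>s. of_real s * M_op \<phi> s)
       (inverse_laplace (\<lambda>x. of_real (\<xi> \<mu> (1 / x) (\<epsilon> / (1 - \<epsilon>))))) t"

end

theory Submission
  imports Defs "HOL-Probability.Distributions"
begin

text \<open>
Put $a = \epsilon/(1-\epsilon)$. Expanding the error function into its power series and each power
$(\mu(\frac1x - a))^{2n+1}$ by the binomial theorem turns $\xi_\mu(\frac1x, a)$ into a series in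
powers of $\frac1x$. Its constant part is $c = \frac12(1 + \mathrm{Erf}(\mu a))$, and since $x^{-k}$
is the Laplace transform of $t^{k-1}/(k-1)!$, the remaining part is $-\int_0^\infty e^{-xt} w(t)\,dt$,
where $\sqrt\pi\,w = \sum_n p_n$ and $p_n$ is the polynomial formed by the inner sum of the theorem.
Hence $\mathcal L^{-1}[\xi_\mu(\frac1x,a)] = c\,\delta_0 - w(t)\,dt$, and inserting this into the
definition of $\tilde M_\mu$ gives the formula; the factor in front of $M\varphi$ is $1 - c$.

The analytic part rests on one estimate: for every rate $q > 0$,
$|p_n(u)| \le C_n e^{qu}$ with $\sum_n C_n < \infty$ (\<open>kernel_term_le\<close>, \<open>kernel_bound_summable\<close>).
With $q = x/2$ it permits to integrate term by term in the Laplace transform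
(\<open>kernel_laplace\<close>). With $q = \frac14$ it controls the Volterra operators
$\varphi \mapsto \frac1t\int_0^t s\,(M\varphi)(s)\,K(t-s)\,ds$: if $|K(u)| \le C e^{u/4}$, then
the exponential may be bounded by $e^{t/4}$ and Cauchy-Schwarz in $L^2(m)$ on the interval $(0,t)$,
whose $m$-measure is at most $t^2$, yields the pointwise bound $C e^{t/4}\,\|\varphi\|$
(\<open>volterra_le\<close>). The function $e^{t/4}$ has $L^2(m)$-norm $2$, so the norm of such an operator is at
most $2C$. Applied to the kernel itself this is boundedness, applied to the tails of the series
it is convergence in $L^2(m)$.

The measure-theoretic part makes the inverse Laplace transform accessible: it is given by a definite
description, so existence and uniqueness both have to be shown. The total variation of a countably additive set function
on the bounded Borel sets is a measure (\<open>variation_countably_additive\<close>). If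
$\kappa = f\,d\nu$ with a positive measure $\nu$, then $|\kappa| = |f|\,d\nu$ and integrals against
$\kappa$ are integrals against $f\,d\nu$ (\<open>total_variation_density\<close>, \<open>cm_integral_density\<close>). The
Radon-Nikodym theorem provides such a density for every candidate $\kappa$, with $\nu = |\kappa|$
(\<open>lf_complex_measure_has_density\<close>). Finally, the values of the Laplace transform at the positive
integers are the moments of $\kappa$ in the variable $y = e^{-t} \in [0,1]$, and by the Weierstrass
approximation theorem they determine $\kappa$ (\<open>laplace_moments_unique\<close>).
\<close>

section \<open>Locally finite complex measures\<close>

lemma halfline_sets: "A \<in> sets (restrict_space borel {0::real..}) \<longleftrightarrow> A \<in> sets borel \<and> A \<subseteq> {0..}"
  by (subst sets_restrict_space_iff) auto

lemma bounded_borel_subset: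
  assumes "A \<in> bounded_borel" "B \<in> sets borel" "B \<subseteq> A"
  shows "B \<in> bounded_borel"
  using assms bounded_subset by (auto simp: bounded_borel_def)

lemma bounded_borel_cut: "A \<in> sets borel \<Longrightarrow> A \<inter> {0..b} \<in> bounded_borel"
  using bounded_subset[OF bounded_closed_interval, of _ 0 b] by (auto simp: bounded_borel_def)

lemma bounded_borel_halfline:
  "A \<in> bounded_borel \<Longrightarrow> A \<in> sets (restrict_space borel {0..})"
  by (auto simp: bounded_borel_def halfline_sets)

lemma bounded_borel_subset_cut:
  assumes "A \<in> bounded_borel"
  obtains N :: nat where "A \<subseteq> {0..<real N}"
proof -
  obtain b where b: "\<And>x. x \<in> A \<Longrightarrow> \<bar>x\<bar> \<le> b"
    using assms by (auto simp: bounded_borel_def bounded_iff)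
  obtain N where "b < real N" using reals_Archimedean2 by blast
  then have "A \<subseteq> {0..<real N}"
    using assms b by (fastforce simp: bounded_borel_def)
  then show ?thesis using that by blast
qed

lemma lf_sums:
  assumes "lf_complex_measure \<kappa>" "\<And>n. A n \<in> bounded_borel" "disjoint_family A" "bounded (\<Union>n. A n)"
  shows "(\<lambda>n. \<kappa> (A n)) sums \<kappa> (\<Union>n. A n)"
  using assms unfolding lf_complex_measure_def by (auto simp: image_subset_iff)

lemma lf_outside: "lf_complex_measure \<kappa> \<Longrightarrow> A \<notin> bounded_borel \<Longrightarrow> \<kappa> A = 0"
  unfolding lf_complex_measure_def by blast

text \<open>
The constant sequence of empty sets is a disjoint family, and a convergent series with constant terms
vanishes.
\<close>

lemma lf_empty: "lf_complex_measure \<kappa> \<Longrightarrow> \<kappa> {} = 0"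
  using lf_sums[of \<kappa> "\<lambda>_. {}"]
  by (simp add: bounded_borel_def disjoint_family_on_def sums_iff summable_const_iff)

lemma lf_Un:
  assumes "lf_complex_measure \<kappa>" "A \<in> bounded_borel" "B \<in> bounded_borel" "A \<inter> B = {}"
  shows "\<kappa> (A \<union> B) = \<kappa> A + \<kappa> B"
proof -
  have "(\<lambda>n. \<kappa> (binaryset A B n)) sums \<kappa> (\<Union>n. binaryset A B n)"
  proof (rule lf_sums[OF assms(1)])
    show "binaryset A B n \<in> bounded_borel" for n
      using assms by (auto simp: binaryset_def bounded_borel_def)
    show "disjoint_family (binaryset A B)"
      using assms by (auto simp: binaryset_def disjoint_family_on_def)
    show "bounded (\<Union>n. binaryset A B n)"
      using assms by (auto simp: UN_binaryset_eq bounded_borel_def)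
  qed
  then show ?thesis
    using binaryset_sums[of \<kappa> A B] lf_empty[OF assms(1)] by (simp add: UN_binaryset_eq sums_unique2)
qed

section \<open>The total variation as a measure\<close>

text \<open>
The set function from which the total variation is built, on all sets at once and before it is
known to be a measure.
\<close>

definition variation :: "(real set \<Rightarrow> complex) \<Rightarrow> real set \<Rightarrow> ennreal" where
  "variation \<kappa> A = (SUP P\<in>{P. finite P \<and> disjoint P \<and> P \<subseteq> bounded_borel \<and> \<Union>P \<subseteq> A}.
     ennreal (\<Sum>B\<in>P. norm (\<kappa> B)))"

lemma variation_upper:
  assumes "finite P" "disjoint P" "P \<subseteq> bounded_borel" "\<Union>P \<subseteq> A"
  shows "ennreal (\<Sum>B\<in>P. norm (\<kappa> B)) \<le> variation \<kappa> A"
  unfolding variation_def by (rule SUP_upper) (use assms in auto)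

lemma variation_least:
  assumes "\<And>P. finite P \<Longrightarrow> disjoint P \<Longrightarrow> P \<subseteq> bounded_borel \<Longrightarrow> \<Union>P \<subseteq> A \<Longrightarrow>
    ennreal (\<Sum>B\<in>P. norm (\<kappa> B)) \<le> C"
  shows "variation \<kappa> A \<le> C"
  unfolding variation_def by (rule SUP_least) (use assms in auto)

lemma variation_mono: "A \<subseteq> B \<Longrightarrow> variation \<kappa> A \<le> variation \<kappa> B"
  by (rule variation_least, rule variation_upper) auto

lemma variation_ge_norm:
  assumes "A \<in> bounded_borel"
  shows "ennreal (norm (\<kappa> A)) \<le> variation \<kappa> A"
  using variation_upper[of "{A}" A \<kappa>] assms by simp

lemma variation_empty:
  assumes "lf_complex_measure \<kappa>"
  shows "variation \<kappa> {} = 0"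
proof -
  have "variation \<kappa> {} \<le> 0"
  proof (rule variation_least)
    fix P :: "real set set" assume "\<Union>P \<subseteq> {}"
    then have "\<And>B. B \<in> P \<Longrightarrow> B = {}" by auto
    then have "(\<Sum>B\<in>P. norm (\<kappa> B)) = 0"
      by (intro sum.neutral) (use lf_empty[OF assms] in auto)
    then show "ennreal (\<Sum>B\<in>P. norm (\<kappa> B)) \<le> 0" by simp
  qed
  then show ?thesis by simp
qed

text \<open>
The union of a finite disjoint family inside \<open>A\<close> and one inside \<open>B\<close> is such a family inside \<open>A \<union> B\<close>. The two
can share only the empty set, which does not contribute to the sums.
\<close>

lemma variation_superadditive:
  assumes "lf_complex_measure \<kappa>" "A \<inter> B = {}"
  shows "variation \<kappa> A + variation \<kappa> B \<le> variation \<kappa> (A \<union> B)"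
proof -
  let ?F = "\<lambda>A. {P. finite P \<and> disjoint P \<and> P \<subseteq> bounded_borel \<and> \<Union>P \<subseteq> A}"
  have ne: "?F A \<noteq> {}" for A by (auto intro!: exI[of _ "{}"])
  have "ennreal (\<Sum>C\<in>P. norm (\<kappa> C)) + ennreal (\<Sum>C\<in>Q. norm (\<kappa> C)) \<le> variation \<kappa> (A \<union> B)"
    if "P \<in> ?F A" "Q \<in> ?F B" for P Q
  proof -
    have "P \<inter> Q \<subseteq> {{}}" using that assms(2) by fastforce
    then have "(\<Sum>C\<in>P \<inter> Q. norm (\<kappa> C)) = 0"
      by (intro sum.neutral) (use lf_empty[OF assms(1)] in auto)
    then have "(\<Sum>C\<in>P. norm (\<kappa> C)) + (\<Sum>C\<in>Q. norm (\<kappa> C)) = (\<Sum>C\<in>P \<union> Q. norm (\<kappa> C))"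
      using that sum.union_inter[of P Q "\<lambda>C. norm (\<kappa> C)"] by simp
    moreover have "ennreal (\<Sum>C\<in>P \<union> Q. norm (\<kappa> C)) \<le> variation \<kappa> (A \<union> B)"
    proof (rule variation_upper)
      show "disjoint (P \<union> Q)"
        using that assms(2) by (intro disjoint_union) blast+
    qed (use that in auto)
    ultimately show ?thesis by (simp add: ennreal_plus[symmetric] sum_nonneg del: ennreal_plus)
  qed
  then have "(SUP P\<in>?F A. SUP Q\<in>?F B. ennreal (\<Sum>C\<in>P. norm (\<kappa> C)) + ennreal (\<Sum>C\<in>Q. norm (\<kappa> C)))
      \<le> variation \<kappa> (A \<union> B)"
    by (intro SUP_least)
  moreover have "(SUP Q\<in>?F B. ennreal (\<Sum>C\<in>P. norm (\<kappa> C)) + ennreal (\<Sum>C\<in>Q. norm (\<kappa> C)))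
      = ennreal (\<Sum>C\<in>P. norm (\<kappa> C)) + variation \<kappa> B" for P
    unfolding variation_def using ennreal_SUP_add_right[OF ne] by simp
  moreover have "(SUP P\<in>?F A. ennreal (\<Sum>C\<in>P. norm (\<kappa> C)) + variation \<kappa> B)
      = variation \<kappa> A + variation \<kappa> B"
    unfolding variation_def[of \<kappa> A] using ennreal_SUP_add_left[OF ne] by simp
  ultimately show ?thesis by simp
qed

text \<open>
Subadditivity: every member \<open>B\<close> of a finite family is cut into its traces on the \<open>A i\<close>, and
$|\kappa(B)| \le \sum_i |\kappa(B \cap A_i)|$ by countable additivity of $\kappa$. The converse follows from
finite superadditivity by a limit.
\<close>

lemma variation_countably_additive:
  assumes \<kappa>: "lf_complex_measure \<kappa>"
  shows "countably_additive (sets (restrict_space borel {0..})) (variation \<kappa>)"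
  unfolding countably_additive_def
proof (intro allI impI antisym)
  fix A :: "nat \<Rightarrow> real set"
  assume A: "range A \<subseteq> sets (restrict_space borel {0..})" and dis: "disjoint_family A"
  have fin: "(\<Sum>i<n. variation \<kappa> (A i)) \<le> variation \<kappa> (\<Union>i<n. A i)" for n
  proof (induction n)
    case (Suc n)
    have "(\<Union>i<n. A i) \<inter> A n = {}"
    proof -
      have "A i \<inter> A n = {}" if "i < n" for i
        using that disjoint_family_onD[OF dis, of i n] by simp
      then show ?thesis by blast
    qed
    then have "variation \<kappa> (\<Union>i<n. A i) + variation \<kappa> (A n) \<le> variation \<kappa> ((\<Union>i<n. A i) \<union> A n)"
      by (rule variation_superadditive[OF \<kappa>])
    moreover have "(\<Union>i<n. A i) \<union> A n = (\<Union>i<Suc n. A i)"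
      unfolding lessThan_Suc by blast
    ultimately have "variation \<kappa> (\<Union>i<n. A i) + variation \<kappa> (A n) \<le> variation \<kappa> (\<Union>i<Suc n. A i)"
      by (simp only:)
    with add_right_mono[OF Suc, of "variation \<kappa> (A n)"]
    have "(\<Sum>i<n. variation \<kappa> (A i)) + variation \<kappa> (A n) \<le> variation \<kappa> (\<Union>i<Suc n. A i)"
      by (rule order_trans)
    then show ?case by (simp only: sum.lessThan_Suc)
  qed simp
  show "(\<Sum>i. variation \<kappa> (A i)) \<le> variation \<kappa> (\<Union>i. A i)"
  proof (rule suminf_le_const)
    fix n
    have "variation \<kappa> (\<Union>i<n. A i) \<le> variation \<kappa> (\<Union>i. A i)" by (rule variation_mono) auto
    with fin[of n] show "(\<Sum>i<n. variation \<kappa> (A i)) \<le> variation \<kappa> (\<Union>i. A i)"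
      by (rule order_trans)
  qed simp
  show "variation \<kappa> (\<Union>i. A i) \<le> (\<Sum>i. variation \<kappa> (A i))"
  proof (rule variation_least)
    fix P assume P: "finite P" "disjoint P" "P \<subseteq> bounded_borel" "\<Union>P \<subseteq> (\<Union>i. A i)"
    have bb: "B \<inter> A i \<in> bounded_borel" if "B \<in> P" for B i
      using bounded_borel_subset[of B "B \<inter> A i"] that P(3) A
      by (auto simp: bounded_borel_def halfline_sets image_subset_iff)
    have 1: "ennreal (norm (\<kappa> B)) \<le> (\<Sum>i. ennreal (norm (\<kappa> (B \<inter> A i))))" if B: "B \<in> P" for B
    proof -
      have eq: "(\<Union>i. B \<inter> A i) = B" using B P(4) by auto
      have "(\<lambda>i. \<kappa> (B \<inter> A i)) sums \<kappa> (\<Union>i. B \<inter> A i)"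
      proof (rule lf_sums[OF \<kappa> bb[OF B]])
        show "disjoint_family (\<lambda>i. B \<inter> A i)"
          using dis by (auto simp: disjoint_family_on_def)
        show "bounded (\<Union>i. B \<inter> A i)"
          unfolding eq using B P(3) by (auto simp: bounded_borel_def)
      qed
      then have "(\<lambda>n. ennreal (norm (\<Sum>i<n. \<kappa> (B \<inter> A i)))) \<longlonglongrightarrow> ennreal (norm (\<kappa> B))"
        unfolding eq sums_def by (intro tendsto_ennrealI tendsto_norm)
      then show ?thesis
      proof (rule LIMSEQ_le_const2, intro exI allI impI)
        fix n
        have "ennreal (norm (\<Sum>i<n. \<kappa> (B \<inter> A i))) \<le> (\<Sum>i<n. ennreal (norm (\<kappa> (B \<inter> A i))))"
          by (simp add: sum_ennreal) (intro ennreal_leI norm_sum)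
        also have "\<dots> \<le> (\<Sum>i. ennreal (norm (\<kappa> (B \<inter> A i))))"
          by (intro sum_le_suminf) auto
        finally show "ennreal (norm (\<Sum>i<n. \<kappa> (B \<inter> A i))) \<le> (\<Sum>i. ennreal (norm (\<kappa> (B \<inter> A i))))" .
      qed
    qed
    have 2: "(\<Sum>B\<in>P. ennreal (norm (\<kappa> (B \<inter> A i)))) \<le> variation \<kappa> (A i)" for i
    proof -
      have "(\<Sum>C\<in>(\<lambda>B. B \<inter> A i) ` P. norm (\<kappa> C)) = (\<Sum>B\<in>P. norm (\<kappa> (B \<inter> A i)))"
      proof (subst sum.reindex_nontrivial[OF P(1)])
        fix B C assume "B \<in> P" "C \<in> P" "B \<noteq> C" "B \<inter> A i = C \<inter> A i"
        then have "B \<inter> A i = {}" using P(2) by (auto simp: disjoint_def)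
        then show "norm (\<kappa> (B \<inter> A i)) = 0" using lf_empty[OF \<kappa>] by simp
      qed simp
      moreover have "ennreal (\<Sum>C\<in>(\<lambda>B. B \<inter> A i) ` P. norm (\<kappa> C)) \<le> variation \<kappa> (A i)"
      proof (rule variation_upper)
        show "disjoint ((\<lambda>B. B \<inter> A i) ` P)"
          unfolding disjoint_def
        proof (intro ballI impI)
          fix S T assume "S \<in> (\<lambda>B. B \<inter> A i) ` P" "T \<in> (\<lambda>B. B \<inter> A i) ` P" "S \<noteq> T"
          then obtain B C where "B \<in> P" "C \<in> P" "B \<noteq> C" "S = B \<inter> A i" "T = C \<inter> A i" by auto
          then show "S \<inter> T = {}" using P(2) by (auto simp: disjoint_def)
        qed
      qed (use P bb in auto)
      ultimately show ?thesis by (simp add: sum_ennreal)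
    qed
    have "ennreal (\<Sum>B\<in>P. norm (\<kappa> B)) = (\<Sum>B\<in>P. ennreal (norm (\<kappa> B)))"
      by (simp add: sum_ennreal)
    also have "\<dots> \<le> (\<Sum>B\<in>P. \<Sum>i. ennreal (norm (\<kappa> (B \<inter> A i))))"
      by (intro sum_mono 1)
    also have "\<dots> = (\<Sum>i. \<Sum>B\<in>P. ennreal (norm (\<kappa> (B \<inter> A i))))"
      by (rule suminf_sum[symmetric]) simp
    also have "\<dots> \<le> (\<Sum>i. variation \<kappa> (A i))"
      by (intro suminf_le 2) auto
    finally show "ennreal (\<Sum>B\<in>P. norm (\<kappa> B)) \<le> (\<Sum>i. variation \<kappa> (A i))" .
  qed
qed

lemma total_variation_eq:
  "total_variation \<kappa> = measure_of {0..} (sets (restrict_space borel {0..})) (variation \<kappa>)"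
  unfolding total_variation_def variation_def[abs_def] ..

lemma sets_total_variation [measurable_cong]:
  "sets (total_variation \<kappa>) = sets (restrict_space borel {0..})"
  unfolding total_variation_eq
  using sets.sigma_sets_eq[of "restrict_space borel {0::real..}"] sets.space_closed[of "restrict_space borel {0::real..}"]
  by (simp add: space_restrict_space)

lemma space_total_variation: "space (total_variation \<kappa>) = {0..}"
  using sets_eq_imp_space_eq[OF sets_total_variation] by (simp add: space_restrict_space)

lemma emeasure_total_variation:
  assumes "lf_complex_measure \<kappa>" "A \<in> sets (restrict_space borel {0..})"
  shows "emeasure (total_variation \<kappa>) A = variation \<kappa> A"
  unfolding total_variation_eq
proof (rule emeasure_measure_of_sigma)
  show "sigma_algebra {0..} (sets (restrict_space borel {0::real..}))"
    using sets.sigma_algebra_axioms[of "restrict_space borel {0::real..}"] by (simp add: space_restrict_space)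
  show "positive (sets (restrict_space borel {0..})) (variation \<kappa>)"
    using variation_empty[OF assms(1)] by (simp add: positive_def)
qed (use variation_countably_additive assms in auto)

section \<open>Complex measures given by a density\<close>

text \<open>
In contrast to \<open>density_unique_banach\<close> this holds on arbitrary measure spaces, which is needed because
a measure that carries a locally integrable density may fail to be $\sigma$-finite where the density vanishes.
\<close>

lemma density_unique_complex:
  fixes f g :: "'a \<Rightarrow> complex"
  assumes f: "integrable M f" and g: "integrable M g"
    and eq: "\<And>A. A \<in> sets M \<Longrightarrow> (LINT x:A|M. f x) = (LINT x:A|M. g x)"
  shows "AE x in M. f x = g x"
proof -
  have re: "(LINT x:A|M. Re (u x)) = Re (LINT x:A|M. u x)"
    and im: "(LINT x:A|M. Im (u x)) = Im (LINT x:A|M. u x)"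
    if "A \<in> sets M" "integrable M u" for A and u :: "'a \<Rightarrow> complex"
    unfolding set_lebesgue_integral_def
    using integral_Re[OF integrable_mult_indicator[OF that]] integral_Im[OF integrable_mult_indicator[OF that]]
    by (simp_all add: scaleR_conv_of_real)
  have "AE x in M. Re (f x) = Re (g x)"
    by (rule density_unique_real) (use f g eq in \<open>auto simp: re\<close>)
  moreover have "AE x in M. Im (f x) = Im (g x)"
    by (rule density_unique_real) (use f g eq in \<open>auto simp: im\<close>)
  ultimately show ?thesis by eventually_elim (simp add: complex_eq_iff)
qed

text \<open>
The relation $d\kappa = f\,d\nu$ on the half-line. Only integrability on bounded sets is required, and the measure
\<open>\<nu>\<close> is not unique: this freedom lets the same lemmas serve explicit measures (with a convenient reference
measure) and arbitrary ones (with $\nu = |\kappa|$).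
\<close>

definition has_cm_density ::
    "(real set \<Rightarrow> complex) \<Rightarrow> real measure \<Rightarrow> (real \<Rightarrow> complex) \<Rightarrow> bool" where
  "has_cm_density \<kappa> \<nu> f \<longleftrightarrow>
     sets \<nu> = sets (restrict_space borel {0..}) \<and> f \<in> borel_measurable \<nu> \<and>
     (\<forall>A\<in>bounded_borel. set_integrable \<nu> A f \<and> \<kappa> A = (LINT t:A|\<nu>. f t)) \<and>
     (\<forall>A. A \<notin> bounded_borel \<longrightarrow> \<kappa> A = 0)"

context
  fixes \<kappa> :: "real set \<Rightarrow> complex" and \<nu> :: "real measure" and f :: "real \<Rightarrow> complex"
  assumes dens: "has_cm_density \<kappa> \<nu> f"
begin

lemma density_sets: "sets \<nu> = sets (restrict_space borel {0..})"
  using dens by (simp add: has_cm_density_def)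

lemma density_space: "space \<nu> = {0..}"
  using sets_eq_imp_space_eq[OF density_sets] by (simp add: space_restrict_space)

lemma density_measurable: "f \<in> borel_measurable \<nu>"
  using dens by (simp add: has_cm_density_def)

lemma density_set_integrable: "A \<in> bounded_borel \<Longrightarrow> set_integrable \<nu> A f"
  using dens by (simp add: has_cm_density_def)

lemma density_eq: "A \<in> bounded_borel \<Longrightarrow> \<kappa> A = (LINT t:A|\<nu>. f t)"
  using dens by (simp add: has_cm_density_def)

lemma density_bounded_borel_sets: "A \<in> bounded_borel \<Longrightarrow> A \<in> sets \<nu>"
  by (simp add: density_sets bounded_borel_halfline)

text \<open>
Termwise integration over the disjoint pieces; the sums of the norms are dominated by the integral of
$|f|$ over the bounded union.
\<close>

lemma lf_complex_measure_density: "lf_complex_measure \<kappa>"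
  unfolding lf_complex_measure_def
proof (intro conjI allI impI)
  fix A :: "nat \<Rightarrow> real set"
  assume A: "range A \<subseteq> bounded_borel" and dis: "disjoint_family A" and bd: "bounded (\<Union>n. A n)"
  have bb: "A n \<in> bounded_borel" for n using A by auto
  have U: "(\<Union>n. A n) \<in> bounded_borel" using bb bd by (auto simp: bounded_borel_def)
  have int: "integrable \<nu> (\<lambda>x. indicator (A i) x *\<^sub>R f x)" for i
    using density_set_integrable[OF bb] by (simp add: set_integrable_def)
  have normint: "integrable \<nu> (\<lambda>x. norm (indicator (\<Union>n. A n) x *\<^sub>R f x))"
    using density_set_integrable[OF U] by (intro integrable_norm) (simp add: set_integrable_def)
  have ind: "(\<lambda>i. indicator (A i) x :: real) sums indicator (\<Union>n. A n) x" for x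
    by (rule indicator_sums) (use disjoint_family_onD[OF dis] in auto)
  have "(\<lambda>i. LINT x|\<nu>. indicator (A i) x *\<^sub>R f x) sums
      (LINT x|\<nu>. (\<Sum>i. indicator (A i) x *\<^sub>R f x))"
  proof (rule sums_integral[OF int])
    have "(\<lambda>i. norm (indicator (A i) x *\<^sub>R f x)) sums (indicator (\<Union>n. A n) x * norm (f x))" for x
      using sums_mult2[OF ind, of x "norm (f x)"] by simp
    then show "AE x in \<nu>. summable (\<lambda>i. norm (indicator (A i) x *\<^sub>R f x))"
      by (auto intro: sums_summable)
    show "summable (\<lambda>i. LINT x|\<nu>. norm (indicator (A i) x *\<^sub>R f x))"
    proof (rule summableI_nonneg_bounded)
      fix n
      have "(\<Sum>i<n. LINT x|\<nu>. norm (indicator (A i) x *\<^sub>R f x)) =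
          (LINT x|\<nu>. (\<Sum>i<n. norm (indicator (A i) x *\<^sub>R f x)))"
        by (rule Bochner_Integration.integral_sum[symmetric]) (rule integrable_norm[OF int])
      also have "\<dots> \<le> (LINT x|\<nu>. norm (indicator (\<Union>n. A n) x *\<^sub>R f x))"
      proof (rule integral_mono[OF _ normint])
        show "integrable \<nu> (\<lambda>x. \<Sum>i<n. norm (indicator (A i) x *\<^sub>R f x))"
          by (intro Bochner_Integration.integrable_sum integrable_norm[OF int])
        fix x
        have "(\<Sum>i<n. indicator (A i) x) \<le> (indicator (\<Union>n. A n) x :: real)"
          using sum_le_suminf[OF sums_summable[OF ind], of "{..<n}" x] sums_unique[OF ind, of x]
          by simp
        then show "(\<Sum>i<n. norm (indicator (A i) x *\<^sub>R f x)) \<le> norm (indicator (\<Union>n. A n) x *\<^sub>R f x)"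
          using mult_right_mono[OF _ norm_ge_zero[of "f x"]] by (simp add: sum_distrib_right[symmetric])
      qed
      finally show "(\<Sum>i<n. LINT x|\<nu>. norm (indicator (A i) x *\<^sub>R f x)) \<le>
        (LINT x|\<nu>. norm (indicator (\<Union>n. A n) x *\<^sub>R f x))" .
    qed simp
  qed
  moreover have "(\<Sum>i. indicator (A i) x *\<^sub>R f x) = indicator (\<Union>n. A n) x *\<^sub>R f x" for x
    using sums_unique[OF sums_scaleR_left[OF ind[of x], of "f x"]] by simp
  ultimately show "(\<lambda>n. \<kappa> (A n)) sums \<kappa> (\<Union>n. A n)"
    by (simp add: density_eq[OF bb] density_eq[OF U] set_lebesgue_integral_def)
next
  fix A show "A \<notin> bounded_borel \<Longrightarrow> \<kappa> A = 0"
    using dens by (simp add: has_cm_density_def)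
qed

text \<open>
The measure $|f|\,d\nu$, which turns out to be the total variation.
\<close>

abbreviation "abs_density \<equiv> density \<nu> (\<lambda>t. ennreal (norm (f t)))"

lemma norm_le_abs_density:
  assumes "A \<in> bounded_borel"
  shows "ennreal (norm (\<kappa> A)) \<le> emeasure abs_density A"
proof -
  have "ennreal (norm (LINT t|\<nu>. indicator A t *\<^sub>R f t)) \<le> (\<integral>\<^sup>+ t. ennreal (norm (indicator A t *\<^sub>R f t)) \<partial>\<nu>)"
    using density_set_integrable[OF assms] by (intro integral_norm_bound_ennreal) (simp add: set_integrable_def)
  also have "\<dots> = emeasure abs_density A"
    using density_bounded_borel_sets[OF assms] density_measurable
    by (subst emeasure_density) (auto intro!: nn_integral_cong split: split_indicator)
  finally show ?thesis by (simp add: density_eq[OF assms] set_lebesgue_integral_def)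
qed

lemma variation_le_abs_density:
  assumes "A \<in> sets \<nu>"
  shows "variation \<kappa> A \<le> emeasure abs_density A"
proof (rule variation_least)
  fix P assume P: "finite P" "disjoint P" "P \<subseteq> bounded_borel" "\<Union>P \<subseteq> A"
  have "ennreal (\<Sum>B\<in>P. norm (\<kappa> B)) = (\<Sum>B\<in>P. ennreal (norm (\<kappa> B)))"
    by (simp add: sum_ennreal)
  also have "\<dots> \<le> (\<Sum>B\<in>P. emeasure abs_density B)"
    by (intro sum_mono norm_le_abs_density) (use P in auto)
  also have "\<dots> = emeasure abs_density (\<Union>B\<in>P. B)"
    using P density_bounded_borel_sets
    by (intro sum_emeasure) (auto simp: disjoint_family_on_def disjoint_def)
  also have "\<dots> \<le> emeasure abs_density A"
    using P assms by (intro emeasure_mono) auto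
  finally show "ennreal (\<Sum>B\<in>P. norm (\<kappa> B)) \<le> emeasure abs_density A" .
qed

lemma emeasure_abs_density:
  assumes "A \<in> bounded_borel"
  shows "emeasure abs_density A = ennreal (LINT t:A|\<nu>. norm (f t))"
proof -
  have "emeasure abs_density A = (\<integral>\<^sup>+ t. ennreal (indicator A t *\<^sub>R norm (f t)) \<partial>\<nu>)"
    using density_bounded_borel_sets[OF assms] density_measurable
    by (subst emeasure_density) (auto intro!: nn_integral_cong split: split_indicator)
  also have "\<dots> = ennreal (LINT t:A|\<nu>. norm (f t))"
    using density_set_integrable[OF assms, unfolded set_integrable_def, THEN integrable_norm]
    unfolding set_lebesgue_integral_def norm_scaleR real_norm_def abs_indicator real_scaleR_def
    by (intro nn_integral_eq_integral) auto
  finally show ?thesis .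
qed

text \<open>
The difficult half of $|\kappa| = |f|\,d\nu$. Approximate $f$ on \<open>A\<close> in $L^1$ by simple functions $s_i$ and
partition \<open>A\<close> into the level sets of $s_i$. On a level set $s_i$ is constant, so that the norm of its integral is
the integral of its norm; replacing $s_i$ by $f$ costs at most twice the $L^1$ error.
\<close>

lemma abs_density_le_variation_bounded:
  assumes A: "A \<in> bounded_borel"
  shows "emeasure abs_density A \<le> variation \<kappa> A"
proof -
  let ?g = "\<lambda>t. indicator A t *\<^sub>R f t"
  have g: "integrable \<nu> ?g"
    using density_set_integrable[OF A] by (simp add: set_integrable_def)
  obtain s where s: "\<And>i. simple_function \<nu> (s i)"
      "\<And>x. x \<in> space \<nu> \<Longrightarrow> (\<lambda>i. s i x) \<longlonglongrightarrow> ?g x"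
      "\<And>x i. x \<in> space \<nu> \<Longrightarrow> norm (s i x) \<le> 2 * norm (?g x)"
    using integrable_implies_simple_function_sequence[OF g] by metis
  have sm: "s i \<in> borel_measurable \<nu>" for i
    using s(1) by (rule borel_measurable_simple_function)
  have si: "integrable \<nu> (s i)" for i
    by (rule Bochner_Integration.integrable_bound[OF integrable_scaleR_right[OF integrable_norm[OF g], of 2] sm])
       (use s(3)[of _ i] in auto)
  define e where "e i = (LINT t|\<nu>. norm (s i t - ?g t))" for i
  have e0: "e \<longlonglongrightarrow> 0"
  proof -
    have "(\<lambda>i. LINT t|\<nu>. norm (s i t - ?g t)) \<longlonglongrightarrow> (LINT t|\<nu>. 0)"
    proof (rule integral_dominated_convergence)
      show "integrable \<nu> (\<lambda>t. 3 * norm (?g t))"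
        using integrable_norm[OF g] by (rule integrable_mult_right)
      show "AE t in \<nu>. (\<lambda>i. norm (s i t - ?g t)) \<longlonglongrightarrow> 0"
        using s(2) by (intro AE_I2 tendsto_norm_zero) (simp add: LIM_zero_iff)
      show "AE t in \<nu>. norm (norm (s i t - ?g t)) \<le> 3 * norm (?g t)" for i
      proof (rule AE_I2)
        fix t assume "t \<in> space \<nu>"
        from s(3)[OF this, of i] norm_triangle_ineq4[of "s i t" "?g t"]
        show "norm (norm (s i t - ?g t)) \<le> 3 * norm (?g t)"
          unfolding real_norm_def abs_norm_cancel by linarith
      qed
    qed (use sm g in auto)
    then show ?thesis by (simp add: e_def[abs_def])
  qed
  have bound: "ennreal ((LINT t:A|\<nu>. norm (f t)) - 2 * e i) \<le> variation \<kappa> A" for i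
  proof -
    define V where "V = s i ` space \<nu>"
    define B where "B v = A \<inter> (s i -` {v} \<inter> space \<nu>)" for v
    have finV: "finite V" using s(1) by (simp add: V_def simple_function_def)
    have Bset: "B v \<in> sets \<nu>" for v
      unfolding B_def by (intro sets.Int density_bounded_borel_sets[OF A] simple_functionD(2)[OF s(1)])
    have Bbb: "B v \<in> bounded_borel" for v
      using bounded_borel_subset[OF A, of "B v"] Bset[of v] by (auto simp: density_sets halfline_sets B_def)
    have Adec: "A = (\<Union>v\<in>V. B v)"
      using sets.sets_into_space[OF density_bounded_borel_sets[OF A]] by (auto simp: V_def B_def)
    have dis: "disjoint_family_on B V" by (auto simp: disjoint_family_on_def B_def)
    \<comment> \<open>The estimate on a single level set.\<close>
    have one: "(LINT t:B v|\<nu>. norm (f t)) - 2 * (LINT t:B v|\<nu>. norm (s i t - ?g t)) \<le> norm (\<kappa> (B v))" for v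
    proof -
      have ig: "integrable \<nu> (\<lambda>t. indicator (B v) t *\<^sub>R ?g t)"
        by (rule integrable_mult_indicator[OF Bset g])
      have is': "integrable \<nu> (\<lambda>t. indicator (B v) t *\<^sub>R s i t)"
        by (rule integrable_mult_indicator[OF Bset si])
      have geq: "indicator (B v) t *\<^sub>R ?g t = indicator (B v) t *\<^sub>R f t" for t
        by (auto simp: B_def split: split_indicator)
      have seq: "(\<lambda>t. indicator (B v) t *\<^sub>R s i t) = (\<lambda>t. indicator (B v) t *\<^sub>R v)"
        by (auto simp: B_def split: split_indicator)
      have "(LINT t|\<nu>. indicator (B v) t *\<^sub>R s i t) = (LINT t|\<nu>. indicator (B v) t) *\<^sub>R v"
        unfolding seq
      proof (rule integral_scaleR_left)
        assume "v \<noteq> 0"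
        have "integrable \<nu> (\<lambda>t. norm (indicator (B v) t *\<^sub>R v) / norm v)"
          using is' unfolding seq by (intro integrable_divide integrable_norm)
        then show "integrable \<nu> (indicat_real (B v))" using \<open>v \<noteq> 0\<close> by simp
      qed
      moreover have "(LINT t|\<nu>. norm (indicator (B v) t *\<^sub>R s i t)) = (LINT t|\<nu>. indicator (B v) t) * norm v"
        by (subst seq[THEN fun_cong]) simp
      ultimately have s_eq: "norm (LINT t|\<nu>. indicator (B v) t *\<^sub>R s i t) = (LINT t|\<nu>. norm (indicator (B v) t *\<^sub>R s i t))"
        by simp
      let ?d = "LINT t|\<nu>. norm (indicator (B v) t *\<^sub>R (s i t - ?g t))"
      have di: "integrable \<nu> (\<lambda>t. indicator (B v) t *\<^sub>R (s i t - ?g t))"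
        using g si by (intro integrable_mult_indicator[OF Bset]) auto
      have "norm (LINT t|\<nu>. indicator (B v) t *\<^sub>R s i t) - norm (LINT t|\<nu>. indicator (B v) t *\<^sub>R ?g t)
          \<le> norm ((LINT t|\<nu>. indicator (B v) t *\<^sub>R s i t) - (LINT t|\<nu>. indicator (B v) t *\<^sub>R ?g t))"
        by (rule norm_triangle_ineq2)
      also have "\<dots> = norm (LINT t|\<nu>. indicator (B v) t *\<^sub>R (s i t - ?g t))"
        using is' ig by (simp add: scaleR_diff_right)
      also have "\<dots> \<le> ?d" by (rule integral_norm_bound)
      finally have 1: "norm (LINT t|\<nu>. indicator (B v) t *\<^sub>R s i t) - norm (\<kappa> (B v)) \<le> ?d"
        unfolding geq density_eq[OF Bbb] set_lebesgue_integral_def .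
      have "(LINT t|\<nu>. norm (indicator (B v) t *\<^sub>R ?g t)) \<le>
        (LINT t|\<nu>. norm (indicator (B v) t *\<^sub>R s i t) + norm (indicator (B v) t *\<^sub>R (s i t - ?g t)))"
      proof (rule integral_mono)
        fix t
        show "norm (indicator (B v) t *\<^sub>R ?g t) \<le>
          norm (indicator (B v) t *\<^sub>R s i t) + norm (indicator (B v) t *\<^sub>R (s i t - ?g t))"
          using norm_triangle_ineq4[of "indicator (B v) t *\<^sub>R s i t" "indicator (B v) t *\<^sub>R (s i t - ?g t)"]
          by (simp add: scaleR_diff_right)
      qed (rule integrable_norm[OF ig] Bochner_Integration.integrable_add[OF integrable_norm[OF is'] integrable_norm[OF di]])+
      also have "\<dots> = (LINT t|\<nu>. norm (indicator (B v) t *\<^sub>R s i t)) + ?d"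
        using is' di by (intro Bochner_Integration.integral_add integrable_norm)
      finally have 2: "(LINT t|\<nu>. norm (indicator (B v) t *\<^sub>R f t)) \<le>
          (LINT t|\<nu>. norm (indicator (B v) t *\<^sub>R s i t)) + ?d"
        unfolding geq .
      from 1 2 s_eq have "(LINT t|\<nu>. norm (indicator (B v) t *\<^sub>R f t)) - 2 * ?d \<le> norm (\<kappa> (B v))"
        by linarith
      then show ?thesis by (simp add: set_lebesgue_integral_def)
    qed
    have intf: "set_integrable \<nu> (B v) (\<lambda>t. norm (f t))" for v
      using integrable_norm[OF density_set_integrable[OF Bbb[of v], unfolded set_integrable_def]]
      unfolding norm_scaleR real_norm_def abs_indicator set_integrable_def real_scaleR_def .
    have intd: "set_integrable \<nu> (B v) (\<lambda>t. norm (s i t - ?g t))" for v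
      unfolding set_integrable_def using g si by (intro integrable_mult_indicator[OF Bset]) auto
    have "(LINT t:A|\<nu>. norm (f t)) - 2 * (LINT t:A|\<nu>. norm (s i t - ?g t)) =
        (\<Sum>v\<in>V. (LINT t:B v|\<nu>. norm (f t)) - 2 * (LINT t:B v|\<nu>. norm (s i t - ?g t)))"
      by (subst (1 2) Adec)
         (simp add: set_integral_finite_Union[OF finV dis intf Bset] set_integral_finite_Union[OF finV dis intd Bset]
           sum_subtractf sum_distrib_left)
    also have "\<dots> \<le> (\<Sum>v\<in>V. norm (\<kappa> (B v)))" by (rule sum_mono[OF one])
    also have "\<dots> = (\<Sum>C\<in>B ` V. norm (\<kappa> C))"
    proof (subst sum.reindex_nontrivial[OF finV])
      fix v w assume "v \<in> V" "w \<in> V" "v \<noteq> w" "B v = B w"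
      then have "B v = {}" by (auto simp: B_def)
      then show "norm (\<kappa> (B v)) = 0" using lf_empty[OF lf_complex_measure_density] by simp
    qed simp
    finally have 3: "(LINT t:A|\<nu>. norm (f t)) - 2 * (LINT t:A|\<nu>. norm (s i t - ?g t)) \<le> (\<Sum>C\<in>B ` V. norm (\<kappa> C))" .
    have "(LINT t:A|\<nu>. norm (s i t - ?g t)) \<le> e i"
      unfolding e_def set_lebesgue_integral_def
    proof (rule integral_mono)
      show "integrable \<nu> (\<lambda>t. norm (s i t - ?g t))" using g si by simp
      then show "integrable \<nu> (\<lambda>t. indicat_real A t *\<^sub>R norm (s i t - ?g t))"
        by (rule integrable_mult_indicator[OF density_bounded_borel_sets[OF A]])
    qed (auto split: split_indicator)
    with 3 have "ennreal ((LINT t:A|\<nu>. norm (f t)) - 2 * e i) \<le> ennreal (\<Sum>C\<in>B ` V. norm (\<kappa> C))"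
      by (intro ennreal_leI) linarith
    also have "\<dots> \<le> variation \<kappa> A"
    proof (rule variation_upper)
      show "disjoint (B ` V)"
        using dis by (auto simp: disjoint_def disjoint_family_on_def B_def)
      show "\<Union> (B ` V) \<subseteq> A" by (auto simp: B_def)
    qed (use finV Bbb in auto)
    finally show ?thesis .
  qed
  have "(\<lambda>i. ennreal ((LINT t:A|\<nu>. norm (f t)) - 2 * e i)) \<longlonglongrightarrow> ennreal ((LINT t:A|\<nu>. norm (f t)) - 2 * 0)"
    by (intro tendsto_ennrealI tendsto_intros e0)
  then have "ennreal ((LINT t:A|\<nu>. norm (f t)) - 2 * 0) \<le> variation \<kappa> A"
    by (rule LIMSEQ_le_const2) (use bound in auto)
  then show ?thesis by (simp add: emeasure_abs_density[OF A])
qed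

text \<open>
The two inequalities on bounded sets extend to unbounded \<open>A\<close> by exhaustion with $A \cap [0,n]$.
\<close>

lemma total_variation_density: "total_variation \<kappa> = abs_density"
proof (rule measure_eqI)
  show "sets (total_variation \<kappa>) = sets abs_density"
    by (simp add: sets_total_variation density_sets)
next
  fix A assume "A \<in> sets (total_variation \<kappa>)"
  then have A: "A \<in> sets borel" "A \<subseteq> {0..}" "A \<in> sets (restrict_space borel {0..})"
    by (auto simp: sets_total_variation halfline_sets)
  have bb: "A \<inter> {0..real n} \<in> bounded_borel" for n using A by (intro bounded_borel_cut)
  have "emeasure abs_density A \<le> variation \<kappa> A"
  proof -
    have "(\<Union>n. A \<inter> {0..real n}) = A" using A(2) real_arch_simple by (auto simp: subset_iff)
    then have "emeasure abs_density A = (SUP n. emeasure abs_density (A \<inter> {0..real n}))"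
      using density_bounded_borel_sets[OF bb]
      by (subst SUP_emeasure_incseq) (auto simp: incseq_def)
    also have "\<dots> \<le> variation \<kappa> A"
    proof (rule SUP_least)
      fix n
      have "emeasure abs_density (A \<inter> {0..real n}) \<le> variation \<kappa> (A \<inter> {0..real n})"
        by (rule abs_density_le_variation_bounded[OF bb])
      also have "\<dots> \<le> variation \<kappa> A" by (rule variation_mono) auto
      finally show "emeasure abs_density (A \<inter> {0..real n}) \<le> variation \<kappa> A" .
    qed
    finally show ?thesis .
  qed
  moreover have "variation \<kappa> A \<le> emeasure abs_density A"
    by (rule variation_le_abs_density) (simp add: density_sets A)
  ultimately show "emeasure (total_variation \<kappa>) A = emeasure abs_density A"
    using emeasure_total_variation[OF lf_complex_measure_density A(3)] by simp
qed

lemma LINT_abs_density: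
  assumes "g \<in> borel_measurable \<nu>"
  shows "(LINT t|abs_density. (g t :: complex)) = (LINT t|\<nu>. norm (f t) *\<^sub>R g t)"
  using density_measurable assms by (intro integral_density) auto

text \<open>
With $d|\kappa| = |f|\,d\nu$ the phase $f/|f|$ is a polar density; where $f$ vanishes any value of modulus 1 will do.
\<close>

lemma polar_density_exists:
  "\<exists>h. h \<in> borel_measurable (total_variation \<kappa>) \<and> (\<forall>t. norm (h t) = 1) \<and>
     (\<forall>A\<in>bounded_borel. \<kappa> A = (LINT t:A|total_variation \<kappa>. h t))"
proof (intro exI conjI allI ballI)
  let ?h = "\<lambda>t. if f t = 0 then 1 else f t / of_real (norm (f t))"
  note [measurable] = density_measurable
  show h: "?h \<in> borel_measurable (total_variation \<kappa>)"
    unfolding total_variation_density by simp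
  show "norm (?h t) = 1" for t by (simp add: norm_divide)
  fix A assume A: "A \<in> bounded_borel"
  have [measurable]: "A \<in> sets \<nu>" by (rule density_bounded_borel_sets[OF A])
  have "(LINT t:A|total_variation \<kappa>. ?h t) = (LINT t|\<nu>. norm (f t) *\<^sub>R (indicator A t *\<^sub>R ?h t))"
    unfolding total_variation_density set_lebesgue_integral_def by (rule LINT_abs_density) simp
  also have "\<dots> = (LINT t|\<nu>. indicator A t *\<^sub>R f t)"
    by (intro Bochner_Integration.integral_cong) (auto simp: scaleR_conv_of_real split: split_indicator)
  finally show "\<kappa> A = (LINT t:A|total_variation \<kappa>. ?h t)"
    by (simp add: density_eq[OF A] set_lebesgue_integral_def)
qed

text \<open>
The chosen polar density $h$ satisfies $|f|\,h\,d\nu = d\kappa = f\,d\nu$ on bounded sets, hence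
$|f|\,h = f$ almost everywhere.
\<close>

lemma cm_integral_density:
  assumes F[measurable]: "F \<in> borel_measurable \<nu>"
  shows "cm_integral \<kappa> F = (LINT t|\<nu>. F t * f t)"
proof -
  note [measurable] = density_measurable
  define h where "h = polar_density \<kappa>"
  have "h \<in> borel_measurable (total_variation \<kappa>) \<and> (\<forall>t. norm (h t) = 1) \<and>
     (\<forall>A\<in>bounded_borel. \<kappa> A = (LINT t:A|total_variation \<kappa>. h t))"
    unfolding h_def polar_density_def by (rule someI_ex[OF polar_density_exists])
  then have hm[measurable]: "h \<in> borel_measurable \<nu>" and h1: "\<And>t. norm (h t) = 1"
    and hA: "\<And>A. A \<in> bounded_borel \<Longrightarrow> \<kappa> A = (LINT t:A|abs_density. h t)"
    by (auto simp: total_variation_density)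
  have hA': "\<kappa> A = (LINT t:A|\<nu>. norm (f t) *\<^sub>R h t)" if "A \<in> bounded_borel" for A
  proof -
    have [measurable]: "A \<in> sets \<nu>" by (rule density_bounded_borel_sets[OF that])
    show ?thesis
      unfolding hA[OF that] set_lebesgue_integral_def
      by (subst LINT_abs_density) (auto simp: mult.commute scaleR_conv_of_real intro!: Bochner_Integration.integral_cong)
  qed
  have "AE t in \<nu>. indicator {0..real n} t *\<^sub>R (norm (f t) *\<^sub>R h t) = indicator {0..real n} t *\<^sub>R f t" for n
  proof (rule density_unique_complex)
    have n: "{0..real n} \<in> bounded_borel" by (auto simp: bounded_borel_def)
    have [measurable]: "{0..real n} \<in> sets \<nu>" by (rule density_bounded_borel_sets[OF n])
    show i: "integrable \<nu> (\<lambda>t. indicator {0..real n} t *\<^sub>R f t)"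
      using density_set_integrable[OF n] by (simp add: set_integrable_def)
    show "integrable \<nu> (\<lambda>t. indicator {0..real n} t *\<^sub>R (norm (f t) *\<^sub>R h t))"
      by (rule Bochner_Integration.integrable_bound[OF i]) (auto simp: h1)
    fix A assume "A \<in> sets \<nu>"
    then have b: "A \<inter> {0..real n} \<in> bounded_borel"
      by (intro bounded_borel_cut) (auto simp: density_sets halfline_sets)
    have *: "(LINT t:A|\<nu>. indicator {0..real n} t *\<^sub>R k t) = (LINT t:(A \<inter> {0..real n})|\<nu>. k t)" for k :: "real \<Rightarrow> complex"
      unfolding set_lebesgue_integral_def by (auto intro!: Bochner_Integration.integral_cong split: split_indicator)
    show "(LINT t:A|\<nu>. indicator {0..real n} t *\<^sub>R (norm (f t) *\<^sub>R h t)) = (LINT t:A|\<nu>. indicator {0..real n} t *\<^sub>R f t)"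
      unfolding * using hA'[OF b] density_eq[OF b] by simp
  qed
  then have "AE t in \<nu>. \<forall>n. indicator {0..real n} t *\<^sub>R (norm (f t) *\<^sub>R h t) = indicator {0..real n} t *\<^sub>R f t"
    by (simp add: AE_all_countable)
  then have ae: "AE t in \<nu>. norm (f t) *\<^sub>R h t = f t"
  proof (rule AE_mp, intro AE_I2 impI)
    fix t assume t: "t \<in> space \<nu>"
      and eq: "\<forall>n. indicator {0..real n} t *\<^sub>R (norm (f t) *\<^sub>R h t) = indicator {0..real n} t *\<^sub>R f t"
    obtain n where "t \<le> real n" using real_arch_simple by blast
    then show "norm (f t) *\<^sub>R h t = f t" using eq[rule_format, of n] t by (simp add: density_space)
  qed
  have "cm_integral \<kappa> F = (LINT t|\<nu>. norm (f t) *\<^sub>R (F t * h t))"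
    unfolding cm_integral_def total_variation_density h_def[symmetric] by (rule LINT_abs_density) simp
  also have "\<dots> = (LINT t|\<nu>. F t * f t)"
  proof (rule integral_cong_AE)
    show "AE t in \<nu>. norm (f t) *\<^sub>R (F t * h t) = F t * f t"
      using ae by eventually_elim (metis mult_scaleR_right)
  qed auto
  finally show ?thesis .
qed

end

section \<open>Existence of densities\<close>

lemma total_variation_dominates:
  assumes \<kappa>: "lf_complex_measure \<kappa>" and A: "A \<in> bounded_borel" and fin: "variation \<kappa> A < \<infinity>"
  shows "norm (\<kappa> A) \<le> measure (total_variation \<kappa>) A"
proof -
  have "emeasure (total_variation \<kappa>) A = variation \<kappa> A"
    by (rule emeasure_total_variation[OF \<kappa> bounded_borel_halfline[OF A]])
  moreover from this have "emeasure (total_variation \<kappa>) A = ennreal (measure (total_variation \<kappa>) A)"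
    using fin by (intro emeasure_eq_ennreal_measure) auto
  ultimately have "ennreal (norm (\<kappa> A)) \<le> ennreal (measure (total_variation \<kappa>) A)"
    using variation_ge_norm[OF A, of \<kappa>] by simp
  then show ?thesis by (subst (asm) ennreal_le_iff) auto
qed

text \<open>
To be applied to the real and the imaginary part. On a bounded set the signed measure $r \circ \kappa$ is
dominated by the total variation, so that $|\kappa| + r \circ \kappa$ is a finite positive measure which is absolutely
continuous with respect to $|\kappa|$. Its Radon-Nikodym derivative minus 1 is the required density.
\<close>

lemma linear_part_density:
  fixes r :: "complex \<Rightarrow> real"
  assumes \<kappa>: "lf_complex_measure \<kappa>" and r: "bounded_linear r" "\<And>z. \<bar>r z\<bar> \<le> norm z"
    and I: "I \<in> bounded_borel" and fin: "variation \<kappa> I < \<infinity>"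
  shows "\<exists>g. g \<in> borel_measurable (total_variation \<kappa>) \<and>
    (\<forall>A\<in>bounded_borel. A \<subseteq> I \<longrightarrow> set_integrable (total_variation \<kappa>) A g \<and>
       r (\<kappa> A) = (LINT t:A|total_variation \<kappa>. g t))"
proof -
  define V where "V = total_variation \<kappa>"
  have sV: "sets V = sets (restrict_space borel {0..})" by (simp add: V_def sets_total_variation)
  have spV: "space V = {0..}" by (simp add: V_def space_total_variation)
  have bbV: "A \<in> bounded_borel \<Longrightarrow> A \<in> sets V" for A by (simp add: sV bounded_borel_halfline)
  have [measurable]: "I \<in> sets V" by (rule bbV[OF I])
  have cut: "A \<inter> I \<in> bounded_borel" if "A \<in> sets V" for A
    using bounded_borel_subset[OF I, of "A \<inter> I"] that I by (auto simp: sV halfline_sets bounded_borel_def)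
  have finI: "emeasure V I < \<infinity>"
    unfolding V_def using emeasure_total_variation[OF \<kappa> bounded_borel_halfline[OF I]] fin by simp
  have finA: "emeasure V A < \<infinity>" if "A \<subseteq> I" for A
    using emeasure_mono[OF that \<open>I \<in> sets V\<close>] finI by (rule le_less_trans)
  have dom: "\<bar>r (\<kappa> A)\<bar> \<le> measure V A" if "A \<in> bounded_borel" "A \<subseteq> I" for A
  proof -
    have "variation \<kappa> A < \<infinity>" using variation_mono[OF that(2), of \<kappa>] fin by (rule le_less_trans)
    then have "norm (\<kappa> A) \<le> measure V A"
      unfolding V_def by (rule total_variation_dominates[OF \<kappa> that(1)])
    then show ?thesis using r(2)[of "\<kappa> A"] by linarith
  qed
  \<comment> \<open>The positive measure whose derivative is sought, traced on \<open>I\<close>.\<close>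
  define \<rho> where "\<rho> A = measure V (A \<inter> I) + r (\<kappa> (A \<inter> I))" for A
  have \<rho>_nonneg: "0 \<le> \<rho> A" if "A \<in> sets V" for A
    using dom[OF cut[OF that]] unfolding \<rho>_def by auto
  define N where "N = measure_of {0..} (sets V) (\<lambda>A. ennreal (\<rho> A))"
  define W where "W = density V (indicator I)"
  have emW: "emeasure W A = emeasure V (A \<inter> I)" if "A \<in> sets V" for A
    using that unfolding W_def by (subst emeasure_density) (simp_all add: indicator_inter_arith[symmetric] Int_commute)
  have "finite_measure W"
  proof (rule finite_measureI)
    have "space W \<in> sets V" using sets.top[of V] by (simp add: W_def)
    then show "emeasure W (space W) \<noteq> \<infinity>" using emW finA[of "space W \<inter> I"] by auto
  qed
  then interpret W: finite_measure W .
  have sW: "sets W = sets V" by (simp add: W_def)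
  have sN: "sets N = sets V"
    unfolding N_def using sets.space_closed[of V] sets.sigma_sets_eq[of V] by (simp add: spV)
  have emN: "emeasure N A = ennreal (\<rho> A)" if A: "A \<in> sets V" for A
    unfolding N_def
  proof (rule emeasure_measure_of_sigma)
    show "sigma_algebra {0..} (sets V)"
      using sets.sigma_algebra_axioms[of V] by (simp add: spV)
    show "positive (sets V) (\<lambda>A. ennreal (\<rho> A))"
      using r(1) lf_empty[OF \<kappa>] by (simp add: positive_def \<rho>_def linear_simps)
    show "countably_additive (sets V) (\<lambda>A. ennreal (\<rho> A))"
      unfolding countably_additive_def
    proof (intro allI impI)
      fix A :: "nat \<Rightarrow> real set"
      assume A: "range A \<subseteq> sets V" and dis: "disjoint_family A" and U: "(\<Union>i. A i) \<in> sets V"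
      have disI: "disjoint_family (\<lambda>i. A i \<inter> I)" using dis by (auto simp: disjoint_family_on_def)
      have Ai: "A i \<in> sets V" for i using A by auto
      have "(\<lambda>i. \<kappa> (A i \<inter> I)) sums \<kappa> (\<Union>i. A i \<inter> I)"
        using cut[OF U] by (intro lf_sums[OF \<kappa> cut[OF Ai] disI]) (auto simp: bounded_borel_def)
      then have 1: "(\<lambda>i. r (\<kappa> (A i \<inter> I))) sums r (\<kappa> ((\<Union>i. A i) \<inter> I))"
        by (intro bounded_linear.sums[OF r(1)]) simp
      have mW: "measure W B = measure V (B \<inter> I)" if "B \<in> sets V" for B
        using emW[OF that] by (simp add: measure_def)
      have "(\<lambda>i. measure W (A i)) sums measure W (\<Union>i. A i)"
        using A dis by (intro W.finite_measure_UNION) (auto simp: sW)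
      then have "(\<lambda>i. measure V (A i \<inter> I)) sums measure V ((\<Union>i. A i) \<inter> I)"
        by (simp only: mW[OF Ai] mW[OF U])
      from sums_add[OF this 1] have "(\<lambda>i. \<rho> (A i)) sums \<rho> (\<Union>i. A i)"
        by (simp only: \<rho>_def)
      then show "(\<Sum>i. ennreal (\<rho> (A i))) = ennreal (\<rho> (\<Union>i. A i))"
        using \<rho>_nonneg[OF Ai] by (intro suminf_ennreal_eq)
    qed
  qed (rule A)
  have "absolutely_continuous W N"
    unfolding absolutely_continuous_def
  proof
    fix A assume "A \<in> null_sets W"
    then have A: "A \<in> sets V" and "emeasure V (A \<inter> I) = 0"
      using emW by (auto simp: null_sets_def sW)
    then have "measure V (A \<inter> I) = 0" by (simp add: measure_def)
    then have "\<rho> A = 0" using dom[OF cut[OF A]] by (simp add: \<rho>_def)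
    then show "A \<in> null_sets N" using A emN by (simp add: null_sets_def sN)
  qed
  then obtain F where F: "F \<in> borel_measurable W" "density W F = N"
    using W.Radon_Nikodym sN sW by metis
  have [measurable]: "F \<in> borel_measurable V" using F(1) by (simp add: W_def)
  define g where "g t = enn2real (F t) - 1" for t
  have "set_integrable V A g \<and> r (\<kappa> A) = (LINT t:A|V. g t)" if A: "A \<in> bounded_borel" "A \<subseteq> I" for A
  proof -
    have [measurable]: "A \<in> sets V" by (rule bbV[OF A(1)])
    have AI: "A \<inter> I = A" using A(2) by auto
    have "ennreal (\<rho> A) = emeasure (density W F) A" using emN F(2) by simp
    also have "\<dots> = (\<integral>\<^sup>+ t. F t * indicator A t \<partial>W)"
      using F(1) by (intro emeasure_density) (simp_all add: sW)
    also have "\<dots> = (\<integral>\<^sup>+ t. indicator I t * (F t * indicator A t) \<partial>V)"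
      unfolding W_def by (intro nn_integral_density) auto
    also have "\<dots> = (\<integral>\<^sup>+ t. F t * indicator A t \<partial>V)"
      using A(2) by (intro nn_integral_cong) (auto split: split_indicator)
    finally have 1: "(\<integral>\<^sup>+ t. F t * indicator A t \<partial>V) = ennreal (\<rho> A)" ..
    have "AE t in V. F t * indicator A t \<noteq> \<infinity>"
      by (rule nn_integral_PInf_AE) (auto simp: 1)
    then have "AE t in V. ennreal (indicator A t *\<^sub>R enn2real (F t)) = F t * indicator A t"
      by eventually_elim (auto simp: less_top split: split_indicator)
    then have "(\<integral>\<^sup>+ t. ennreal (indicator A t *\<^sub>R enn2real (F t)) \<partial>V) = ennreal (\<rho> A)"
      unfolding 1[symmetric] by (rule nn_integral_cong_AE)
    then have h1: "has_bochner_integral V (\<lambda>t. indicator A t *\<^sub>R enn2real (F t)) (\<rho> A)"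
      using \<rho>_nonneg by (intro has_bochner_integral_nn_integral) auto
    have h2: "has_bochner_integral V (\<lambda>t. indicator A t *\<^sub>R (1::real)) (measure V A)"
      using has_bochner_integral_real_indicator[of A V] finA[OF A(2)] by simp
    have "has_bochner_integral V (\<lambda>t. indicator A t *\<^sub>R g t) (\<rho> A - measure V A)"
      using has_bochner_integral_diff[OF h1 h2] unfolding g_def scaleR_diff_right .
    then show ?thesis
      unfolding set_integrable_def set_lebesgue_integral_def
      by (auto simp: has_bochner_integral_iff \<rho>_def AI)
  qed
  moreover have "g \<in> borel_measurable V" unfolding g_def by measurable
  ultimately show ?thesis unfolding V_def by blast
qed

text \<open>
The complex measure is not defined on unbounded sets, so Radon-Nikodym is applied on each interval $[n,n+1)$
and the densities are glued.
\<close>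

theorem lf_complex_measure_has_density:
  assumes \<kappa>: "lf_complex_measure \<kappa>" and fin: "\<And>A. A \<in> bounded_borel \<Longrightarrow> variation \<kappa> A < \<infinity>"
  shows "\<exists>h. has_cm_density \<kappa> (total_variation \<kappa>) h"
proof -
  define V where "V = total_variation \<kappa>"
  have sV: "sets V = sets (restrict_space borel {0..})" by (simp add: V_def sets_total_variation)
  have bbV: "A \<in> bounded_borel \<Longrightarrow> A \<in> sets V" for A by (simp add: sV bounded_borel_halfline)
  define I where "I n = {real n..<real n + 1}" for n
  have I: "I n \<in> bounded_borel" for n by (auto simp: I_def bounded_borel_def)
  have "\<exists>g. g \<in> borel_measurable V \<and>
    (\<forall>A\<in>bounded_borel. A \<subseteq> I n \<longrightarrow> set_integrable V A g \<and> Re (\<kappa> A) = (LINT t:A|V. g t))" for n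
    unfolding V_def by (rule linear_part_density[OF \<kappa> bounded_linear_Re abs_Re_le_cmod I fin[OF I]])
  then obtain g where g: "\<And>n. g n \<in> borel_measurable V"
    "\<And>n A. A \<in> bounded_borel \<Longrightarrow> A \<subseteq> I n \<Longrightarrow> set_integrable V A (g n)"
    "\<And>n A. A \<in> bounded_borel \<Longrightarrow> A \<subseteq> I n \<Longrightarrow> Re (\<kappa> A) = (LINT t:A|V. g n t)"
    by metis
  have "\<exists>g. g \<in> borel_measurable V \<and>
    (\<forall>A\<in>bounded_borel. A \<subseteq> I n \<longrightarrow> set_integrable V A g \<and> Im (\<kappa> A) = (LINT t:A|V. g t))" for n
    unfolding V_def by (rule linear_part_density[OF \<kappa> bounded_linear_Im abs_Im_le_cmod I fin[OF I]])
  then obtain k where k: "\<And>n. k n \<in> borel_measurable V"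
    "\<And>n A. A \<in> bounded_borel \<Longrightarrow> A \<subseteq> I n \<Longrightarrow> set_integrable V A (k n)"
    "\<And>n A. A \<in> bounded_borel \<Longrightarrow> A \<subseteq> I n \<Longrightarrow> Im (\<kappa> A) = (LINT t:A|V. k n t)"
    by metis
  define h where "h t = complex_of_real (g (nat \<lfloor>t\<rfloor>) t) + \<i> * complex_of_real (k (nat \<lfloor>t\<rfloor>) t)" for t
  have idm: "(\<lambda>t. nat \<lfloor>t\<rfloor>) \<in> measurable V (count_space UNIV)"
    unfolding measurable_cong_sets[OF sV refl] by (intro measurable_restrict_space1) measurable
  have [measurable]: "(\<lambda>t. g (nat \<lfloor>t\<rfloor>) t) \<in> borel_measurable V" "(\<lambda>t. k (nat \<lfloor>t\<rfloor>) t) \<in> borel_measurable V"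
    using measurable_compose_countable[OF g(1) idm] measurable_compose_countable[OF k(1) idm] by auto
  have h_meas: "h \<in> borel_measurable V"
    unfolding h_def by measurable
  have piece: "set_integrable V A h \<and> \<kappa> A = (LINT t:A|V. h t)" if A: "A \<in> bounded_borel" "A \<subseteq> I n" for A n
  proof -
    let ?h = "\<lambda>t. indicator A t *\<^sub>R complex_of_real (g n t) + \<i> * (indicator A t *\<^sub>R complex_of_real (k n t))"
    have fl: "nat \<lfloor>t\<rfloor> = n" if "t \<in> I n" for t
      using that floor_unique[of "int n" t] by (simp add: I_def)
    have eq: "indicator A t *\<^sub>R h t = ?h t" for t
      using A(2) fl[of t] by (auto simp: h_def split: split_indicator)
    have gi: "integrable V (\<lambda>t. indicator A t *\<^sub>R complex_of_real (g n t))"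
      "(LINT t|V. indicator A t *\<^sub>R complex_of_real (g n t)) = complex_of_real (LINT t:A|V. g n t)"
      using set_integral_complex_of_real[of V A "g n"] integrable_of_real[OF g(2)[OF A, unfolded set_integrable_def], where 'a=complex]
      by (auto simp: set_lebesgue_integral_def scaleR_conv_of_real)
    have ki: "integrable V (\<lambda>t. indicator A t *\<^sub>R complex_of_real (k n t))"
      "(LINT t|V. indicator A t *\<^sub>R complex_of_real (k n t)) = complex_of_real (LINT t:A|V. k n t)"
      using set_integral_complex_of_real[of V A "k n"] integrable_of_real[OF k(2)[OF A, unfolded set_integrable_def], where 'a=complex]
      by (auto simp: set_lebesgue_integral_def scaleR_conv_of_real)
    have "integrable V ?h" using gi(1) ki(1) by (intro Bochner_Integration.integrable_add integrable_mult_right)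
    moreover have "(LINT t|V. ?h t) = \<kappa> A"
      unfolding Bochner_Integration.integral_add[OF gi(1) integrable_mult_right[OF ki(1)]]
        integral_mult_right_zero gi(2) ki(2) g(3)[OF A, symmetric] k(3)[OF A, symmetric]
      by (rule complex_eq[symmetric])
    ultimately show ?thesis unfolding set_integrable_def set_lebesgue_integral_def eq by simp
  qed
  have "set_integrable V A h \<and> \<kappa> A = (LINT t:A|V. h t)" if A: "A \<in> bounded_borel" for A
  proof -
    obtain N where N: "A \<subseteq> {0..<real N}" by (rule bounded_borel_subset_cut[OF A])
    have bb: "A \<inter> I n \<in> bounded_borel" for n
      using bounded_borel_subset[OF A, of "A \<inter> I n"] A by (auto simp: bounded_borel_def I_def)
    have ex: "\<exists>n. t \<in> I n \<and> n < N" if "t \<in> A" for t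
    proof (intro exI[of _ "nat \<lfloor>t\<rfloor>"])
      have "0 \<le> t" "t < real N" using N that by auto
      then show "t \<in> I (nat \<lfloor>t\<rfloor>) \<and> nat \<lfloor>t\<rfloor> < N" by (auto simp: I_def floor_less_iff nat_less_iff)
    qed
    have dec: "A = (\<Union>n<N. A \<inter> I n)" "A = (\<Union>n. A \<inter> I n)" using ex by blast+
    have disI: "I m \<inter> I n = {}" if "m \<noteq> n" for m n
      using that by (auto simp: I_def)
    have dis: "disjoint_family_on (\<lambda>n. A \<inter> I n) S" for S
      using disI by (auto simp: disjoint_family_on_def)
    have "(\<lambda>n. \<kappa> (A \<inter> I n)) sums \<kappa> (\<Union>n. A \<inter> I n)"
      using A dec(2) by (intro lf_sums[OF \<kappa> bb dis]) (simp add: bounded_borel_def)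
    then have s1: "(\<lambda>n. \<kappa> (A \<inter> I n)) sums \<kappa> A" using dec(2) by simp
    have "(\<lambda>n. \<kappa> (A \<inter> I n)) sums (\<Sum>n<N. \<kappa> (A \<inter> I n))"
    proof (rule sums_finite)
      fix n assume "n \<notin> {..<N}"
      then have "A \<inter> I n = {}" using N by (force simp: I_def)
      then show "\<kappa> (A \<inter> I n) = 0" using lf_empty[OF \<kappa>] by simp
    qed simp
    with s1 have "\<kappa> A = (\<Sum>n<N. \<kappa> (A \<inter> I n))" by (rule sums_unique2)
    also have "\<dots> = (\<Sum>n<N. LINT t:(A \<inter> I n)|V. h t)"
      using piece[OF bb] by (intro sum.cong) auto
    also have "\<dots> = (LINT t:(\<Union>n<N. A \<inter> I n)|V. h t)"
      using piece[OF bb] dis bbV[OF bb] by (intro set_integral_finite_Union[symmetric]) auto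
    finally have "\<kappa> A = (LINT t:A|V. h t)" using dec(1) by simp
    moreover have "set_integrable V (\<Union>n<N. A \<inter> I n) h"
      using piece[OF bb] bbV[OF bb] by (intro set_integrable_UN) auto
    ultimately show ?thesis using dec(1) by simp
  qed
  then have "has_cm_density \<kappa> V h"
    using sV h_meas lf_outside[OF \<kappa>] unfolding has_cm_density_def by blast
  then show ?thesis unfolding V_def by blast
qed

text \<open>
The functional $q \mapsto \int q(e^{-t})\,e^{-t}\,f(t)\,d\nu(t)$. The extra factor $e^{-t}$ makes the measure finite and
sends the monomial $y^i$ to the value of the Laplace transform at $i + 1$.
\<close>

definition exp_pairing :: "real measure \<Rightarrow> (real \<Rightarrow> complex) \<Rightarrow> (real \<Rightarrow> real) \<Rightarrow> complex" where
  "exp_pairing \<nu> f q = (LINT t|\<nu>. of_real (q (exp (- t)) * exp (- t)) * f t)"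

section \<open>Uniqueness of the Laplace transform\<close>

text \<open>
Continuous functions of $y = e^{-t}$ for which $y \cdot \mathrm{ramp}(y)$ tends to the indicator of
$y \ge c$, that is of $t \le b$ when $c = e^{-b}$. The division by $y$ (cut off at $c$) compensates the weight
$e^{-t}$ of the pairing.
\<close>

definition ramp :: "real \<Rightarrow> nat \<Rightarrow> real \<Rightarrow> real" where
  "ramp c n y = max 0 (min 1 (1 + real n * (y - c))) / max y c"

context
  fixes \<kappa> :: "real set \<Rightarrow> complex" and \<nu> :: "real measure" and f :: "real \<Rightarrow> complex"
  assumes dens: "has_cm_density \<kappa> \<nu> f"
    and integrable: "\<And>n::nat. integrable \<nu> (\<lambda>t. of_real (exp (- (real (Suc n) * t))) * f t)"
begin

lemma integrable_exp_pairing: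
  assumes q: "q \<in> borel_measurable borel" "\<And>y. y \<in> {0..1} \<Longrightarrow> \<bar>q y\<bar> \<le> C"
  shows "integrable \<nu> (\<lambda>t. of_real (q (exp (- t)) * exp (- t)) * f t)"
proof (rule Bochner_Integration.integrable_bound)
  show "integrable \<nu> (\<lambda>t. C *\<^sub>R (of_real (exp (- t)) * f t))"
    using integrable[of 0] by simp
  have m: "(\<lambda>t. t) \<in> measurable \<nu> borel"
    unfolding measurable_cong_sets[OF density_sets[OF dens] refl] by (intro measurable_restrict_space1) measurable
  note [measurable] = density_measurable[OF dens] m
  have [measurable]: "(\<lambda>t. exp (- t)) \<in> borel_measurable \<nu>" by measurable
  have [measurable]: "(\<lambda>t. q (exp (- t))) \<in> borel_measurable \<nu>"
    by (rule measurable_compose[OF _ q(1)]) measurable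
  show "(\<lambda>t. of_real (q (exp (- t)) * exp (- t)) * f t) \<in> borel_measurable \<nu>"
    by measurable
  show "AE t in \<nu>. norm (of_real (q (exp (- t)) * exp (- t)) * f t) \<le> norm (C *\<^sub>R (of_real (exp (- t)) * f t))"
  proof (rule AE_I2)
    fix t assume "t \<in> space \<nu>"
    then have "exp (- t) \<in> {0..1}" by (auto simp: density_space[OF dens])
    then have "\<bar>q (exp (- t))\<bar> \<le> \<bar>C\<bar>" using q(2) by fastforce
    then show "norm (of_real (q (exp (- t)) * exp (- t)) * f t) \<le> norm (C *\<^sub>R (of_real (exp (- t)) * f t))"
      by (auto simp: norm_mult abs_mult mult.assoc intro!: mult_right_mono)
  qed
qed

lemma exp_pairing_diff_bound:
  assumes p: "p \<in> borel_measurable borel" "\<And>y. y \<in> {0..1} \<Longrightarrow> \<bar>p y\<bar> \<le> C"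
    and q: "q \<in> borel_measurable borel" "\<And>y. y \<in> {0..1} \<Longrightarrow> \<bar>q y\<bar> \<le> D"
    and close: "\<And>y. y \<in> {0..1} \<Longrightarrow> \<bar>p y - q y\<bar> \<le> e"
  shows "norm (exp_pairing \<nu> f p - exp_pairing \<nu> f q) \<le> e * (LINT t|\<nu>. norm (of_real (exp (- t)) * f t))"
proof -
  note ip = integrable_exp_pairing[OF p] and iq = integrable_exp_pairing[OF q]
  have i1: "integrable \<nu> (\<lambda>t. norm (of_real (exp (- t)) * f t))"
    using integrable_norm[OF integrable[of 0]] by simp
  have "exp_pairing \<nu> f p - exp_pairing \<nu> f q =
      (LINT t|\<nu>. of_real (p (exp (- t)) * exp (- t)) * f t - of_real (q (exp (- t)) * exp (- t)) * f t)"
    unfolding exp_pairing_def by (rule Bochner_Integration.integral_diff[OF ip iq, symmetric])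
  also have "norm \<dots> \<le> (LINT t|\<nu>. norm (of_real (p (exp (- t)) * exp (- t)) * f t - of_real (q (exp (- t)) * exp (- t)) * f t))"
    by (rule integral_norm_bound)
  also have "\<dots> \<le> (LINT t|\<nu>. e * norm (of_real (exp (- t)) * f t))"
  proof (rule integral_mono)
    fix t assume "t \<in> space \<nu>"
    then have "exp (- t) \<in> {0..1}" by (auto simp: density_space[OF dens])
    then have "\<bar>p (exp (- t)) - q (exp (- t))\<bar> \<le> e" by (rule close)
    then have "\<bar>p (exp (- t)) - q (exp (- t))\<bar> * norm (of_real (exp (- t)) * f t) \<le> e * norm (of_real (exp (- t)) * f t)"
      by (rule mult_right_mono) simp
    moreover have "of_real (p (exp (- t)) * exp (- t)) * f t - of_real (q (exp (- t)) * exp (- t)) * f t =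
        of_real (p (exp (- t)) - q (exp (- t))) * (of_real (exp (- t)) * f t)"
      by (simp add: algebra_simps)
    ultimately show "norm (of_real (p (exp (- t)) * exp (- t)) * f t - of_real (q (exp (- t)) * exp (- t)) * f t)
        \<le> e * norm (of_real (exp (- t)) * f t)"
      by (simp only: norm_mult norm_of_real)
  qed (use ip iq i1 in \<open>auto intro!: integrable_norm Bochner_Integration.integrable_diff integrable_mult_right simp del: integrable_norm_iff\<close>)
  also have "\<dots> = e * (LINT t|\<nu>. norm (of_real (exp (- t)) * f t))" by simp
  finally show ?thesis .
qed

lemma exp_pairing_polynomial:
  "exp_pairing \<nu> f (\<lambda>y. \<Sum>i\<le>n. a i * y ^ i) =
     (\<Sum>i\<le>n. of_real (a i) * (LINT t|\<nu>. of_real (exp (- (real (Suc i) * t))) * f t))"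
proof -
  have "of_real ((\<Sum>i\<le>n. a i * exp (- t) ^ i) * exp (- t)) * f t =
      (\<Sum>i\<le>n. of_real (a i) * (of_real (exp (- (real (Suc i) * t))) * f t))" for t
  proof -
    \<comment> \<open>The weight shifts the exponent by one.\<close>
    have e: "exp (- t) ^ i * exp (- t) = exp (- (real (Suc i) * t))" for i
      using exp_of_nat_mult[of "Suc i" "- t"] by (simp add: mult.commute)
    have "(\<Sum>i\<le>n. a i * exp (- t) ^ i) * exp (- t) = (\<Sum>i\<le>n. a i * exp (- (real (Suc i) * t)))"
      unfolding sum_distrib_right by (intro sum.cong refl) (simp only: e mult.assoc)
    then show ?thesis
      by (simp only: of_real_sum of_real_mult sum_distrib_right mult.assoc)
  qed
  then show ?thesis
    unfolding exp_pairing_def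
    by (simp only: Bochner_Integration.integral_sum[OF integrable_mult_right[OF integrable]] integral_mult_right_zero)
qed

lemma exp_pairing_ramp_limit:
  assumes b: "0 \<le> b"
  shows "(\<lambda>n. exp_pairing \<nu> f (ramp (exp (- b)) n)) \<longlonglongrightarrow> \<kappa> {0..b}"
proof -
  let ?c = "exp (- b)"
  have bb: "{0..b} \<in> bounded_borel" by (auto simp: bounded_borel_def)
  have ramp_bound: "\<bar>ramp ?c n y\<bar> \<le> 1 / ?c" for n y
    unfolding ramp_def abs_divide by (intro frac_le) auto
  have ramp_meas: "ramp ?c n \<in> borel_measurable borel" for n
    unfolding ramp_def[abs_def] by measurable
  have bdd: "\<bar>ramp ?c n y\<bar> \<le> 1 / ?c" if "y \<in> {0..1}" for n y by (rule ramp_bound)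
  have "(\<lambda>n. LINT t|\<nu>. of_real (ramp ?c n (exp (- t)) * exp (- t)) * f t) \<longlonglongrightarrow> (LINT t|\<nu>. indicator {0..b} t *\<^sub>R f t)"
  proof (rule integral_dominated_convergence)
    show "integrable \<nu> (\<lambda>t. 1 / ?c * norm (of_real (exp (- t)) * f t))"
      using integrable_norm[OF integrable[of 0]] by (intro integrable_mult_right) simp
    show "(\<lambda>t. indicator {0..b} t *\<^sub>R f t) \<in> borel_measurable \<nu>"
      using density_set_integrable[OF dens bb] unfolding set_integrable_def by (rule borel_measurable_integrable)
    show "(\<lambda>t. of_real (ramp ?c n (exp (- t)) * exp (- t)) * f t) \<in> borel_measurable \<nu>" for n
      by (rule borel_measurable_integrable[OF integrable_exp_pairing[OF ramp_meas bdd]])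
    show "AE t in \<nu>. norm (of_real (ramp ?c n (exp (- t)) * exp (- t)) * f t) \<le> 1 / ?c * norm (of_real (exp (- t)) * f t)" for n
      using mult_right_mono[OF ramp_bound norm_ge_zero[of "of_real (exp (- t)) * f t" for t]]
      by (simp add: norm_mult abs_mult mult.assoc)
    show "AE t in \<nu>. (\<lambda>n. of_real (ramp ?c n (exp (- t)) * exp (- t)) * f t) \<longlonglongrightarrow> indicator {0..b} t *\<^sub>R f t"
    proof (rule AE_I2)
      fix t assume "t \<in> space \<nu>"
      then have t: "0 \<le> t" by (simp add: density_space[OF dens])
      show "(\<lambda>n. of_real (ramp ?c n (exp (- t)) * exp (- t)) * f t) \<longlonglongrightarrow> indicator {0..b} t *\<^sub>R f t"
      proof (cases "t \<le> b")
        case True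
        then have "1 \<le> 1 + real n * (exp (- t) - ?c)" for n by simp
        then have "max 0 (min 1 (1 + real n * (exp (- t) - ?c))) = 1" for n by (simp add: min_absorb1)
        then have "ramp ?c n (exp (- t)) * exp (- t) = 1" for n
          using True by (simp add: ramp_def max_absorb1)
        then show ?thesis using True t by simp
      next
        case False
        then have d: "0 < ?c - exp (- t)" by simp
        obtain N where N: "1 / (?c - exp (- t)) < real N" using reals_Archimedean2 by blast
        have "ramp ?c n (exp (- t)) = 0" if "N \<le> n" for n
        proof -
          have "1 / (?c - exp (- t)) \<le> real n" using N that by linarith
          then have "1 \<le> real n * (?c - exp (- t))" using d by (simp add: field_simps)
          then have "1 + real n * (exp (- t) - ?c) \<le> 0" by (simp add: algebra_simps)
          then show ?thesis by (simp add: ramp_def max_absorb1 min_def)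
        qed
        then have "eventually (\<lambda>n. of_real (ramp ?c n (exp (- t)) * exp (- t)) * f t = 0) sequentially"
          by (auto simp: eventually_sequentially)
        then show ?thesis using False by (simp add: tendsto_eventually)
      qed
    qed
  qed
  then show ?thesis
    by (simp add: exp_pairing_def density_eq[OF dens bb] set_lebesgue_integral_def)
qed

end

text \<open>
The initial intervals generate the Borel sets and are stable under intersection, so Dynkin's
$\pi$-$\lambda$ theorem applies inside each $[0,N]$.
\<close>

lemma lf_complex_measure_eqI:
  assumes \<kappa>: "lf_complex_measure \<kappa>" and \<kappa>': "lf_complex_measure \<kappa>'"
    and eq: "\<And>b. 0 \<le> b \<Longrightarrow> \<kappa> {0..b} = \<kappa>' {0..b}"
  shows "\<kappa> = \<kappa>'"
proof
  fix A
  have agree: "\<kappa> (A \<inter> {0..real N}) = \<kappa>' (A \<inter> {0..real N})" if "A \<in> sets borel" for A N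
  proof -
    let ?G = "range (\<lambda>a::real. {..a})"
    have "Int_stable ?G" by (auto simp: Int_stable_def)
    moreover have "?G \<subseteq> Pow UNIV" by simp
    moreover have "A \<in> sigma_sets UNIV ?G" using that by (simp add: borel_eq_atMost)
    ultimately show ?thesis
    proof (induction rule: sigma_sets_induct_disjoint)
      case (basic A)
      then obtain a where A: "A = {..a}" by auto
      show ?case
      proof (cases "0 \<le> a")
        case True
        then have "A \<inter> {0..real N} = {0..min a (real N)}" by (auto simp: A)
        then show ?thesis using eq True by simp
      next
        case False
        then have "A \<inter> {0..real N} = {}" by (auto simp: A)
        then show ?thesis by (simp add: lf_empty \<kappa> \<kappa>')
      qed
    next
      case empty
      show ?case by (simp add: lf_empty \<kappa> \<kappa>')
    next
      case (compl A)
      then have A: "A \<in> sets borel" by (simp add: borel_eq_atMost)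
      have *: "{0..real N} = (A \<inter> {0..real N}) \<union> ((UNIV - A) \<inter> {0..real N})" by auto
      have "\<mu> {0..real N} = \<mu> (A \<inter> {0..real N}) + \<mu> ((UNIV - A) \<inter> {0..real N})" if "lf_complex_measure \<mu>" for \<mu>
        using A by (subst *, intro lf_Un[OF that] bounded_borel_cut) auto
      from this[OF \<kappa>] this[OF \<kappa>'] show ?case using compl eq[of "real N"] by simp
    next
      case (union A)
      have A: "A i \<in> sets borel" for i using union(2) by (auto simp: borel_eq_atMost)
      have "(\<lambda>i. \<mu> (A i \<inter> {0..real N})) sums \<mu> (\<Union>i. A i \<inter> {0..real N})" if "lf_complex_measure \<mu>" for \<mu>
      proof (rule lf_sums[OF that bounded_borel_cut[OF A]])
        show "disjoint_family (\<lambda>i. A i \<inter> {0..real N})"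
          using union(1) by (auto simp: disjoint_family_on_def)
        show "bounded (\<Union>i. A i \<inter> {0..real N})"
          by (rule bounded_subset[OF bounded_closed_interval]) auto
      qed
      from this[OF \<kappa>] this[OF \<kappa>'] show ?case
        using union(3) by (simp add: sums_unique2)
    qed
  qed
  show "\<kappa> A = \<kappa>' A"
  proof (cases "A \<in> bounded_borel")
    case True
    obtain N where "A \<subseteq> {0..<real N}" by (rule bounded_borel_subset_cut[OF True])
    then have "A \<inter> {0..real N} = A" by auto
    then show ?thesis using agree[of A N] True by (simp add: bounded_borel_def)
  next
    case False
    then show ?thesis using \<kappa> \<kappa>' by (simp add: lf_outside)
  qed
qed

text \<open>
The pairings agree on polynomials, by uniform approximation on $[0,1]$ on all continuous
functions, and by dominated convergence along the ramps on the indicators of initial intervals.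
\<close>

lemma laplace_moments_unique:
  assumes \<kappa>: "has_cm_density \<kappa> \<nu> f"
      "\<And>n::nat. integrable \<nu> (\<lambda>t. of_real (exp (- (real (Suc n) * t))) * f t)"
    and \<kappa>': "has_cm_density \<kappa>' \<nu>' g"
      "\<And>n::nat. integrable \<nu>' (\<lambda>t. of_real (exp (- (real (Suc n) * t))) * g t)"
    and eq: "\<And>n::nat. (LINT t|\<nu>. of_real (exp (- (real (Suc n) * t))) * f t) =
       (LINT t|\<nu>'. of_real (exp (- (real (Suc n) * t))) * g t)"
  shows "\<kappa> = \<kappa>'"
proof (rule lf_complex_measure_eqI)
  have cont: "exp_pairing \<nu> f q = exp_pairing \<nu>' g q" if q: "continuous_on UNIV q" for q
  proof -
    define K where "K = (LINT t|\<nu>. norm (of_real (exp (- t)) * f t)) + (LINT t|\<nu>'. norm (of_real (exp (- t)) * g t))"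
    have K: "0 \<le> K" unfolding K_def by (intro add_nonneg_nonneg integral_nonneg_AE) auto
    have bdd: "\<exists>C. \<forall>y\<in>{0..1}. \<bar>p y\<bar> \<le> C" if "continuous_on UNIV p" for p :: "real \<Rightarrow> real"
      using compact_imp_bounded[OF compact_continuous_image[OF continuous_on_subset[OF that subset_UNIV] compact_Icc[of 0 1]]]
      by (auto simp: bounded_iff)
    have "norm (exp_pairing \<nu> f q - exp_pairing \<nu>' g q) \<le> e * K" if "0 < e" for e
    proof -
      obtain r where r: "real_polynomial_function r" "\<And>y. y \<in> {0..1} \<Longrightarrow> \<bar>q y - r y\<bar> < e"
        using Stone_Weierstrass_real_polynomial_function[OF compact_Icc continuous_on_subset[OF q subset_UNIV] \<open>0 < e\<close>]
        by metis
      obtain a n where rp: "r = (\<lambda>y. \<Sum>i\<le>n. a i * y ^ i)"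
        using r(1) by (auto simp: real_polynomial_function_iff_sum)
      have rc: "continuous_on UNIV r" unfolding rp by (intro continuous_intros)
      obtain C where C: "\<And>y. y \<in> {0..1} \<Longrightarrow> \<bar>q y\<bar> \<le> C" using bdd[OF q] by blast
      obtain D where D: "\<And>y. y \<in> {0..1} \<Longrightarrow> \<bar>r y\<bar> \<le> D" using bdd[OF rc] by blast
      have close: "\<bar>q y - r y\<bar> \<le> e" if "y \<in> {0..1}" for y using r(2)[OF that] by simp
      note m = borel_measurable_continuous_onI[OF q] borel_measurable_continuous_onI[OF rc]
      have "exp_pairing \<nu> f r = exp_pairing \<nu>' g r"
        unfolding rp exp_pairing_polynomial[OF \<kappa>] exp_pairing_polynomial[OF \<kappa>'] eq ..
      moreover have "norm (exp_pairing \<nu> f q - exp_pairing \<nu> f r) \<le> e * (LINT t|\<nu>. norm (of_real (exp (- t)) * f t))"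
        by (rule exp_pairing_diff_bound[OF \<kappa> m(1) C m(2) D close])
      moreover have "norm (exp_pairing \<nu>' g q - exp_pairing \<nu>' g r) \<le> e * (LINT t|\<nu>'. norm (of_real (exp (- t)) * g t))"
        by (rule exp_pairing_diff_bound[OF \<kappa>' m(1) C m(2) D close])
      ultimately show ?thesis
        using norm_triangle_ineq4[of "exp_pairing \<nu> f q - exp_pairing \<nu> f r" "exp_pairing \<nu>' g q - exp_pairing \<nu>' g r"]
        unfolding K_def distrib_left by simp
    qed
    then have "norm (exp_pairing \<nu> f q - exp_pairing \<nu>' g q) \<le> 0 * K"
      by (intro tendsto_le[OF trivial_limit_at_right_real tendsto_mult[OF tendsto_ident_at tendsto_const] tendsto_const])
         (auto simp: eventually_at_filter)
    then show ?thesis by simp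
  qed
  fix b :: real assume b: "0 \<le> b"
  have "continuous_on UNIV (ramp (exp (- b)) n)" for n
    unfolding ramp_def[abs_def] by (intro continuous_intros) (auto simp: max_def)
  then have "(\<lambda>n. exp_pairing \<nu> f (ramp (exp (- b)) n)) \<longlonglongrightarrow> \<kappa>' {0..b}"
    using exp_pairing_ramp_limit[OF \<kappa>' b] by (simp add: cont)
  then show "\<kappa> {0..b} = \<kappa>' {0..b}"
    using exp_pairing_ramp_limit[OF \<kappa> b] by (rule LIMSEQ_unique[rotated])
qed (use \<kappa>(1) \<kappa>'(1) in \<open>auto intro: lf_complex_measure_density\<close>)

section \<open>The inverse Laplace transform\<close>

lemma exp_measurable_halfline:
  assumes "sets \<nu> = sets (restrict_space borel {0::real..})"
  shows "(\<lambda>t. exp (- (x * t)) :: real) \<in> borel_measurable \<nu>"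
  unfolding measurable_cong_sets[OF assms refl] by (intro measurable_restrict_space1) measurable

lemma total_variation_exp_finite_iff:
  assumes dens: "has_cm_density \<kappa> \<nu> f"
  shows "(\<integral>\<^sup>+ t. ennreal (exp (- (x * t))) \<partial>total_variation \<kappa>) < \<infinity> \<longleftrightarrow>
    integrable \<nu> (\<lambda>t. of_real (exp (- (x * t))) * f t)"
proof -
  note [measurable] = density_measurable[OF dens] exp_measurable_halfline[OF density_sets[OF dens], of x]
  have "(\<integral>\<^sup>+ t. ennreal (exp (- (x * t))) \<partial>total_variation \<kappa>) =
      (\<integral>\<^sup>+ t. ennreal (norm (f t)) * ennreal (exp (- (x * t))) \<partial>\<nu>)"
    unfolding total_variation_density[OF dens] by (rule nn_integral_density) auto
  also have "\<dots> = (\<integral>\<^sup>+ t. ennreal (norm (of_real (exp (- (x * t))) * f t)) \<partial>\<nu>)"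
    by (simp add: norm_mult ennreal_mult[symmetric] mult.commute)
  finally show ?thesis by (simp add: integrable_iff_bounded)
qed

lemma laplace_density:
  assumes dens: "has_cm_density \<kappa> \<nu> f"
  shows "laplace \<kappa> x = (LINT t|\<nu>. of_real (exp (- (x * t))) * f t)"
  unfolding laplace_def
  using exp_measurable_halfline[OF density_sets[OF dens], of x]
  by (intro cm_integral_density[OF dens]) simp

text \<open>
On $[0,N]$ the constant 1 is bounded by $e^N e^{-t}$. This is where the integrability condition on admissible
measures yields the local finiteness that Radon-Nikodym needs.
\<close>

lemma variation_finite_of_laplace:
  assumes \<kappa>: "lf_complex_measure \<kappa>"
    and fin: "(\<integral>\<^sup>+ t. ennreal (exp (- (1 * t))) \<partial>total_variation \<kappa>) < \<infinity>"
    and A: "A \<in> bounded_borel"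
  shows "variation \<kappa> A < \<infinity>"
proof -
  have AV: "A \<in> sets (total_variation \<kappa>)"
    by (simp add: sets_total_variation bounded_borel_halfline[OF A])
  obtain N where N: "A \<subseteq> {0..<real N}" by (rule bounded_borel_subset_cut[OF A])
  have "variation \<kappa> A = emeasure (total_variation \<kappa>) A"
    using emeasure_total_variation[OF \<kappa> bounded_borel_halfline[OF A]] by simp
  also have "\<dots> = (\<integral>\<^sup>+ t. indicator A t \<partial>total_variation \<kappa>)" using AV by simp
  also have "\<dots> \<le> (\<integral>\<^sup>+ t. ennreal (exp (real N)) * ennreal (exp (- (1 * t))) \<partial>total_variation \<kappa>)"
  proof (rule nn_integral_mono)
    fix t
    have "1 \<le> exp (real N) * exp (- (1 * t))" if "t \<in> A"
      using that N by (auto simp: exp_add[symmetric])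
    then show "indicator A t \<le> ennreal (exp (real N)) * ennreal (exp (- (1 * t)))"
      by (auto simp: ennreal_mult[symmetric] split: split_indicator)
  qed
  also have "\<dots> = ennreal (exp (real N)) * (\<integral>\<^sup>+ t. ennreal (exp (- (1 * t))) \<partial>total_variation \<kappa>)"
    using exp_measurable_halfline[OF sets_total_variation, of 1] by (intro nn_integral_cmult) auto
  also have "\<dots> < \<infinity>" using fin by (simp add: ennreal_mult_less_top)
  finally show ?thesis .
qed

text \<open>
A competitor of \<open>\<kappa>\<close> with the same Laplace transform has a density by Radon-Nikodym, and then equals \<open>\<kappa>\<close> because
both have the same transform at the positive integers.
\<close>

theorem inverse_laplace_density:
  assumes dens: "has_cm_density \<kappa> \<nu> f"
    and int: "\<And>x. 0 < x \<Longrightarrow> integrable \<nu> (\<lambda>t. of_real (exp (- (x * t))) * f t)"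
    and eq: "\<And>x. 0 < x \<Longrightarrow> (LINT t|\<nu>. of_real (exp (- (x * t))) * f t) = g x"
  shows "inverse_laplace g = \<kappa>"
  unfolding inverse_laplace_def
proof (rule the_equality)
  show "lf_complex_measure \<kappa> \<and> (\<forall>x>0. (\<integral>\<^sup>+ t. ennreal (exp (- (x * t))) \<partial>total_variation \<kappa>) < \<infinity>) \<and>
      (\<forall>x>0. laplace \<kappa> x = g x)"
    using lf_complex_measure_density[OF dens] total_variation_exp_finite_iff[OF dens] laplace_density[OF dens] int eq
    by simp
next
  fix \<kappa>'
  assume *: "lf_complex_measure \<kappa>' \<and> (\<forall>x>0. (\<integral>\<^sup>+ t. ennreal (exp (- (x * t))) \<partial>total_variation \<kappa>') < \<infinity>) \<and>
      (\<forall>x>0. laplace \<kappa>' x = g x)"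
  then have lf: "lf_complex_measure \<kappa>'"
    and fin: "\<And>x. 0 < x \<Longrightarrow> (\<integral>\<^sup>+ t. ennreal (exp (- (x * t))) \<partial>total_variation \<kappa>') < \<infinity>"
    and lap: "\<And>x. 0 < x \<Longrightarrow> laplace \<kappa>' x = g x"
    by auto
  obtain h where h: "has_cm_density \<kappa>' (total_variation \<kappa>') h"
    using lf_complex_measure_has_density[OF lf variation_finite_of_laplace[OF lf fin]] by auto
  have int': "integrable (total_variation \<kappa>') (\<lambda>t. of_real (exp (- (x * t))) * h t)" if "0 < x" for x
    using fin[OF that] total_variation_exp_finite_iff[OF h] by blast
  show "\<kappa>' = \<kappa>"
  proof (rule laplace_moments_unique[OF h _ dens])
    fix n :: nat
    show "integrable (total_variation \<kappa>') (\<lambda>t. of_real (exp (- (real (Suc n) * t))) * h t)"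
      by (rule int') simp
    show "integrable \<nu> (\<lambda>t. of_real (exp (- (real (Suc n) * t))) * f t)"
      by (rule int) simp
    have "laplace \<kappa>' (real (Suc n)) = laplace \<kappa> (real (Suc n))"
      using lap eq laplace_density[OF dens] by simp
    then show "(LINT t|total_variation \<kappa>'. of_real (exp (- (real (Suc n) * t))) * h t) =
        (LINT t|\<nu>. of_real (exp (- (real (Suc n) * t))) * f t)"
      unfolding laplace_density[OF dens] laplace_density[OF h] .
  qed
qed

section \<open>A point mass at the origin minus a density\<close>

text \<open>
The measure $\delta_0 + dt$ on the half-line: the map $t \mapsto \max(0,t)$ compresses the unit interval
$[-1,0]$ into a unit mass at the origin.
\<close>

definition dirac_plus_lebesgue :: "real measure" where
  "dirac_plus_lebesgue = distr (restrict_space lborel {-1..}) (restrict_space borel {0..}) (max 0)"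

lemma dirac_plus_lebesgue_integral:
  fixes F :: "real \<Rightarrow> complex"
  assumes F[measurable]: "F \<in> borel_measurable borel" and int: "set_integrable lborel {0<..} F"
  shows "integrable dirac_plus_lebesgue F"
    and "(LINT t|dirac_plus_lebesgue. F t) = F 0 + (LINT t:{0<..}|lborel. F t)"
proof -
  have m: "max 0 \<in> measurable (restrict_space lborel {-1::real..}) (restrict_space borel {0..})"
    by (intro measurable_restrict_space3) auto
  have F': "F \<in> borel_measurable (restrict_space borel {0..})"
    by (intro measurable_restrict_space1) measurable
  \<comment> \<open>The two pieces carry the point mass and Lebesgue measure.\<close>
  have dec: "{-1::real..} = {-1..0} \<union> {0<..}" by auto
  have 1: "set_integrable lborel {-1..0} (\<lambda>t. F (max 0 t))"
    and piece0: "(LINT t:{-1..0}|lborel. F (max 0 t)) = F 0"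
  proof -
    have c: "indicator {-1..0} t *\<^sub>R F (max 0 t) = indicator {-1..0} t *\<^sub>R F 0" for t :: real
      by (auto split: split_indicator)
    show "set_integrable lborel {-1..0} (\<lambda>t. F (max 0 t))"
      unfolding set_integrable_def c by (rule integrable_scaleR_left) simp
    show "(LINT t:{-1..0}|lborel. F (max 0 t)) = F 0"
      unfolding set_lebesgue_integral_def c by (subst integral_scaleR_left) auto
  qed
  have c: "indicator {0<..} t *\<^sub>R F (max 0 t) = indicator {0<..} t *\<^sub>R F t" for t :: real
    by (auto split: split_indicator)
  have 2: "set_integrable lborel {0<..} (\<lambda>t. F (max 0 t))"
    using int unfolding set_integrable_def c .
  have piece1: "(LINT t:{0<..}|lborel. F (max 0 t)) = (LINT t:{0<..}|lborel. F t)"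
    unfolding set_lebesgue_integral_def c ..
  have int': "set_integrable lborel {-1..} (\<lambda>t. F (max 0 t))"
    unfolding dec by (rule set_integrable_Un[OF 1 2]) auto
  show "integrable dirac_plus_lebesgue F"
    unfolding dirac_plus_lebesgue_def integrable_distr_eq[OF m F']
    using int' by (subst integrable_restrict_space) (auto simp: set_integrable_def)
  have "(LINT t|dirac_plus_lebesgue. F t) = (LINT t:{-1..}|lborel. F (max 0 t))"
    unfolding dirac_plus_lebesgue_def integral_distr[OF m F']
    by (subst integral_restrict_space) (auto simp: set_lebesgue_integral_def)
  also have "\<dots> = F 0 + (LINT t:{0<..}|lborel. F t)"
    unfolding dec using piece0 piece1 by (subst set_integral_Un[OF _ 1 2]) auto
  finally show "(LINT t|dirac_plus_lebesgue. F t) = F 0 + (LINT t:{0<..}|lborel. F t)" .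
qed

definition atom_minus_density :: "real \<Rightarrow> (real \<Rightarrow> real) \<Rightarrow> real \<Rightarrow> complex" where
  "atom_minus_density c w t = (if t = 0 then of_real c else - of_real (w t))"

text \<open>
The complex measure $c\,\delta_0 - w(t)\,dt$.
\<close>

definition atom_minus_measure :: "real \<Rightarrow> (real \<Rightarrow> real) \<Rightarrow> real set \<Rightarrow> complex" where
  "atom_minus_measure c w A =
     (if A \<in> bounded_borel then LINT t:A|dirac_plus_lebesgue. atom_minus_density c w t else 0)"

context
  fixes c :: real and w :: "real \<Rightarrow> real"
  assumes w[measurable]: "w \<in> borel_measurable borel"
    and w_int: "\<And>x. 0 < x \<Longrightarrow> set_integrable lborel {0<..} (\<lambda>t. exp (- (x * t)) * w t)"
begin

lemma atom_minus_density_measurable[measurable]: "atom_minus_density c w \<in> borel_measurable borel"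
  unfolding atom_minus_density_def[abs_def] by measurable

lemma atom_minus_integral:
  fixes F :: "real \<Rightarrow> complex"
  assumes F[measurable]: "F \<in> borel_measurable borel"
    and int: "set_integrable lborel {0<..} (\<lambda>t. F t * of_real (w t))"
  shows "integrable dirac_plus_lebesgue (\<lambda>t. F t * atom_minus_density c w t)"
    and "(LINT t|dirac_plus_lebesgue. F t * atom_minus_density c w t) =
      F 0 * of_real c - (LINT t:{0<..}|lborel. F t * of_real (w t))"
proof -
  have e: "indicator {0<..} t *\<^sub>R (F t * atom_minus_density c w t) = - (indicator {0<..} t *\<^sub>R (F t * of_real (w t)))" for t
    by (auto simp: atom_minus_density_def split: split_indicator)
  have i: "set_integrable lborel {0<..} (\<lambda>t. F t * atom_minus_density c w t)"
    using int unfolding set_integrable_def e by simp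
  show "integrable dirac_plus_lebesgue (\<lambda>t. F t * atom_minus_density c w t)"
    by (rule dirac_plus_lebesgue_integral[OF _ i]) measurable
  have "(LINT t|dirac_plus_lebesgue. F t * atom_minus_density c w t) =
      F 0 * atom_minus_density c w 0 + (LINT t:{0<..}|lborel. F t * atom_minus_density c w t)"
    by (rule dirac_plus_lebesgue_integral[OF _ i]) measurable
  then show "(LINT t|dirac_plus_lebesgue. F t * atom_minus_density c w t) =
      F 0 * of_real c - (LINT t:{0<..}|lborel. F t * of_real (w t))"
    unfolding set_lebesgue_integral_def e by (simp add: atom_minus_density_def)
qed

lemma exp_w_integrable:
  assumes "0 < x"
  shows "set_integrable lborel {0<..} (\<lambda>t. of_real (exp (- (x * t))) * complex_of_real (w t))"
  using integrable_of_real[OF w_int[OF assms, unfolded set_integrable_def], where 'a=complex]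
  by (simp add: set_integrable_def scaleR_conv_of_real)

lemma has_cm_density_atom_minus:
  "has_cm_density (atom_minus_measure c w) dirac_plus_lebesgue (atom_minus_density c w)"
  unfolding has_cm_density_def
proof (intro conjI ballI allI impI)
  show s: "sets dirac_plus_lebesgue = sets (restrict_space borel {0..})"
    by (simp add: dirac_plus_lebesgue_def)
  show m: "atom_minus_density c w \<in> borel_measurable dirac_plus_lebesgue"
    unfolding measurable_cong_sets[OF s refl] by (intro measurable_restrict_space1) measurable
  fix A assume A: "A \<in> bounded_borel"
  obtain N where N: "A \<subseteq> {0..<real N}" by (rule bounded_borel_subset_cut[OF A])
  have i: "integrable dirac_plus_lebesgue (\<lambda>t. exp (real N) *\<^sub>R (of_real (exp (- (1 * t))) * atom_minus_density c w t))"
    by (intro integrable_scaleR_right atom_minus_integral exp_w_integrable) auto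
  show "set_integrable dirac_plus_lebesgue A (atom_minus_density c w)"
    unfolding set_integrable_def
  proof (rule Bochner_Integration.integrable_bound[OF i])
    show "(\<lambda>t. indicator A t *\<^sub>R atom_minus_density c w t) \<in> borel_measurable dirac_plus_lebesgue"
      using m bounded_borel_halfline[OF A] s by measurable
    have "1 \<le> exp (real N) * exp (- t)" if "t \<in> A" for t
      using that N by (auto simp: exp_add[symmetric])
    then show "AE t in dirac_plus_lebesgue. norm (indicator A t *\<^sub>R atom_minus_density c w t) \<le>
        norm (exp (real N) *\<^sub>R (of_real (exp (- (1 * t))) * atom_minus_density c w t))"
      using mult_right_mono[OF _ norm_ge_zero, of 1 _ "atom_minus_density c w t" for t]
      by (auto simp: norm_mult mult.assoc[symmetric] split: split_indicator)
  qed
qed (auto simp: atom_minus_measure_def)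

lemma inverse_laplace_atom_minus:
  assumes "\<And>x. 0 < x \<Longrightarrow> g x = of_real (c - (LINT t:{0<..}|lborel. exp (- (x * t)) * w t))"
  shows "inverse_laplace g = atom_minus_measure c w"
proof (rule inverse_laplace_density[OF has_cm_density_atom_minus])
  fix x :: real assume x: "0 < x"
  have m: "(\<lambda>t. complex_of_real (exp (- (x * t)))) \<in> borel_measurable borel" by measurable
  show "integrable dirac_plus_lebesgue (\<lambda>t. of_real (exp (- (x * t))) * atom_minus_density c w t)"
    by (rule atom_minus_integral(1)[OF m exp_w_integrable[OF x]])
  have "(LINT t|dirac_plus_lebesgue. of_real (exp (- (x * t))) * atom_minus_density c w t) =
      of_real c - (LINT t:{0<..}|lborel. of_real (exp (- (x * t))) * complex_of_real (w t))"
    by (subst atom_minus_integral(2)[OF m exp_w_integrable[OF x]]) simp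
  also have "(LINT t:{0<..}|lborel. of_real (exp (- (x * t))) * complex_of_real (w t)) =
      of_real (LINT t:{0<..}|lborel. exp (- (x * t)) * w t)"
    by (simp add: set_integral_complex_of_real[symmetric])
  finally show "(LINT t|dirac_plus_lebesgue. of_real (exp (- (x * t))) * atom_minus_density c w t) = g x"
    by (simp add: assms[OF x])
qed

lemma cm_integral_atom_minus:
  fixes F :: "real \<Rightarrow> complex"
  assumes F[measurable]: "F \<in> borel_measurable borel"
    and int: "set_integrable lborel {0<..} (\<lambda>t. F t * of_real (w t))"
  shows "cm_integral (atom_minus_measure c w) F = F 0 * of_real c - (LINT t:{0<..}|lborel. F t * of_real (w t))"
proof -
  have "F \<in> borel_measurable dirac_plus_lebesgue"
    unfolding measurable_cong_sets[OF density_sets[OF has_cm_density_atom_minus] refl]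
    by (intro measurable_restrict_space1) measurable
  then show ?thesis
    using cm_integral_density[OF has_cm_density_atom_minus] atom_minus_integral(2)[OF F int] by simp
qed

end

section \<open>The power series of the error function\<close>

definition erf_term :: "nat \<Rightarrow> real \<Rightarrow> real" where
  "erf_term n z = (-1) ^ n * z ^ (2 * n + 1) / (fact n * real (2 * n + 1))"

lemma erf_term_derivative:
  "(erf_term n has_real_derivative (- (z\<^sup>2)) ^ n / fact n) (at z)"
proof -
  have "((\<lambda>z. (-1) ^ n * z ^ (2 * n + 1) / (fact n * real (2 * n + 1))) has_real_derivative
      (-1) ^ n * (real (2 * n + 1) * z ^ (2 * n)) / (fact n * real (2 * n + 1))) (at z)"
    by (rule derivative_eq_intros refl | simp)+
  moreover have "(-1) ^ n * (real (2 * n + 1) * z ^ (2 * n)) / (fact n * real (2 * n + 1)) = (- (z\<^sup>2)) ^ n / fact n"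
    by (simp add: power_mult power_minus[of "z\<^sup>2"] del: of_nat_Suc of_nat_add)
  ultimately show ?thesis by (simp add: erf_term_def[abs_def])
qed

text \<open>
The differentiated series is that of $e^{-z^2}$, which converges uniformly on balls by the Weierstrass test.
\<close>

lemma erf_series_derivative:
  shows "summable (\<lambda>n. erf_term n z)"
    and "((\<lambda>z. \<Sum>n. erf_term n z) has_real_derivative exp (- (z\<^sup>2))) (at z)"
proof -
  let ?S = "ball 0 (\<bar>z\<bar> + 1) :: real set"
  have S: "convex ?S" "z \<in> interior ?S" "0 \<in> ?S" by auto
  have d: "(erf_term n has_field_derivative (- (x\<^sup>2)) ^ n / fact n) (at x within ?S)" for n x
    using erf_term_derivative by (rule has_field_derivative_at_within)
  have u: "uniformly_convergent_on ?S (\<lambda>n x. \<Sum>i<n. (- (x\<^sup>2)) ^ i / fact i)"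
  proof (rule Weierstrass_m_test')
    fix n :: nat and x :: real assume "x \<in> ?S"
    then have "\<bar>x\<bar>\<^sup>2 \<le> (\<bar>z\<bar> + 1)\<^sup>2" by (intro power_mono) auto
    then have "(x\<^sup>2) ^ n \<le> ((\<bar>z\<bar> + 1)\<^sup>2) ^ n"
      using power_mono[of "x\<^sup>2" "(\<bar>z\<bar> + 1)\<^sup>2" n] by simp
    then show "norm ((- (x\<^sup>2)) ^ n / fact n) \<le> ((\<bar>z\<bar> + 1)\<^sup>2) ^ n / fact n"
      by (simp add: power_abs divide_right_mono)
  next
    show "summable (\<lambda>n. ((\<bar>z\<bar> + 1)\<^sup>2) ^ n / fact n)"
      using summable_exp[of "(\<bar>z\<bar> + 1)\<^sup>2"] by (simp add: divide_inverse mult.commute)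
  qed
  have s0: "summable (\<lambda>n. erf_term n 0)" by (simp add: erf_term_def)
  show "summable (\<lambda>n. erf_term n z)"
    by (rule has_field_derivative_series'(1)[OF S(1) d u S(3) s0 S(2)])
  have "((\<lambda>z. \<Sum>n. erf_term n z) has_real_derivative (\<Sum>n. (- (z\<^sup>2)) ^ n / fact n)) (at z)"
    by (rule has_field_derivative_series'(2)[OF S(1) d u S(3) s0 S(2)])
  moreover have "(\<Sum>n. (- (z\<^sup>2)) ^ n / fact n) = exp (- (z\<^sup>2))"
    by (simp add: exp_def divide_inverse mult.commute)
  ultimately show "((\<lambda>z. \<Sum>n. erf_term n z) has_real_derivative exp (- (z\<^sup>2))) (at z)" by simp
qed

lemma Erf_sums: "(\<lambda>n. 2 / sqrt pi * erf_term n z) sums Erf z"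
proof -
  have "(LBINT t=0..ereal z. exp (- t\<^sup>2)) = (\<Sum>n. erf_term n z) - (\<Sum>n. erf_term n 0)"
    unfolding zero_ereal_def
  proof (rule interval_integral_FTC_finite)
    show "continuous_on {min 0 z..max 0 z} (\<lambda>t. exp (- t\<^sup>2))" by (intro continuous_intros)
    fix x assume "min 0 z \<le> x" "x \<le> max 0 z"
    show "((\<lambda>z. \<Sum>n. erf_term n z) has_vector_derivative exp (- x\<^sup>2)) (at x within {min 0 z..max 0 z})"
      using erf_series_derivative(2)[of x]
      unfolding has_real_derivative_iff_has_vector_derivative by (rule has_vector_derivative_at_within)
  qed
  moreover have "(\<Sum>n. erf_term n 0) = 0" by (simp add: erf_term_def)
  ultimately have "Erf z = 2 / sqrt pi * (\<Sum>n. erf_term n z)" by (simp add: Erf_def)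
  then show ?thesis
    using sums_mult[OF summable_sums[OF erf_series_derivative(1)[of z]], of "2 / sqrt pi"] by (simp only:)
qed

section \<open>The convolution kernel\<close>

definition kernel_coeff :: "real \<Rightarrow> real \<Rightarrow> nat \<Rightarrow> nat \<Rightarrow> real" where
  "kernel_coeff \<mu> a n k = real ((2 * n + 1) choose k) * ((- 1) ^ (n + k - 1) * \<mu> ^ (2 * n + 1)
     / (fact n * fact (k - 1) * real (2 * n + 1))) * a ^ (2 * n + 1 - k)"

definition kernel_term :: "real \<Rightarrow> real \<Rightarrow> nat \<Rightarrow> real \<Rightarrow> real" where
  "kernel_term \<mu> a n u = (\<Sum>k=1..2 * n + 1. kernel_coeff \<mu> a n k * u ^ (k - 1))"

text \<open>
Up to the factor $-1/\sqrt\pi$ the density of the absolutely continuous part of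
$\mathcal L^{-1}[\xi_\mu(\frac1x,a)]$.
\<close>

definition erf_kernel :: "real \<Rightarrow> real \<Rightarrow> real \<Rightarrow> real" where
  "erf_kernel \<mu> a u = (\<Sum>n. kernel_term \<mu> a n u)"

text \<open>
A summable sequence of constants with $|p_n(u)| \le C_n e^{qu}$ for the $n$-th kernel polynomial $p_n$.
\<close>

definition kernel_bound :: "real \<Rightarrow> real \<Rightarrow> real \<Rightarrow> nat \<Rightarrow> real" where
  "kernel_bound \<mu> a q n = q * (\<bar>\<mu>\<bar> * (\<bar>a\<bar> + 1 / q)) ^ (2 * n + 1) / fact n"

text \<open>
Up to a constant this is the exponential series at the square of \<open>\<bar>\<mu>\<bar> * (\<bar>a\<bar> + 1 / q)\<close>.
\<close>

lemma kernel_bound_summable: "summable (kernel_bound \<mu> a q)"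
proof -
  let ?y = "\<bar>\<mu>\<bar> * (\<bar>a\<bar> + 1 / q)"
  have "summable (\<lambda>n. (q * ?y) * (inverse (fact n) * (?y\<^sup>2) ^ n))"
    by (intro summable_mult summable_exp)
  moreover have "(q * ?y) * (inverse (fact n) * (?y\<^sup>2) ^ n) = kernel_bound \<mu> a q n" for n
    unfolding kernel_bound_def power_add power_mult by (simp add: divide_inverse)
  ultimately show ?thesis by (simp only:)
qed

lemma power_le_exp:
  fixes q u :: real
  assumes "0 < q" "0 \<le> u"
  shows "u ^ j / fact j \<le> (1 / q) ^ j * exp (q * u)"
proof -
  have "(q * u) ^ j / fact j \<le> exp (q * u)"
    using sum_le_suminf[OF summable_exp[of "q * u"], of "{j}"] assms
    by (simp add: exp_def divide_inverse mult.commute)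
  then show ?thesis using assms by (simp add: power_mult_distrib field_simps)
qed

text \<open>
Estimate $u^{k-1}/(k-1)! \le q \cdot q^{-k} e^{qu}$ and sum the remaining binomial coefficients to
$(|a| + 1/q)^{2n+1}$.
\<close>

lemma kernel_term_le:
  assumes q: "0 < q" and u: "0 \<le> u"
  shows "\<bar>kernel_term \<mu> a n u\<bar> \<le> kernel_bound \<mu> a q n * exp (q * u)"
proof -
  let ?m = "2 * n + 1"
  let ?c = "\<lambda>k. real (?m choose k) * (1 / q) ^ k * \<bar>a\<bar> ^ (?m - k)"
  have 1: "\<bar>kernel_coeff \<mu> a n k * u ^ (k - 1)\<bar> \<le> ?c k * (\<bar>\<mu>\<bar> ^ ?m * q / fact n * exp (q * u))"
    if k: "k \<in> {1..?m}" for k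
  proof -
    have "\<bar>kernel_coeff \<mu> a n k * u ^ (k - 1)\<bar> =
        (real (?m choose k) * \<bar>a\<bar> ^ (?m - k) * (\<bar>\<mu>\<bar> ^ ?m / fact n)) * ((u ^ (k - 1) / fact (k - 1)) / real ?m)"
      using u unfolding kernel_coeff_def abs_mult abs_divide power_abs by (simp add: ac_simps)
    also have "\<dots> \<le> (real (?m choose k) * \<bar>a\<bar> ^ (?m - k) * (\<bar>\<mu>\<bar> ^ ?m / fact n)) * ((1 / q) ^ (k - 1) * exp (q * u) / 1)"
      using u q by (intro mult_left_mono frac_le power_le_exp[OF q u]) (auto intro!: mult_nonneg_nonneg)
    also have "(1 / q) ^ (k - 1) = (1 / q) ^ k * q"
      using k q by (cases k) auto
    finally show ?thesis by (simp add: ac_simps)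
  qed
  have "\<bar>kernel_term \<mu> a n u\<bar> \<le> (\<Sum>k=1..?m. ?c k * (\<bar>\<mu>\<bar> ^ ?m * q / fact n * exp (q * u)))"
    unfolding kernel_term_def by (rule order_trans[OF sum_abs sum_mono[OF 1]])
  also have "\<dots> = (\<Sum>k=1..?m. ?c k) * (\<bar>\<mu>\<bar> ^ ?m * q / fact n * exp (q * u))"
    by (rule sum_distrib_right[symmetric])
  also have "\<dots> \<le> (1 / q + \<bar>a\<bar>) ^ ?m * (\<bar>\<mu>\<bar> ^ ?m * q / fact n * exp (q * u))"
  proof (rule mult_right_mono)
    have "(\<Sum>k=1..?m. ?c k) \<le> (\<Sum>k\<le>?m. ?c k)"
      using q by (intro sum_mono2) auto
    then show "(\<Sum>k=1..?m. ?c k) \<le> (1 / q + \<bar>a\<bar>) ^ ?m"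
      unfolding binomial_ring[of "1 / q" "\<bar>a\<bar>"] .
  qed (use q in auto)
  also have "\<dots> = kernel_bound \<mu> a q n * exp (q * u)"
    unfolding kernel_bound_def power_mult_distrib by (simp add: ac_simps)
  finally show ?thesis .
qed

lemma kernel_term_summable:
  assumes u: "0 \<le> u"
  shows "summable (\<lambda>n. \<bar>kernel_term \<mu> a n u\<bar>)"
proof (rule summable_comparison_test'[where N = 0])
  show "summable (\<lambda>n. kernel_bound \<mu> a 1 n * exp (1 * u))"
    by (intro summable_mult2 kernel_bound_summable)
qed (use kernel_term_le[of 1 u] u in auto)

lemma kernel_partial_sum_le:
  assumes q: "0 < q" and u: "0 \<le> u"
  shows "\<bar>(\<Sum>n<N. kernel_term \<mu> a n u) - erf_kernel \<mu> a u\<bar> \<le> (\<Sum>n. kernel_bound \<mu> a q (n + N)) * exp (q * u)"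
proof -
  have s: "summable (\<lambda>n. kernel_term \<mu> a n u)"
    using kernel_term_summable[OF u] by (rule summable_rabs_cancel)
  have sN: "summable (\<lambda>n. kernel_bound \<mu> a q (n + N))"
    using kernel_bound_summable by (subst summable_iff_shift)
  have "erf_kernel \<mu> a u - (\<Sum>n<N. kernel_term \<mu> a n u) = (\<Sum>n. kernel_term \<mu> a (n + N) u)"
    unfolding erf_kernel_def using suminf_minus_initial_segment[OF s, of N] by simp
  also have "\<bar>\<dots>\<bar> \<le> (\<Sum>n. kernel_bound \<mu> a q (n + N) * exp (q * u))"
    using norm_suminf_le[of "\<lambda>n. kernel_term \<mu> a (n + N) u" "\<lambda>n. kernel_bound \<mu> a q (n + N) * exp (q * u)"]
      kernel_term_le[OF q u] summable_mult2[OF sN] by simp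
  also have "\<dots> = (\<Sum>n. kernel_bound \<mu> a q (n + N)) * exp (q * u)"
    by (rule suminf_mult2[OF sN, symmetric])
  finally show ?thesis by (simp add: abs_minus_commute)
qed

lemma kernel_le:
  assumes "0 < q" "0 \<le> u"
  shows "\<bar>erf_kernel \<mu> a u\<bar> \<le> (\<Sum>n. kernel_bound \<mu> a q n) * exp (q * u)"
  using kernel_partial_sum_le[OF assms, where N = 0] by simp

lemma kernel_term_measurable[measurable]: "kernel_term \<mu> a n \<in> borel_measurable borel"
  unfolding kernel_term_def[abs_def] by measurable

lemma kernel_measurable[measurable]: "erf_kernel \<mu> a \<in> borel_measurable borel"
  unfolding erf_kernel_def[abs_def] by measurable

text \<open>
The total mass of the Erlang distribution.
\<close>

lemma has_bochner_integral_power_exp: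
  fixes x :: real
  assumes x: "0 < x"
  shows "has_bochner_integral lborel (\<lambda>u. indicator {0<..} u *\<^sub>R (exp (- (x * u)) * u ^ j)) (fact j / x ^ Suc j)"
proof -
  have "has_bochner_integral lborel (erlang_density j x) 1"
  proof (rule has_bochner_integral_nn_integral)
    show "(\<integral>\<^sup>+ u. ennreal (erlang_density j x u) \<partial>lborel) = ennreal 1"
      using prob_space.emeasure_space_1[OF prob_space_erlang_density[OF x, of j]]
      by (simp add: emeasure_density)
  qed (use x in auto)
  from has_bochner_integral_mult_right[OF this, of "fact j / x ^ Suc j"]
  have "has_bochner_integral lborel (\<lambda>u. fact j / x ^ Suc j * erlang_density j x u) (fact j / x ^ Suc j)" by simp
  then show ?thesis
  proof (rule has_bochner_integral_cong_AE[THEN iffD1, rotated -1])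
    show "AE u in lborel. fact j / x ^ Suc j * erlang_density j x u = indicator {0<..} u *\<^sub>R (exp (- (x * u)) * u ^ j)"
      using AE_lborel_singleton[of "0::real"]
      by eventually_elim (use x in \<open>auto simp: erlang_density_def split: split_indicator\<close>)
  qed auto
qed

text \<open>
The powers $x^{-k}$ arising from the monomials recombine by the binomial theorem, except that the summand $k = 0$ is
missing. It is the term of the error function series at $-\mu a$, and as that series is odd its subtraction appears
as an addition.
\<close>

lemma kernel_term_laplace:
  assumes x: "0 < x"
  shows "set_integrable lborel {0<..} (\<lambda>u. exp (- (x * u)) * kernel_term \<mu> a n u)"
    and "(LINT u:{0<..}|lborel. exp (- (x * u)) * kernel_term \<mu> a n u) =
      erf_term n (\<mu> * (1 / x - a)) + erf_term n (\<mu> * a)"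
proof -
  let ?m = "2 * n + 1"
  have e: "indicator {0<..} u *\<^sub>R (exp (- (x * u)) * kernel_term \<mu> a n u) =
      (\<Sum>k=1..?m. kernel_coeff \<mu> a n k * (indicator {0<..} u *\<^sub>R (exp (- (x * u)) * u ^ (k - 1))))" for u :: real
    unfolding kernel_term_def sum_distrib_left real_scaleR_def by (intro sum.cong refl) (simp only: ac_simps)
  have h: "has_bochner_integral lborel (\<lambda>u. indicator {0<..} u *\<^sub>R (exp (- (x * u)) * kernel_term \<mu> a n u))
      (\<Sum>k=1..?m. kernel_coeff \<mu> a n k * (fact (k - 1) / x ^ Suc (k - 1)))"
    unfolding e by (intro has_bochner_integral_sum has_bochner_integral_mult_right has_bochner_integral_power_exp[OF x])
  have "(\<Sum>k=1..?m. kernel_coeff \<mu> a n k * (fact (k - 1) / x ^ Suc (k - 1))) =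
      (\<Sum>k=1..?m. (-1) ^ n * \<mu> ^ ?m / (fact n * real ?m) * (real (?m choose k) * (1 / x) ^ k * (- a) ^ (?m - k)))"
  proof (rule sum.cong[OF refl])
    fix k assume k: "k \<in> {1..?m}"
    then have "even (k - 1) \<longleftrightarrow> even (?m - k)" by auto
    then have s: "(- a) ^ (?m - k) = (-1) ^ (k - 1) * a ^ (?m - k)"
      unfolding power_minus[of a] by (simp add: minus_one_power_iff)
    obtain j where "k = Suc j" using k by (cases k) auto
    then show "kernel_coeff \<mu> a n k * (fact (k - 1) / x ^ Suc (k - 1)) =
        (-1) ^ n * \<mu> ^ ?m / (fact n * real ?m) * (real (?m choose k) * (1 / x) ^ k * (- a) ^ (?m - k))"
      unfolding s kernel_coeff_def by (simp add: power_add power_one_over)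
  qed
  also have "\<dots> = (-1) ^ n * \<mu> ^ ?m / (fact n * real ?m) * ((\<Sum>k\<le>?m. real (?m choose k) * (1 / x) ^ k * (- a) ^ (?m - k)) - (- a) ^ ?m)"
  proof -
    have "{..?m} = insert 0 {1..?m}" by auto
    then have "(\<Sum>k\<le>?m. real (?m choose k) * (1 / x) ^ k * (- a) ^ (?m - k)) =
        (- a) ^ ?m + (\<Sum>k=1..?m. real (?m choose k) * (1 / x) ^ k * (- a) ^ (?m - k))"
      by (simp only: sum.insert finite_atLeastAtMost) simp
    then show ?thesis unfolding sum_distrib_left[symmetric] by (simp only: add_diff_cancel_left')
  qed
  also have "\<dots> = (-1) ^ n * \<mu> ^ ?m / (fact n * real ?m) * ((1 / x - a) ^ ?m - (- a) ^ ?m)"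
    unfolding binomial_ring[of "1 / x" "- a", symmetric] by simp
  also have "\<dots> = erf_term n (\<mu> * (1 / x - a)) + erf_term n (\<mu> * a)"
  proof -
    have odd: "(- a) ^ ?m = - (a ^ ?m)" by simp
    have "P * Q / D * (Y - - Z) = P * (Q * Y) / D + P * (Q * Z) / D" for P Q D Y Z :: real
      by (simp add: algebra_simps add_divide_distrib)
    then show ?thesis unfolding erf_term_def power_mult_distrib odd .
  qed
  finally show "set_integrable lborel {0<..} (\<lambda>u. exp (- (x * u)) * kernel_term \<mu> a n u)"
    "(LINT u:{0<..}|lborel. exp (- (x * u)) * kernel_term \<mu> a n u) =
      erf_term n (\<mu> * (1 / x - a)) + erf_term n (\<mu> * a)"
    using h by (auto simp: set_integrable_def set_lebesgue_integral_def has_bochner_integral_iff)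
qed

text \<open>
The bound on the terms with rate $x/2$ leaves the integrable majorant $e^{-xu/2}$, which justifies the termwise
integration.
\<close>

lemma kernel_laplace:
  assumes x: "0 < x"
  shows "set_integrable lborel {0<..} (\<lambda>u. exp (- (x * u)) * erf_kernel \<mu> a u)"
    and "(LINT u:{0<..}|lborel. exp (- (x * u)) * erf_kernel \<mu> a u) =
      sqrt pi / 2 * (Erf (\<mu> * (1 / x - a)) + Erf (\<mu> * a))"
proof -
  let ?q = "x / 2"
  let ?f = "\<lambda>n u. indicator {0<..} u *\<^sub>R (exp (- (x * u)) * kernel_term \<mu> a n u)"
  have f: "integrable lborel (?f n)" for n
    using kernel_term_laplace(1)[OF x] by (simp add: set_integrable_def)
  have half: "has_bochner_integral lborel (\<lambda>u. indicator {0<..} u *\<^sub>R exp (- (?q * u))) (1 / ?q)"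
    using has_bochner_integral_power_exp[of ?q 0] x by simp
  have le: "norm (?f n u) \<le> kernel_bound \<mu> a ?q n * (indicator {0<..} u *\<^sub>R exp (- (?q * u)))" for n u
  proof (cases "0 < u")
    case True
    have "exp (- (x * u)) * \<bar>kernel_term \<mu> a n u\<bar> \<le> exp (- (x * u)) * (kernel_bound \<mu> a ?q n * exp (?q * u))"
      using x True by (intro mult_left_mono kernel_term_le) auto
    also have "\<dots> = kernel_bound \<mu> a ?q n * (exp (- (x * u)) * exp (?q * u))" by simp
    also have "exp (- (x * u)) * exp (?q * u) = exp (- (?q * u))" by (simp add: exp_add[symmetric])
    finally show ?thesis using True by (simp add: abs_mult)
  qed simp
  have pw: "summable (\<lambda>n. norm (?f n u))" for u
  proof (rule summable_comparison_test'[where N = 0])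
    show "summable (\<lambda>n. kernel_bound \<mu> a ?q n * (indicator {0<..} u *\<^sub>R exp (- (?q * u))))"
      by (intro summable_mult2 kernel_bound_summable)
  qed (use le in simp)
  have int: "summable (\<lambda>n. LINT u|lborel. norm (?f n u))"
  proof (rule summable_comparison_test'[where N = 0])
    show "summable (\<lambda>n. kernel_bound \<mu> a ?q n * (1 / ?q))"
      by (intro summable_mult2 kernel_bound_summable)
    fix n
    have "(LINT u|lborel. norm (?f n u)) \<le> (LINT u|lborel. kernel_bound \<mu> a ?q n * (indicator {0<..} u *\<^sub>R exp (- (?q * u))))"
      using half by (intro integral_mono integrable_norm f integrable_mult_right le) (simp add: has_bochner_integral_iff)
    also have "\<dots> = kernel_bound \<mu> a ?q n * (1 / ?q)"
      using half by (simp add: has_bochner_integral_iff)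
    finally show "norm (LINT u|lborel. norm (?f n u)) \<le> kernel_bound \<mu> a ?q n * (1 / ?q)"
      by (simp add: integral_nonneg_AE)
  qed
  have lim: "(\<Sum>n. ?f n u) = indicator {0<..} u *\<^sub>R (exp (- (x * u)) * erf_kernel \<mu> a u)" for u
  proof (cases "0 < u")
    case True
    have s: "summable (\<lambda>n. kernel_term \<mu> a n u)"
      using kernel_term_summable[of u] True by (intro summable_rabs_cancel[OF kernel_term_summable]) simp
    show ?thesis using True suminf_mult[OF s, of "exp (- (x * u))"] by (simp add: erf_kernel_def)
  qed simp
  show "set_integrable lborel {0<..} (\<lambda>u. exp (- (x * u)) * erf_kernel \<mu> a u)"
    using integrable_suminf[OF f AE_I2[OF pw] int] unfolding lim by (simp add: set_integrable_def)
  have 1: "(\<lambda>n. LINT u|lborel. ?f n u) sums (LINT u:{0<..}|lborel. exp (- (x * u)) * erf_kernel \<mu> a u)"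
    using sums_integral[OF f AE_I2[OF pw] int] unfolding lim set_lebesgue_integral_def .
  have 2: "(LINT u|lborel. ?f n u) = sqrt pi / 2 * (2 / sqrt pi * erf_term n (\<mu> * (1 / x - a)) + 2 / sqrt pi * erf_term n (\<mu> * a))" for n
    using kernel_term_laplace(2)[OF x, of \<mu> a n] by (simp add: set_lebesgue_integral_def distrib_left)
  have 3: "(\<lambda>n. sqrt pi / 2 * (2 / sqrt pi * erf_term n (\<mu> * (1 / x - a)) + 2 / sqrt pi * erf_term n (\<mu> * a))) sums
      (sqrt pi / 2 * (Erf (\<mu> * (1 / x - a)) + Erf (\<mu> * a)))"
    by (intro sums_mult sums_add Erf_sums)
  show "(LINT u:{0<..}|lborel. exp (- (x * u)) * erf_kernel \<mu> a u) =
      sqrt pi / 2 * (Erf (\<mu> * (1 / x - a)) + Erf (\<mu> * a))"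
    by (rule sums_unique2[OF 1[unfolded 2] 3])
qed

section \<open>The space $L^2(m)$\<close>

lemma m_measure_space: "space m_measure = {0<..}"
  by (simp add: m_measure_def space_restrict_space)

lemma measurable_m_measure: "measurable m_measure M = measurable (restrict_space borel {0<..}) M"
  by (intro measurable_cong_sets) (simp_all add: m_measure_def sets_restrict_space)

lemma m_measure_measurableI:
  "f \<in> borel_measurable borel \<Longrightarrow> f \<in> borel_measurable m_measure"
  unfolding measurable_m_measure by (rule measurable_restrict_space1)

lemma m_measure_extend:
  fixes f :: "real \<Rightarrow> complex"
  assumes "f \<in> borel_measurable m_measure"
  shows "(\<lambda>s. indicator {0<..} s *\<^sub>R f s) \<in> borel_measurable borel"
  using assms unfolding measurable_m_measure by (subst (asm) borel_measurable_restrict_space_iff) auto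

lemma nn_integral_m_measure:
  assumes [measurable]: "g \<in> borel_measurable borel"
  shows "(\<integral>\<^sup>+ t. g t \<partial>m_measure) = (\<integral>\<^sup>+ t. ennreal (indicator {0<..} t * (t * exp (- t))) * g t \<partial>lborel)"
proof -
  have [measurable]: "g \<in> borel_measurable (restrict_space lborel {0<..})"
    by (intro measurable_restrict_space1) measurable
  have [measurable]: "(\<lambda>t. ennreal (t * exp (- t))) \<in> borel_measurable (restrict_space lborel {0<..})"
    by (intro measurable_restrict_space1) measurable
  have "(\<integral>\<^sup>+ t. g t \<partial>m_measure) = (\<integral>\<^sup>+ t. ennreal (t * exp (- t)) * g t \<partial>restrict_space lborel {0<..})"
    unfolding m_measure_def by (rule nn_integral_density) measurable
  also have "\<dots> = (\<integral>\<^sup>+ t. ennreal (t * exp (- t)) * g t * indicator {0<..} t \<partial>lborel)"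
    by (rule nn_integral_restrict_space) simp
  also have "\<dots> = (\<integral>\<^sup>+ t. ennreal (indicator {0<..} t * (t * exp (- t))) * g t \<partial>lborel)"
    by (intro nn_integral_cong) (auto split: split_indicator)
  finally show ?thesis .
qed

lemma AE_m_measure_iff:
  "(AE t in m_measure. P t) \<longleftrightarrow> (AE t in lborel. 0 < t \<longrightarrow> P t)"
proof -
  have [measurable]: "(\<lambda>t. ennreal (t * exp (- t))) \<in> borel_measurable (restrict_space lborel {0<..})"
    by (intro measurable_restrict_space1) measurable
  have "(AE t in m_measure. P t) \<longleftrightarrow> (AE t in restrict_space lborel {0<..}. 0 < ennreal (t * exp (- t)) \<longrightarrow> P t)"
    unfolding m_measure_def by (subst AE_density) auto
  also have "\<dots> \<longleftrightarrow> (AE t in lborel. t \<in> {0<..} \<longrightarrow> 0 < ennreal (t * exp (- t)) \<longrightarrow> P t)"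
    by (subst AE_restrict_space_iff) auto
  also have "\<dots> \<longleftrightarrow> (AE t in lborel. 0 < t \<longrightarrow> P t)"
    by (intro AE_cong) auto
  finally show ?thesis .
qed

lemma L2_measurable: "f \<in> L2 M \<Longrightarrow> f \<in> borel_measurable M"
  by (simp add: L2_def)

lemma L2_square_integrable: "f \<in> L2 M \<Longrightarrow> integrable M (\<lambda>t. (norm (f t))\<^sup>2)"
  by (simp add: L2_def)

lemma L2_norm_nonneg: "0 \<le> L2_norm M f"
  by (simp add: L2_norm_def integral_nonneg_AE)

lemma L2_norm_square: "(L2_norm M f)\<^sup>2 = (LINT t|M. (norm (f t))\<^sup>2)"
  by (simp add: L2_norm_def integral_nonneg_AE)

lemma L2_of_square_bound:
  assumes f: "f \<in> borel_measurable M" and g: "integrable M g"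
    and le: "\<And>t. t \<in> space M \<Longrightarrow> (norm (f t))\<^sup>2 \<le> g t"
  shows "f \<in> L2 M" "(L2_norm M f)\<^sup>2 \<le> (LINT t|M. g t)"
proof -
  have i: "integrable M (\<lambda>t. (norm (f t))\<^sup>2)"
  proof (rule Bochner_Integration.integrable_bound[OF g])
    show "(\<lambda>t. (norm (f t))\<^sup>2) \<in> borel_measurable M" using f by measurable
    show "AE t in M. norm ((norm (f t))\<^sup>2) \<le> norm (g t)"
      using le by (intro AE_I2) (simp add: order_trans[OF _ abs_ge_self])
  qed
  then show "f \<in> L2 M" using f by (simp add: L2_def)
  show "(L2_norm M f)\<^sup>2 \<le> (LINT t|M. g t)"
    unfolding L2_norm_square by (rule integral_mono[OF i g le])
qed

text \<open>
The inequality $|z + w|^2 \le 2|z|^2 + 2|w|^2$ stands in for Minkowski's inequality.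
\<close>

lemma L2_add:
  assumes f: "f \<in> L2 M" and g: "g \<in> L2 M"
  shows "(\<lambda>t. f t + g t) \<in> L2 M"
    and "(L2_norm M (\<lambda>t. f t + g t))\<^sup>2 \<le> 2 * (L2_norm M f)\<^sup>2 + 2 * (L2_norm M g)\<^sup>2"
proof -
  note [measurable] = L2_measurable[OF f] L2_measurable[OF g]
  note i = L2_square_integrable[OF f] L2_square_integrable[OF g]
  have le: "(norm (f t + g t))\<^sup>2 \<le> 2 * (norm (f t))\<^sup>2 + 2 * (norm (g t))\<^sup>2" for t
  proof -
    have "(norm (f t + g t))\<^sup>2 \<le> (norm (f t) + norm (g t))\<^sup>2"
      by (intro power_mono norm_triangle_ineq) auto
    also have "\<dots> \<le> 2 * (norm (f t))\<^sup>2 + 2 * (norm (g t))\<^sup>2"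
      using sum_squares_bound[of "norm (f t)" "norm (g t)"] by (simp add: power2_sum)
    finally show ?thesis .
  qed
  have m: "(\<lambda>t. f t + g t) \<in> borel_measurable M" by measurable
  have b: "integrable M (\<lambda>t. 2 * (norm (f t))\<^sup>2 + 2 * (norm (g t))\<^sup>2)" using i by simp
  show "(\<lambda>t. f t + g t) \<in> L2 M" by (rule L2_of_square_bound(1)[OF m b le])
  have "(L2_norm M (\<lambda>t. f t + g t))\<^sup>2 \<le> (LINT t|M. 2 * (norm (f t))\<^sup>2 + 2 * (norm (g t))\<^sup>2)"
    by (rule L2_of_square_bound(2)[OF m b le])
  also have "\<dots> = 2 * (L2_norm M f)\<^sup>2 + 2 * (L2_norm M g)\<^sup>2"
    using i by (simp add: L2_norm_square)
  finally show "(L2_norm M (\<lambda>t. f t + g t))\<^sup>2 \<le> 2 * (L2_norm M f)\<^sup>2 + 2 * (L2_norm M g)\<^sup>2" .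
qed

lemma L2_scale:
  assumes f: "f \<in> L2 M"
  shows "(\<lambda>t. c * f t) \<in> L2 M"
  using L2_of_square_bound(1)[of "\<lambda>t. c * f t" M "\<lambda>t. (norm c)\<^sup>2 * (norm (f t))\<^sup>2"]
    L2_square_integrable[OF f] L2_measurable[OF f] by (simp add: norm_mult power_mult_distrib)

lemma L2_norm_cong:
  assumes "\<And>t. t \<in> space M \<Longrightarrow> f t = g t"
  shows "L2_norm M f = L2_norm M g"
  unfolding L2_norm_def by (auto intro!: arg_cong[where f = sqrt] Bochner_Integration.integral_cong simp: assms)

lemma L2_cong:
  assumes "\<And>t. t \<in> space M \<Longrightarrow> f t = g t" "f \<in> L2 M"
  shows "g \<in> L2 M"
proof -
  have "g \<in> borel_measurable M"
    using L2_measurable[OF assms(2)] measurable_cong[of M f g borel] assms(1) by simp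
  then show ?thesis
    by (rule L2_of_square_bound(1)[OF _ L2_square_integrable[OF assms(2)]]) (simp add: assms(1))
qed

text \<open>
This is $\int_0^\infty t\,e^{-t/2}\,dt = 4$, the square of the $L^2(m)$-norm of $e^{t/4}$.
\<close>

lemma exp_half_m_measure:
  "has_bochner_integral m_measure (\<lambda>t. exp (t / 2)) 4"
proof (rule has_bochner_integral_nn_integral)
  have "(\<integral>\<^sup>+ t. ennreal (exp (t / 2)) \<partial>m_measure) =
      (\<integral>\<^sup>+ t. ennreal (indicator {0<..} t *\<^sub>R (exp (- (1 / 2 * t)) * t ^ 1)) \<partial>lborel)"
    by (subst nn_integral_m_measure)
       (auto intro!: nn_integral_cong simp: ennreal_mult[symmetric] exp_add[symmetric] mult.assoc split: split_indicator)
  also have "\<dots> = ennreal 4"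
    using has_bochner_integral_power_exp[of "1 / 2" 1]
    by (subst nn_integral_eq_integral) (auto simp: has_bochner_integral_iff power2_eq_square split: split_indicator)
  finally show "(\<integral>\<^sup>+ t. ennreal (exp (t / 2)) \<partial>m_measure) = ennreal 4" .
qed (auto intro: m_measure_measurableI)

lemma L2_of_exp_bound:
  assumes f: "f \<in> borel_measurable m_measure" and B: "0 \<le> B"
    and le: "\<And>t. 0 < t \<Longrightarrow> norm (f t) \<le> B * exp (t / 4)"
  shows "f \<in> L2 m_measure" "L2_norm m_measure f \<le> 2 * B"
proof -
  have i: "integrable m_measure (\<lambda>t. B\<^sup>2 * exp (t / 2))"
    and v: "(LINT t|m_measure. B\<^sup>2 * exp (t / 2)) = B\<^sup>2 * 4"
    using has_bochner_integral_mult_right[OF exp_half_m_measure, of "B\<^sup>2"]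
    unfolding has_bochner_integral_iff by auto
  have sq: "(norm (f t))\<^sup>2 \<le> B\<^sup>2 * exp (t / 2)" if "t \<in> space m_measure" for t
  proof -
    have "(norm (f t))\<^sup>2 \<le> (B * exp (t / 4))\<^sup>2"
      using le that by (intro power_mono) (auto simp: m_measure_space)
    also have "\<dots> = B\<^sup>2 * exp (t / 2)"
      by (simp add: power_mult_distrib power2_eq_square exp_add[symmetric])
    finally show ?thesis .
  qed
  show "f \<in> L2 m_measure" by (rule L2_of_square_bound(1)[OF f i sq])
  have "(L2_norm m_measure f)\<^sup>2 \<le> (2 * B)\<^sup>2"
    using L2_of_square_bound(2)[OF f i sq] unfolding v by (simp add: power_mult_distrib)
  then show "L2_norm m_measure f \<le> 2 * B" by (rule power2_le_imp_le) (use B in simp)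
qed

section \<open>Volterra operators on $L^2(m)$\<close>

definition weighted_M :: "(real \<Rightarrow> complex) \<Rightarrow> real \<Rightarrow> complex" where
  "weighted_M \<phi> s = of_real s * M_op \<phi> s"

text \<open>
The integral operators $\frac1t\int_0^t s\,(M\varphi)(s)\,K(t-s)\,ds$ of which the theorem is made, with an
arbitrary kernel \<open>K\<close>.
\<close>

definition volterra :: "(real \<Rightarrow> real) \<Rightarrow> (real \<Rightarrow> complex) \<Rightarrow> real \<Rightarrow> complex" where
  "volterra K \<phi> t = 1 / of_real t * (LINT s:{0<..<t}|lborel. weighted_M \<phi> s * of_real (K (t - s)))"

lemma weighted_M_measurable:
  assumes "\<phi> \<in> borel_measurable m_measure"
  shows "(\<lambda>s. indicator {0<..} s *\<^sub>R weighted_M \<phi> s) \<in> borel_measurable borel"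
proof -
  note [measurable] = m_measure_extend[OF assms]
  have "(\<lambda>s. indicator {0<..} s *\<^sub>R weighted_M \<phi> s) =
      (\<lambda>s. of_real (s * exp (- s)) * (indicator {0<..} s *\<^sub>R \<phi> s))"
    by (auto simp: weighted_M_def M_op_def fun_eq_iff split: split_indicator)
  then show ?thesis by (simp only:) measurable
qed

text \<open>
The factor $s\,e^{-s}$ in $s\,(M\varphi)(s)$ is exactly the density of $m$, so this is an integral of
$|\varphi|$ with respect to $m$. Cauchy-Schwarz on $(0,t)$, with $m(0,t) \le \int_0^t s\,ds \le t^2$, gives the factor $t$.
\<close>

lemma weighted_M_L1:
  assumes \<phi>: "\<phi> \<in> L2 m_measure" and t: "0 < t"
  shows "integrable lborel (\<lambda>s. indicator {0<..<t} s *\<^sub>R weighted_M \<phi> s)"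
    and "(LINT s|lborel. norm (indicator {0<..<t} s *\<^sub>R weighted_M \<phi> s)) \<le> t * L2_norm m_measure \<phi>"
proof -
  let ?N = "L2_norm m_measure \<phi>"
  define \<Phi> where "\<Phi> s = indicator {0<..} s *\<^sub>R \<phi> s" for s
  have [measurable]: "\<Phi> \<in> borel_measurable borel"
    unfolding \<Phi>_def by (rule m_measure_extend[OF L2_measurable[OF \<phi>]])
  have e: "indicator {0<..<t} s *\<^sub>R weighted_M \<phi> s = indicator {0<..<t} s *\<^sub>R (of_real (s * exp (- s)) * \<Phi> s)" for s
    by (auto simp: weighted_M_def M_op_def \<Phi>_def split: split_indicator)
  let ?I = "\<integral>\<^sup>+ s. ennreal (norm (indicator {0<..<t} s *\<^sub>R weighted_M \<phi> s)) \<partial>lborel"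
  have "?I = (\<integral>\<^sup>+ s. ennreal (indicator {0<..<t} s) * ennreal (norm (\<Phi> s)) \<partial>m_measure)"
    unfolding e
    by (subst nn_integral_m_measure)
       (auto intro!: nn_integral_cong simp: norm_mult ennreal_mult[symmetric] split: split_indicator)
  also have "\<dots>\<^sup>2 \<le> (\<integral>\<^sup>+ s. (ennreal (indicator {0<..<t} s))\<^sup>2 \<partial>m_measure) * (\<integral>\<^sup>+ s. (ennreal (norm (\<Phi> s)))\<^sup>2 \<partial>m_measure)"
    by (intro Cauchy_Schwarz_nn_integral m_measure_measurableI) measurable
  also have "(\<integral>\<^sup>+ s. (ennreal (norm (\<Phi> s)))\<^sup>2 \<partial>m_measure) = ennreal (?N\<^sup>2)"
  proof -
    have "(\<integral>\<^sup>+ s. (ennreal (norm (\<Phi> s)))\<^sup>2 \<partial>m_measure) = (\<integral>\<^sup>+ s. ennreal ((norm (\<phi> s))\<^sup>2) \<partial>m_measure)"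
      by (intro nn_integral_cong) (simp add: \<Phi>_def m_measure_space ennreal_power)
    also have "\<dots> = ennreal (?N\<^sup>2)"
      unfolding L2_norm_square using L2_square_integrable[OF \<phi>] by (intro nn_integral_eq_integral) auto
    finally show ?thesis .
  qed
  also have "(\<integral>\<^sup>+ s. (ennreal (indicator {0<..<t} s))\<^sup>2 \<partial>m_measure) \<le> ennreal (t\<^sup>2)"
  proof -
    have "(\<integral>\<^sup>+ s. (ennreal (indicator {0<..<t} s))\<^sup>2 \<partial>m_measure) =
        (\<integral>\<^sup>+ s. ennreal (indicator {0<..} s * (s * exp (- s))) * (ennreal (indicator {0<..<t} s))\<^sup>2 \<partial>lborel)"
      by (rule nn_integral_m_measure) measurable
    also have "\<dots> \<le> (\<integral>\<^sup>+ s. ennreal t * indicator {0<..<t} s \<partial>lborel)"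
    proof (rule nn_integral_mono)
      fix s :: real
      show "ennreal (indicator {0<..} s * (s * exp (- s))) * (ennreal (indicator {0<..<t} s))\<^sup>2 \<le> ennreal t * indicator {0<..<t} s"
      proof (cases "s \<in> {0<..<t}")
        case True
        then have "s * exp (- s) \<le> s * 1" by (intro mult_left_mono) auto
        then have "s * exp (- s) \<le> t" using True unfolding greaterThanLessThan_iff by linarith
        then show ?thesis using True by (simp add: ennreal_leI)
      qed simp
    qed
    also have "\<dots> = ennreal (t\<^sup>2)"
      using t by (simp add: nn_integral_cmult_indicator ennreal_mult[symmetric] power2_eq_square)
    finally show ?thesis .
  qed
  finally have "?I\<^sup>2 \<le> ennreal (t\<^sup>2) * ennreal (?N\<^sup>2)"
    by (simp add: mult_right_mono)
  also have "\<dots> = (ennreal (t * ?N))\<^sup>2"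
    using t L2_norm_nonneg[of m_measure \<phi>] by (simp add: ennreal_power ennreal_mult[symmetric] power_mult_distrib)
  finally have sq: "?I\<^sup>2 \<le> (ennreal (t * ?N))\<^sup>2" .
  have I: "?I \<le> ennreal (t * ?N)"
  proof (cases ?I)
    case (real i)
    have "0 \<le> t * ?N" using t L2_norm_nonneg[of m_measure \<phi>] by simp
    moreover from this have "i\<^sup>2 \<le> (t * ?N)\<^sup>2"
      using sq real by (simp add: ennreal_power)
    ultimately have "i \<le> t * ?N" by (rule power2_le_imp_le[rotated])
    then show ?thesis unfolding real(2) by (rule ennreal_leI)
  next
    case top
    have "(ennreal (t * ?N))\<^sup>2 = ennreal ((t * ?N)\<^sup>2)"
      using t L2_norm_nonneg[of m_measure \<phi>] by (simp add: ennreal_power)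
    then show ?thesis using sq unfolding top by (simp add: top_unique)
  qed
  show int: "integrable lborel (\<lambda>s. indicator {0<..<t} s *\<^sub>R weighted_M \<phi> s)"
  proof (rule integrableI_bounded)
    show "(\<lambda>s. indicator {0<..<t} s *\<^sub>R weighted_M \<phi> s) \<in> borel_measurable lborel"
      unfolding e by measurable
    show "?I < \<infinity>" using I by (rule le_less_trans) simp
  qed
  have "ennreal (LINT s|lborel. norm (indicator {0<..<t} s *\<^sub>R weighted_M \<phi> s)) = ?I"
    using int by (intro nn_integral_eq_integral[symmetric] integrable_norm) auto
  with I have "ennreal (LINT s|lborel. norm (indicator {0<..<t} s *\<^sub>R weighted_M \<phi> s)) \<le> ennreal (t * ?N)"
    by (simp only:)
  then show "(LINT s|lborel. norm (indicator {0<..<t} s *\<^sub>R weighted_M \<phi> s)) \<le> t * ?N"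
    using t L2_norm_nonneg[of m_measure \<phi>] by (subst (asm) ennreal_le_iff) auto
qed

context
  fixes K :: "real \<Rightarrow> real" and C :: real
  assumes K[measurable]: "K \<in> borel_measurable borel"
    and K_le: "\<And>u. 0 \<le> u \<Longrightarrow> \<bar>K u\<bar> \<le> C * exp (1 / 4 * u)"
begin

lemma K_const_nonneg: "0 \<le> C"
  using K_le[of 0] by simp

text \<open>
For $0 < s < t$ the kernel is bounded independently of $s$ by $C e^{(t-s)/4} \le C e^{t/4}$.
\<close>

lemma volterra_integrand:
  assumes \<phi>: "\<phi> \<in> L2 m_measure" and t: "0 < t"
  shows "set_integrable lborel {0<..<t} (\<lambda>s. weighted_M \<phi> s * of_real (K (t - s)))"
    and "norm (LINT s:{0<..<t}|lborel. weighted_M \<phi> s * of_real (K (t - s))) \<le>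
      C * exp (t / 4) * (t * L2_norm m_measure \<phi>)"
proof -
  let ?f = "\<lambda>s. indicator {0<..<t} s *\<^sub>R (weighted_M \<phi> s * of_real (K (t - s)))"
  let ?g = "\<lambda>s. indicator {0<..<t} s *\<^sub>R weighted_M \<phi> s"
  have g: "integrable lborel ?g" by (rule weighted_M_L1(1)[OF \<phi> t])
  have gn: "integrable lborel (\<lambda>s. C * exp (t / 4) * norm (?g s))"
    using integrable_norm[OF g] by (rule integrable_mult_right)
  have le: "norm (?f s) \<le> C * exp (t / 4) * norm (?g s)" for s
  proof (cases "s \<in> {0<..<t}")
    case True
    have "\<bar>K (t - s)\<bar> \<le> C * exp (1 / 4 * (t - s))" using True by (intro K_le) auto
    also have "\<dots> \<le> C * exp (t / 4)" using True K_const_nonneg by (intro mult_left_mono) auto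
    finally have "norm (weighted_M \<phi> s) * \<bar>K (t - s)\<bar> \<le> norm (weighted_M \<phi> s) * (C * exp (t / 4))"
      by (intro mult_left_mono) auto
    then show ?thesis using True by (simp add: norm_mult mult.commute)
  qed simp
  have meas: "?f \<in> borel_measurable lborel"
  proof -
    have "?f s = ?g s * of_real (K (t - s))" for s by simp
    moreover have "(\<lambda>s. ?g s * of_real (K (t - s))) \<in> borel_measurable lborel"
      using borel_measurable_integrable[OF g] by measurable
    ultimately show ?thesis by (simp only:)
  qed
  have f: "integrable lborel ?f"
    by (rule Bochner_Integration.integrable_bound[OF gn meas]) (use le abs_ge_self order_trans in \<open>fastforce intro: AE_I2\<close>)
  then show "set_integrable lborel {0<..<t} (\<lambda>s. weighted_M \<phi> s * of_real (K (t - s)))"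
    by (simp add: set_integrable_def)
  have "norm (LINT s|lborel. ?f s) \<le> (LINT s|lborel. norm (?f s))" by (rule integral_norm_bound)
  also have "\<dots> \<le> (LINT s|lborel. C * exp (t / 4) * norm (?g s))"
    by (rule integral_mono[OF integrable_norm[OF f] gn le])
  also have "\<dots> = C * exp (t / 4) * (LINT s|lborel. norm (?g s))" by (rule integral_mult_right_zero)
  also have "\<dots> \<le> C * exp (t / 4) * (t * L2_norm m_measure \<phi>)"
    using K_const_nonneg by (intro mult_left_mono weighted_M_L1(2)[OF \<phi> t]) auto
  finally show "norm (LINT s:{0<..<t}|lborel. weighted_M \<phi> s * of_real (K (t - s))) \<le>
      C * exp (t / 4) * (t * L2_norm m_measure \<phi>)"
    by (simp add: set_lebesgue_integral_def)
qed

text \<open>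
The prefactor $\frac1t$ cancels the factor $t$ of the Cauchy-Schwarz estimate.
\<close>

lemma volterra_le:
  assumes \<phi>: "\<phi> \<in> L2 m_measure" and t: "0 < t"
  shows "norm (volterra K \<phi> t) \<le> C * L2_norm m_measure \<phi> * exp (t / 4)"
proof -
  have "norm (volterra K \<phi> t) = 1 / t * norm (LINT s:{0<..<t}|lborel. weighted_M \<phi> s * of_real (K (t - s)))"
    using t by (simp add: volterra_def norm_mult norm_divide)
  also have "\<dots> \<le> 1 / t * (C * exp (t / 4) * (t * L2_norm m_measure \<phi>))"
    using t by (intro mult_left_mono volterra_integrand(2)[OF \<phi> t]) auto
  finally show ?thesis using t by (simp add: ac_simps)
qed

lemma volterra_measurable:
  assumes \<phi>: "\<phi> \<in> L2 m_measure"
  shows "volterra K \<phi> \<in> borel_measurable m_measure"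
proof (rule m_measure_measurableI)
  define H where "H s = indicator {0<..} s *\<^sub>R weighted_M \<phi> s" for s
  have [measurable]: "H \<in> borel_measurable borel"
    unfolding H_def by (rule weighted_M_measurable[OF L2_measurable[OF \<phi>]])
  have e: "indicator {0<..<t} s *\<^sub>R (weighted_M \<phi> s * of_real (K (t - s))) =
      (if s < t then H s * of_real (K (t - s)) else 0)" for s t
    by (auto simp: H_def split: split_indicator)
  have "(\<lambda>t. LINT s|lborel. (if s < t then H s * of_real (K (t - s)) else 0)) \<in> borel_measurable borel"
    by (rule lborel.borel_measurable_lebesgue_integral) measurable
  moreover have "(\<lambda>t. 1 / complex_of_real t) \<in> borel_measurable borel" by measurable
  ultimately show "volterra K \<phi> \<in> borel_measurable borel"
    unfolding volterra_def[abs_def] set_lebesgue_integral_def e by (intro borel_measurable_times)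
qed

text \<open>
The function $e^{t/4}$ has norm 2 in $L^2(m)$.
\<close>

lemma volterra_L2:
  assumes \<phi>: "\<phi> \<in> L2 m_measure"
  shows "volterra K \<phi> \<in> L2 m_measure"
    and "L2_norm m_measure (volterra K \<phi>) \<le> 2 * C * L2_norm m_measure \<phi>"
proof -
  have nn: "0 \<le> C * L2_norm m_measure \<phi>" using K_const_nonneg L2_norm_nonneg by (rule mult_nonneg_nonneg)
  show "volterra K \<phi> \<in> L2 m_measure"
    by (rule L2_of_exp_bound(1)[OF volterra_measurable[OF \<phi>] nn volterra_le[OF \<phi>]])
  show "L2_norm m_measure (volterra K \<phi>) \<le> 2 * C * L2_norm m_measure \<phi>"
    using L2_of_exp_bound(2)[OF volterra_measurable[OF \<phi>] nn volterra_le[OF \<phi>]] by simp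
qed

lemma volterra_add:
  assumes f: "f \<in> L2 m_measure" and g: "g \<in> L2 m_measure" and t: "0 < t"
  shows "volterra K (\<lambda>y. f y + g y) t = volterra K f t + volterra K g t"
proof -
  have "weighted_M (\<lambda>y. f y + g y) s * of_real (K (t - s)) =
      weighted_M f s * of_real (K (t - s)) + weighted_M g s * of_real (K (t - s))" for s
    by (simp add: weighted_M_def M_op_def algebra_simps)
  then show ?thesis
    unfolding volterra_def
    using set_integral_add(2)[OF volterra_integrand(1)[OF f t] volterra_integrand(1)[OF g t]]
    by (simp add: distrib_left)
qed

end

lemma volterra_scale: "volterra K (\<lambda>y. c * f y) t = c * volterra K f t"
proof -
  have "weighted_M (\<lambda>y. c * f y) s * of_real (K (t - s)) = c * (weighted_M f s * of_real (K (t - s)))" for s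
    by (simp add: weighted_M_def M_op_def)
  then show ?thesis unfolding volterra_def by (simp only: set_integral_mult_right) simp
qed

lemma volterra_cong_AE:
  assumes f: "f \<in> L2 m_measure" and g: "g \<in> L2 m_measure"
    and K[measurable]: "K \<in> borel_measurable borel" and ae: "AE x in m_measure. f x = g x"
  shows "volterra K f t = volterra K g t"
proof -
  have m: "(\<lambda>s. indicator {0<..<t} s *\<^sub>R (weighted_M \<phi> s * of_real (K (t - s)))) \<in> borel_measurable lborel"
    if "\<phi> \<in> L2 m_measure" for \<phi>
  proof -
    note [measurable] = weighted_M_measurable[OF L2_measurable[OF that]]
    have "indicator {0<..<t} s *\<^sub>R (weighted_M \<phi> s * of_real (K (t - s))) =
        indicator {0<..<t} s *\<^sub>R ((indicator {0<..} s *\<^sub>R weighted_M \<phi> s) * of_real (K (t - s)))" for s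
      by (auto split: split_indicator)
    then show ?thesis by (simp only:) measurable
  qed
  have "(LINT s:{0<..<t}|lborel. weighted_M f s * of_real (K (t - s))) =
      (LINT s:{0<..<t}|lborel. weighted_M g s * of_real (K (t - s)))"
    unfolding set_lebesgue_integral_def
  proof (rule integral_cong_AE[OF m[OF f] m[OF g]])
    show "AE s in lborel. indicator {0<..<t} s *\<^sub>R (weighted_M f s * of_real (K (t - s))) =
        indicator {0<..<t} s *\<^sub>R (weighted_M g s * of_real (K (t - s)))"
      using ae unfolding AE_m_measure_iff
      by eventually_elim (auto simp: weighted_M_def M_op_def split: split_indicator)
  qed
  then show ?thesis by (simp add: volterra_def)
qed

lemma volterra_sum_kernel:
  assumes "\<And>i. i \<in> I \<Longrightarrow> set_integrable lborel {0<..<t} (\<lambda>s. weighted_M \<phi> s * of_real (K i (t - s)))"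
  shows "volterra (\<lambda>u. \<Sum>i\<in>I. b i * K i u) \<phi> t = (\<Sum>i\<in>I. of_real (b i) * volterra (K i) \<phi> t)"
proof -
  have e: "indicator {0<..<t} s *\<^sub>R (weighted_M \<phi> s * of_real (\<Sum>i\<in>I. b i * K i (t - s))) =
      (\<Sum>i\<in>I. of_real (b i) * (indicator {0<..<t} s *\<^sub>R (weighted_M \<phi> s * of_real (K i (t - s)))))" for s
    by (simp add: sum_distrib_left scaleR_sum_right mult.left_commute)
  have "(LINT s:{0<..<t}|lborel. weighted_M \<phi> s * of_real (\<Sum>i\<in>I. b i * K i (t - s))) =
      (\<Sum>i\<in>I. of_real (b i) * (LINT s:{0<..<t}|lborel. weighted_M \<phi> s * of_real (K i (t - s))))"
    unfolding set_lebesgue_integral_def e integral_mult_right_zero[symmetric]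
    by (intro Bochner_Integration.integral_sum integrable_mult_right assms[unfolded set_integrable_def])
  then show ?thesis
    unfolding volterra_def by (simp only: sum_distrib_left) (simp add: mult.left_commute)
qed

lemma volterra_diff_kernel:
  assumes "set_integrable lborel {0<..<t} (\<lambda>s. weighted_M \<phi> s * of_real (K (t - s)))"
    "set_integrable lborel {0<..<t} (\<lambda>s. weighted_M \<phi> s * of_real (L (t - s)))"
  shows "volterra (\<lambda>u. K u - L u) \<phi> t = volterra K \<phi> t - volterra L \<phi> t"
proof -
  have "weighted_M \<phi> s * of_real (K (t - s) - L (t - s)) =
      weighted_M \<phi> s * of_real (K (t - s)) - weighted_M \<phi> s * of_real (L (t - s))" for s
    by (simp add: right_diff_distrib)
  then show ?thesis
    unfolding volterra_def by (simp only: set_integral_diff(2)[OF assms] right_diff_distrib)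
qed

lemma volterra_scale_kernel:
  "volterra (\<lambda>u. r * K u) \<phi> t = of_real r * volterra K \<phi> t"
proof -
  have "weighted_M \<phi> s * of_real (r * K (t - s)) = of_real r * (weighted_M \<phi> s * of_real (K (t - s)))" for s
    by simp
  then show ?thesis unfolding volterra_def by (simp only: set_integral_mult_right) simp
qed

text \<open>
The atom contributes $c\,t\,(M\varphi)(t)$ and the density, after the reflection $s = t - u$, a Volterra
integral. At the end point $s = 0$ the weight $s$ vanishes, so that it does not matter that functions in $L^2(m)$ are
measurable only on the open half-line.
\<close>

lemma convolution_atom_minus:
  assumes w[measurable]: "w \<in> borel_measurable borel"
    and w_int: "\<And>x. 0 < x \<Longrightarrow> set_integrable lborel {0<..} (\<lambda>t. exp (- (x * t)) * w t)"
    and w_le: "\<And>u. 0 \<le> u \<Longrightarrow> \<bar>w u\<bar> \<le> C * exp (1 / 4 * u)"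
    and \<phi>: "\<phi> \<in> L2 m_measure" and t: "0 < t"
  shows "Defs.convolution (\<lambda>s. of_real s * M_op \<phi> s) (atom_minus_measure c w) t =
    of_real c * (of_real t * M_op \<phi> t) - of_real t * volterra w \<phi> t"
proof -
  define H where "H s = indicator {0<..} s *\<^sub>R weighted_M \<phi> s" for s
  have [measurable]: "H \<in> borel_measurable borel"
    unfolding H_def by (rule weighted_M_measurable[OF L2_measurable[OF \<phi>]])
  define F where "F u = indicator {0..t} u * H (t - u)" for u
  have F_eq: "indicator {0..t} u * (of_real (t - u) * M_op \<phi> (t - u)) = F u" for u
    by (auto simp: F_def H_def weighted_M_def split: split_indicator)
  have F_meas: "F \<in> borel_measurable borel" unfolding F_def by measurable
  define G where "G s = indicator {0<..<t} s *\<^sub>R (weighted_M \<phi> s * of_real (w (t - s)))" for s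
  have G_int: "integrable lborel G"
    using volterra_integrand(1)[OF w w_le \<phi> t] unfolding set_integrable_def G_def[abs_def] by blast
  have FG: "indicator {0<..} u *\<^sub>R (F u * of_real (w u)) = G (t + (-1) * u)" for u
    by (auto simp: F_def G_def H_def split: split_indicator)
  have int: "set_integrable lborel {0<..} (\<lambda>u. F u * of_real (w u))"
    unfolding set_integrable_def FG by (rule lborel_integrable_real_affine[OF G_int]) simp
  have "(LINT u:{0<..}|lborel. F u * of_real (w u)) = (LINT s|lborel. G s)"
    unfolding set_lebesgue_integral_def FG
    using lborel_integral_real_affine[of "-1" G t] by simp
  also have "\<dots> = of_real t * volterra w \<phi> t"
    using t by (simp add: volterra_def G_def set_lebesgue_integral_def)
  finally have "cm_integral (atom_minus_measure c w) F = F 0 * of_real c - of_real t * volterra w \<phi> t"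
    using cm_integral_atom_minus[OF w w_int F_meas int] by simp
  moreover have "F 0 = of_real t * M_op \<phi> t"
    using t by (simp add: F_def H_def weighted_M_def)
  ultimately show ?thesis
    unfolding Defs.convolution_def F_eq by (simp add: mult.commute)
qed

section \<open>The operator $\tilde M_\mu$\<close>

lemma inverse_laplace_xi:
  "inverse_laplace (\<lambda>x. of_real (\<xi> \<mu> (1 / x) a)) =
     atom_minus_measure ((1 + Erf (\<mu> * a)) / 2) (\<lambda>u. 1 / sqrt pi * erf_kernel \<mu> a u)"
proof (rule inverse_laplace_atom_minus)
  show "(\<lambda>u. 1 / sqrt pi * erf_kernel \<mu> a u) \<in> borel_measurable borel" by measurable
  fix x :: real assume x: "0 < x"
  have e: "exp (- (x * t)) * (1 / sqrt pi * erf_kernel \<mu> a t) = 1 / sqrt pi * (exp (- (x * t)) * erf_kernel \<mu> a t)" for t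
    by simp
  show "set_integrable lborel {0<..} (\<lambda>t. exp (- (x * t)) * (1 / sqrt pi * erf_kernel \<mu> a t))"
    unfolding e using kernel_laplace(1)[OF x] by (rule set_integrable_mult_right)
  have "(LINT t:{0<..}|lborel. exp (- (x * t)) * (1 / sqrt pi * erf_kernel \<mu> a t)) =
      1 / sqrt pi * (sqrt pi / 2 * (Erf (\<mu> * (1 / x - a)) + Erf (\<mu> * a)))"
    unfolding e set_integral_mult_right kernel_laplace(2)[OF x] ..
  then show "complex_of_real (\<xi> \<mu> (1 / x) a) = of_real ((1 + Erf (\<mu> * a)) / 2 -
      (LINT t:{0<..}|lborel. exp (- (x * t)) * (1 / sqrt pi * erf_kernel \<mu> a t)))"
    by (simp add: \<xi>_def field_simps)
qed

lemma M_tilde_eq: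
  assumes \<phi>: "\<phi> \<in> L2 m_measure" and t: "0 < t"
  shows "M_tilde \<mu> \<epsilon> \<phi> t = of_real (1 / 2 * (1 - Erf (\<mu> * (\<epsilon> / (1 - \<epsilon>))))) * M_op \<phi> t
    + of_real (1 / sqrt pi) * volterra (erf_kernel \<mu> (\<epsilon> / (1 - \<epsilon>))) \<phi> t"
proof -
  let ?a = "\<epsilon> / (1 - \<epsilon>)"
  let ?w = "\<lambda>u. 1 / sqrt pi * erf_kernel \<mu> ?a u"
  let ?c = "(1 + Erf (\<mu> * ?a)) / 2"
  have m: "?w \<in> borel_measurable borel" by measurable
  have i: "set_integrable lborel {0<..} (\<lambda>t. exp (- (x * t)) * ?w t)" if "0 < x" for x
    using set_integrable_mult_right[OF kernel_laplace(1)[OF that], of "1 / sqrt pi" \<mu> ?a]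
    by (simp only: mult.left_commute)
  have b: "\<bar>?w u\<bar> \<le> 1 / sqrt pi * (\<Sum>n. kernel_bound \<mu> ?a (1 / 4) n) * exp (1 / 4 * u)" if "0 \<le> u" for u
    using mult_left_mono[OF kernel_le[of "1 / 4" u \<mu> ?a], of "1 / sqrt pi"] that
    by (simp add: abs_mult)
  have conv: "Defs.convolution (\<lambda>s. of_real s * M_op \<phi> s) (atom_minus_measure ?c ?w) t =
      of_real ?c * (of_real t * M_op \<phi> t) - of_real t * volterra ?w \<phi> t"
    by (rule convolution_atom_minus[OF m i b \<phi> t])
  have "M_tilde \<mu> \<epsilon> \<phi> t = M_op \<phi> t - 1 / of_real t *
      (of_real ?c * (of_real t * M_op \<phi> t) - of_real t * volterra ?w \<phi> t)"
    unfolding M_tilde_def inverse_laplace_xi conv ..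
  also have "\<dots> = M_op \<phi> t - of_real ?c * M_op \<phi> t + volterra ?w \<phi> t"
    using t by (simp add: right_diff_distrib)
  also have "\<dots> = of_real (1 - ?c) * M_op \<phi> t + volterra ?w \<phi> t"
    by (simp only: of_real_diff of_real_1 left_diff_distrib mult_1_left)
  also have "1 - ?c = 1 / 2 * (1 - Erf (\<mu> * ?a))" by (simp add: field_simps)
  finally show ?thesis unfolding volterra_scale_kernel .
qed

lemma power_bound:
  fixes u :: real
  assumes "0 \<le> u"
  shows "\<bar>u ^ j\<bar> \<le> fact j * 4 ^ j * exp (1 / 4 * u)"
  using power_le_exp[of "1 / 4" u j] assms by (simp add: field_simps)

lemma volterra_kernel_term:
  assumes \<phi>: "\<phi> \<in> L2 m_measure" and t: "0 < t"
  shows "volterra (kernel_term \<mu> a n) \<phi> t = (\<Sum>k=1..2 * n + 1. of_real (kernel_coeff \<mu> a n k) *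
    (1 / of_real t * (LBINT s=0..ereal t. of_real s * M_op \<phi> s * of_real ((t - s) ^ (k - 1)))))"
proof -
  have "volterra (kernel_term \<mu> a n) \<phi> t =
      (\<Sum>k=1..2 * n + 1. of_real (kernel_coeff \<mu> a n k) * volterra (\<lambda>u. u ^ (k - 1)) \<phi> t)"
    unfolding kernel_term_def[abs_def]
    by (intro volterra_sum_kernel volterra_integrand(1)[OF _ power_bound \<phi> t]) measurable
  moreover have "(LBINT s=0..ereal t. f s) = (LINT s:{0<..<t}|lborel. f s)" for f :: "real \<Rightarrow> complex"
    using t by (simp add: interval_lebesgue_integral_def zero_ereal_def einterval_eq)
  ultimately show ?thesis by (simp only: volterra_def weighted_M_def)
qed

text \<open>
The difference between a partial sum and the limit is again a Volterra operator, and its kernel is bounded by the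
tail of the summable constants.
\<close>

lemma volterra_kernel_series:
  assumes \<phi>: "\<phi> \<in> L2 m_measure"
  shows "L2_sums m_measure (\<lambda>n. volterra (kernel_term \<mu> a n) \<phi>) (volterra (erf_kernel \<mu> a) \<phi>)"
  unfolding L2_sums_def
proof (intro conjI allI)
  have q: "0 < (1 / 4 :: real)" by simp
  have int_term: "set_integrable lborel {0<..<t} (\<lambda>s. weighted_M \<phi> s * of_real (kernel_term \<mu> a n (t - s)))"
    if "0 < t" for n t
    by (rule volterra_integrand(1)[OF kernel_term_measurable kernel_term_le[OF q] \<phi> that])
  have int_kernel: "set_integrable lborel {0<..<t} (\<lambda>s. weighted_M \<phi> s * of_real (erf_kernel \<mu> a (t - s)))"
    if "0 < t" for t
    by (rule volterra_integrand(1)[OF kernel_measurable kernel_le[OF q] \<phi> that])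
  show "volterra (kernel_term \<mu> a n) \<phi> \<in> L2 m_measure" for n
    by (rule volterra_L2(1)[OF kernel_term_measurable kernel_term_le[OF q] \<phi>])
  show "volterra (erf_kernel \<mu> a) \<phi> \<in> L2 m_measure"
    by (rule volterra_L2(1)[OF kernel_measurable kernel_le[OF q] \<phi>])
  define R where "R N = (\<Sum>n. kernel_bound \<mu> a (1 / 4) (n + N))" for N
  let ?D = "\<lambda>N u. (\<Sum>n<N. kernel_term \<mu> a n u) - erf_kernel \<mu> a u"
  have bound: "L2_norm m_measure (\<lambda>t. (\<Sum>n<N. volterra (kernel_term \<mu> a n) \<phi> t) - volterra (erf_kernel \<mu> a) \<phi> t)
      \<le> 2 * R N * L2_norm m_measure \<phi>" for N
  proof -
    have m: "?D N \<in> borel_measurable borel" by measurable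
    have ms: "(\<lambda>u. \<Sum>n<N. kernel_term \<mu> a n u) \<in> borel_measurable borel" by measurable
    have bs: "\<bar>\<Sum>n<N. kernel_term \<mu> a n u\<bar> \<le> (\<Sum>n<N. kernel_bound \<mu> a (1 / 4) n) * exp (1 / 4 * u)" if "0 \<le> u" for u
      unfolding sum_distrib_right by (rule order_trans[OF sum_abs sum_mono[OF kernel_term_le[OF q that]]])
    have "(\<Sum>n<N. volterra (kernel_term \<mu> a n) \<phi> t) - volterra (erf_kernel \<mu> a) \<phi> t = volterra (?D N) \<phi> t"
      if "t \<in> space m_measure" for t
    proof -
      have t: "0 < t" using that by (simp add: m_measure_space)
      have "volterra (\<lambda>u. \<Sum>n<N. kernel_term \<mu> a n u) \<phi> t = (\<Sum>n<N. volterra (kernel_term \<mu> a n) \<phi> t)"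
        using volterra_sum_kernel[where I = "{..<N}" and K = "kernel_term \<mu> a" and b = "\<lambda>_. 1", OF int_term[OF t]]
        by simp
      moreover have "volterra (?D N) \<phi> t =
          volterra (\<lambda>u. \<Sum>n<N. kernel_term \<mu> a n u) \<phi> t - volterra (erf_kernel \<mu> a) \<phi> t"
        by (rule volterra_diff_kernel[OF volterra_integrand(1)[OF ms bs \<phi> t] int_kernel[OF t]])
      ultimately show ?thesis by (simp only:)
    qed
    then have "L2_norm m_measure (\<lambda>t. (\<Sum>n<N. volterra (kernel_term \<mu> a n) \<phi> t) - volterra (erf_kernel \<mu> a) \<phi> t)
        = L2_norm m_measure (volterra (?D N) \<phi>)"
      by (rule L2_norm_cong)
    also have "\<dots> \<le> 2 * R N * L2_norm m_measure \<phi>"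
      unfolding R_def by (rule volterra_L2(2)[OF m kernel_partial_sum_le[OF q] \<phi>])
    finally show ?thesis .
  qed
  have "R \<longlonglongrightarrow> 0"
  proof -
    note s = kernel_bound_summable[of \<mu> a "1 / 4"]
    have "R = (\<lambda>N. (\<Sum>n. kernel_bound \<mu> a (1 / 4) n) - (\<Sum>n<N. kernel_bound \<mu> a (1 / 4) n))"
      unfolding R_def using suminf_minus_initial_segment[OF s] by (simp add: fun_eq_iff)
    moreover have "(\<lambda>N. (\<Sum>n. kernel_bound \<mu> a (1 / 4) n) - (\<Sum>n<N. kernel_bound \<mu> a (1 / 4) n))
        \<longlonglongrightarrow> (\<Sum>n. kernel_bound \<mu> a (1 / 4) n) - (\<Sum>n. kernel_bound \<mu> a (1 / 4) n)"
      by (rule tendsto_diff[OF tendsto_const summable_LIMSEQ[OF s]])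
    ultimately show ?thesis by simp
  qed
  from tendsto_mult[OF tendsto_mult[OF tendsto_const[of 2] this] tendsto_const[of "L2_norm m_measure \<phi>"]]
  have lim: "(\<lambda>N. 2 * R N * L2_norm m_measure \<phi>) \<longlonglongrightarrow> 0" by simp
  show "(\<lambda>N. L2_norm m_measure (\<lambda>t. (\<Sum>n<N. volterra (kernel_term \<mu> a n) \<phi> t) - volterra (erf_kernel \<mu> a) \<phi> t)) \<longlonglongrightarrow> 0"
    by (rule tendsto_sandwich[OF _ _ tendsto_const lim]) (auto simp: L2_norm_nonneg bound)
qed

lemma scaled_M_op_L2:
  assumes f: "f \<in> L2 m_measure"
  shows "(\<lambda>t. of_real r * M_op f t) \<in> L2 m_measure"
    and "(L2_norm m_measure (\<lambda>t. of_real r * M_op f t))\<^sup>2 \<le> r\<^sup>2 * (L2_norm m_measure f)\<^sup>2"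
proof -
  note [measurable] = L2_measurable[OF f]
  have [measurable]: "(\<lambda>t. complex_of_real (exp (- t))) \<in> borel_measurable m_measure"
    by (rule m_measure_measurableI) measurable
  have m: "(\<lambda>t. of_real r * M_op f t) \<in> borel_measurable m_measure"
    unfolding M_op_def by measurable
  have i: "integrable m_measure (\<lambda>t. r\<^sup>2 * (norm (f t))\<^sup>2)"
    by (intro integrable_mult_right L2_square_integrable[OF f])
  have le: "(norm (of_real r * M_op f t))\<^sup>2 \<le> r\<^sup>2 * (norm (f t))\<^sup>2" if "t \<in> space m_measure" for t
  proof -
    have "exp (- t) * norm (f t) \<le> 1 * norm (f t)"
      using that by (intro mult_right_mono) (auto simp: m_measure_space)
    then have "norm (of_real r * M_op f t) \<le> \<bar>r\<bar> * norm (f t)"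
      by (simp add: M_op_def norm_mult mult_left_mono)
    from power_mono[OF this, of 2] show ?thesis by (simp add: power_mult_distrib)
  qed
  show "(\<lambda>t. of_real r * M_op f t) \<in> L2 m_measure"
    by (rule L2_of_square_bound(1)[OF m i le])
  show "(L2_norm m_measure (\<lambda>t. of_real r * M_op f t))\<^sup>2 \<le> r\<^sup>2 * (L2_norm m_measure f)\<^sup>2"
    using L2_of_square_bound(2)[OF m i le] by (simp add: L2_norm_square)
qed

text \<open>
Boundedness of $\tilde M_\mu$ follows from its shape alone: at each $t > 0$ it is a multiple of $M$, which is a
contraction, plus a Volterra operator with an exponentially bounded kernel.
\<close>

lemma bounded_operator_multiplication_plus_volterra:
  fixes T :: "(real \<Rightarrow> complex) \<Rightarrow> real \<Rightarrow> complex" and r :: real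
  assumes K: "K \<in> borel_measurable borel"
    and K_le: "\<And>u. 0 \<le> u \<Longrightarrow> \<bar>K u\<bar> \<le> C * exp (1 / 4 * u)"
    and T: "\<And>f t. f \<in> L2 m_measure \<Longrightarrow> 0 < t \<Longrightarrow> T f t = of_real r * M_op f t + volterra K f t"
  shows "bounded_operator_L2 m_measure T"
proof -
  let ?R = "\<lambda>f t. of_real r * M_op f t + volterra K f t"
  have T': "T f t = ?R f t" if "f \<in> L2 m_measure" "t \<in> space m_measure" for f t
    using T that by (simp add: m_measure_space)
  have L2: "T f \<in> L2 m_measure" if f: "f \<in> L2 m_measure" for f
    by (rule L2_cong[OF T'[OF f, symmetric] L2_add(1)[OF scaled_M_op_L2(1)[OF f] volterra_L2(1)[OF K K_le f]]])
  have add: "(\<lambda>y. f y + g y) \<in> L2 m_measure" if "f \<in> L2 m_measure" "g \<in> L2 m_measure" for f g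
    by (rule L2_add(1)[OF that])
  have cong: "AE x in m_measure. T f x = T g x"
    if f: "f \<in> L2 m_measure" and g: "g \<in> L2 m_measure" and ae: "AE x in m_measure. f x = g x" for f g
    using ae
  proof (rule AE_mp, intro AE_I2 impI)
    fix x assume "x \<in> space m_measure" "f x = g x"
    then show "T f x = T g x"
      using volterra_cong_AE[OF f g K ae] by (simp add: T' f g M_op_def)
  qed
  have additive: "AE x in m_measure. T (\<lambda>y. f y + g y) x = T f x + T g x"
    if f: "f \<in> L2 m_measure" and g: "g \<in> L2 m_measure" for f g
  proof (rule AE_I2)
    fix x assume x: "x \<in> space m_measure"
    then have "volterra K (\<lambda>y. f y + g y) x = volterra K f x + volterra K g x"
      by (intro volterra_add[OF K K_le f g]) (simp_all add: m_measure_space)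
    then show "T (\<lambda>y. f y + g y) x = T f x + T g x"
      using x by (simp add: T' f g add M_op_def distrib_left)
  qed
  have scale: "AE x in m_measure. T (\<lambda>y. c * f y) x = c * T f x"
    if f: "f \<in> L2 m_measure" for c f
    by (rule AE_I2) (simp add: T' f L2_scale[OF f] M_op_def volterra_scale distrib_left)
  have bound: "L2_norm m_measure (T f) \<le> sqrt (2 * r\<^sup>2 + 8 * C\<^sup>2) * L2_norm m_measure f"
    if f: "f \<in> L2 m_measure" for f
  proof -
    let ?N = "L2_norm m_measure f"
    have "L2_norm m_measure (T f) = L2_norm m_measure (?R f)"
      by (rule L2_norm_cong) (rule T'[OF f])
    then have "(L2_norm m_measure (T f))\<^sup>2 \<le>
        2 * (L2_norm m_measure (\<lambda>t. of_real r * M_op f t))\<^sup>2 + 2 * (L2_norm m_measure (volterra K f))\<^sup>2"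
      using L2_add(2)[OF scaled_M_op_L2(1)[OF f] volterra_L2(1)[OF K K_le f]] by simp
    moreover have "(L2_norm m_measure (volterra K f))\<^sup>2 \<le> (2 * C * ?N)\<^sup>2"
      by (rule power_mono[OF volterra_L2(2)[OF K K_le f] L2_norm_nonneg])
    ultimately have "(L2_norm m_measure (T f))\<^sup>2 \<le> 2 * (r\<^sup>2 * ?N\<^sup>2) + 2 * (2 * C * ?N)\<^sup>2"
      using scaled_M_op_L2(2)[OF f, of r] by linarith
    also have "\<dots> = (sqrt (2 * r\<^sup>2 + 8 * C\<^sup>2) * ?N)\<^sup>2"
      by (simp add: power_mult_distrib algebra_simps)
    finally show ?thesis
      by (rule power2_le_imp_le) (simp add: L2_norm_nonneg)
  qed
  show ?thesis
    unfolding bounded_operator_L2_def using L2 cong additive scale bound by blast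
qed

theorem theorem2p1:
  fixes \<mu> \<epsilon> :: real
  assumes "\<epsilon> \<noteq> 1"
  shows "(\<forall>\<phi>\<in>L2 m_measure. \<exists>S.
            L2_sums m_measure
              (\<lambda>n t. \<Sum>k=1..2 * n + 1.
                 complex_of_real
                   (real ((2 * n + 1) choose k) * ((- 1) ^ (n + k - 1) * \<mu> ^ (2 * n + 1)
                      / (fact n * fact (k - 1) * real (2 * n + 1)))
                    * (\<epsilon> / (1 - \<epsilon>)) ^ (2 * n + 1 - k))
                 * (1 / complex_of_real t
                    * (LBINT s=0..ereal t.
                         complex_of_real s * M_op \<phi> s * complex_of_real ((t - s) ^ (k - 1)))))
              S \<and>
            (AE t in m_measure.
               M_tilde \<mu> \<epsilon> \<phi> t =
                 complex_of_real (1 / 2 * (1 - Erf (\<mu> * \<epsilon> / (1 - \<epsilon>)))) * M_op \<phi> t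
                 + complex_of_real (1 / sqrt pi) * S t)) \<and>
         bounded_operator_L2 m_measure (M_tilde \<mu> \<epsilon>)"
proof (intro conjI ballI)
  let ?a = "\<epsilon> / (1 - \<epsilon>)"
  fix \<phi> assume \<phi>: "\<phi> \<in> L2 m_measure"
  let ?f = "\<lambda>n t. \<Sum>k=1..2 * n + 1. complex_of_real (kernel_coeff \<mu> ?a n k) *
    (1 / complex_of_real t * (LBINT s=0..ereal t. complex_of_real s * M_op \<phi> s * complex_of_real ((t - s) ^ (k - 1))))"
  have "L2_sums m_measure ?f (volterra (erf_kernel \<mu> ?a) \<phi>)"
  proof -
    have eq: "volterra (kernel_term \<mu> ?a n) \<phi> t = ?f n t" if "t \<in> space m_measure" for n t
      using that by (intro volterra_kernel_term[OF \<phi>]) (simp add: m_measure_space)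
    have k: "volterra (kernel_term \<mu> ?a n) \<phi> \<in> L2 m_measure" for n
      using volterra_kernel_series[OF \<phi>, of \<mu> ?a] unfolding L2_sums_def by blast
    have "?f n \<in> L2 m_measure" for n
      by (rule L2_cong[OF eq k])
    moreover have "L2_norm m_measure (\<lambda>t. (\<Sum>n<N. ?f n t) - volterra (erf_kernel \<mu> ?a) \<phi> t) =
        L2_norm m_measure (\<lambda>t. (\<Sum>n<N. volterra (kernel_term \<mu> ?a n) \<phi> t) - volterra (erf_kernel \<mu> ?a) \<phi> t)" for N
      by (rule L2_norm_cong) (simp only: eq)
    ultimately show ?thesis
      using volterra_kernel_series[OF \<phi>, of \<mu> ?a] unfolding L2_sums_def by presburger
  qed
  moreover have "AE t in m_measure. M_tilde \<mu> \<epsilon> \<phi> t =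
      complex_of_real (1 / 2 * (1 - Erf (\<mu> * \<epsilon> / (1 - \<epsilon>)))) * M_op \<phi> t
      + complex_of_real (1 / sqrt pi) * volterra (erf_kernel \<mu> ?a) \<phi> t"
    by (rule AE_I2) (simp only: M_tilde_eq[OF \<phi>] m_measure_space greaterThan_iff times_divide_eq_right)
  ultimately show "\<exists>S. L2_sums m_measure
      (\<lambda>n t. \<Sum>k=1..2 * n + 1.
         complex_of_real
           (real ((2 * n + 1) choose k) * ((- 1) ^ (n + k - 1) * \<mu> ^ (2 * n + 1)
              / (fact n * fact (k - 1) * real (2 * n + 1)))
            * (\<epsilon> / (1 - \<epsilon>)) ^ (2 * n + 1 - k))
         * (1 / complex_of_real t
            * (LBINT s=0..ereal t.
                 complex_of_real s * M_op \<phi> s * complex_of_real ((t - s) ^ (k - 1))))) S \<and>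
      (AE t in m_measure. M_tilde \<mu> \<epsilon> \<phi> t =
         complex_of_real (1 / 2 * (1 - Erf (\<mu> * \<epsilon> / (1 - \<epsilon>)))) * M_op \<phi> t
         + complex_of_real (1 / sqrt pi) * S t)"
    unfolding kernel_coeff_def by blast
next
  let ?a = "\<epsilon> / (1 - \<epsilon>)"
  let ?K = "\<lambda>u. 1 / sqrt pi * erf_kernel \<mu> ?a u"
  show "bounded_operator_L2 m_measure (M_tilde \<mu> \<epsilon>)"
  proof (rule bounded_operator_multiplication_plus_volterra)
    show "?K \<in> borel_measurable borel" by measurable
    show "\<bar>?K u\<bar> \<le> 1 / sqrt pi * (\<Sum>n. kernel_bound \<mu> ?a (1 / 4) n) * exp (1 / 4 * u)" if "0 \<le> u" for u
      using mult_left_mono[OF kernel_le[of "1 / 4" u \<mu> ?a], of "1 / sqrt pi"] that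
      by (simp add: abs_mult)
    show "M_tilde \<mu> \<epsilon> f t = of_real (1 / 2 * (1 - Erf (\<mu> * ?a))) * M_op f t + volterra ?K f t"
      if "f \<in> L2 m_measure" "0 < t" for f t
      unfolding volterra_scale_kernel by (rule M_tilde_eq[OF that])
  qed
qed

end
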